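(* There is an absolute constant $c\ge 1$ such that the following holds. Let $\mathcal{P}$ be a hereditary graph property and let $\varepsilon\in(0,1)$. Let $M\ge 1$ be an integer, $\delta\in(0,1]$, and $n_0\ge 1$ an integer such that every graph $G$ on $n\ge n_0$ vertices which is $(\varepsilon/2)$-far from $\mathcal{P}$ admits a graph $F\notin\mathcal{P}$ with $|V(F)|\le M$ and $ind(F,G)\ge\delta$. Then there is a distance estimator for $\mathcal{P}$ with parameter $\varepsilon$ whose query complexity is at most $2^{(M/\delta+\log_2 n_0)^{c}}$. That is, there is a randomized algorithm which, given any real $\alpha$ and edge-query access to any graph $G$ (on any number of vertices), makes at most $2^{(M/\delta+\log_2 n_0)^{c}}$ edge queries and, with probability at least $2/3$, outputs "close" if $G$ is $(\alpha-\varepsilon)$-close to $\mathcal{P}$ and outputs "far" if $G$ is $\alpha$-far from $\mathcal{P}$.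
   Context: Graphs are finite and simple. A graph property is a family of graphs closed under isomorphism; it is hereditary if it is closed under taking induced subgraphs (vertex removal). For a graph $G$ on $n$ vertices and $\beta\ge 0$, $G$ is $\beta$-far from $\mathcal{P}$ if one must add/delete at least $\beta n^2$ edges of $G$ to obtain a graph satisfying $\mathcal{P}$; otherwise $G$ is $\beta$-close to $\mathcal{P}$. For graphs $F,G$, $ind(F,G)$ denotes the probability that a uniformly random map $\varphi:V(F)\to V(G)$ is injective and is an induced homomorphism (i.e. $uv\in E(F)$ iff $\varphi(u)\varphi(v)\in E(G)$). An edge query asks, for two vertices $i,j$ of $G$, whether $ij$ is an edge; the algorithm knows the number of vertices of $G$. *)

theory Defs
  imports "HOL-Probability.Probability"
begin

text \<open>Vertices are natural numbers; every finite graph has an isomorphic copy of this kind.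
  The graph without vertices is allowed.\<close>

record graph =
  verts :: "nat set"
  edges :: "nat set set"

definition simple_graph :: "graph \<Rightarrow> bool" where
  "simple_graph G \<longleftrightarrow> finite (verts G) \<and> (\<forall>e\<in>edges G. e \<subseteq> verts G \<and> card e = 2)"

definition graph_iso :: "graph \<Rightarrow> graph \<Rightarrow> bool" where
  "graph_iso G H \<longleftrightarrow> (\<exists>f. bij_betw f (verts G) (verts H) \<and>
     (\<forall>u\<in>verts G. \<forall>v\<in>verts G. {u, v} \<in> edges G \<longleftrightarrow> {f u, f v} \<in> edges H))"

definition induced_subgraph :: "graph \<Rightarrow> nat set \<Rightarrow> graph" where
  "induced_subgraph G U = \<lparr>verts = U, edges = {e \<in> edges G. e \<subseteq> U}\<rparr>"

definition graph_property :: "graph set \<Rightarrow> bool" where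
  "graph_property P \<longleftrightarrow> (\<forall>G\<in>P. simple_graph G) \<and>
     (\<forall>G\<in>P. \<forall>H. simple_graph H \<and> graph_iso G H \<longrightarrow> H \<in> P)"

definition hereditary :: "graph set \<Rightarrow> bool" where
  "hereditary P \<longleftrightarrow> graph_property P \<and> (\<forall>G\<in>P. \<forall>U\<subseteq>verts G. induced_subgraph G U \<in> P)"

text \<open>If no graph on the vertex set of \<open>G\<close> satisfies \<open>P\<close>, then \<open>G\<close> is \<open>\<beta>\<close>-far for every \<open>\<beta>\<close>.
  The definition is used verbatim for negative \<open>\<beta>\<close>, where every graph is \<open>\<beta>\<close>-far.\<close>

definition far_from :: "graph set \<Rightarrow> real \<Rightarrow> graph \<Rightarrow> bool" where
  "far_from P \<beta> G \<longleftrightarrow> (\<forall>H\<in>P. verts H = verts G \<longrightarrow>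
     real (card (sym_diff (edges G) (edges H))) \<ge> \<beta> * real (card (verts G)) ^ 2)"

definition close_to :: "graph set \<Rightarrow> real \<Rightarrow> graph \<Rightarrow> bool" where
  "close_to P \<beta> G \<longleftrightarrow> \<not> far_from P \<beta> G"

text \<open>Meaningful when \<open>G\<close> has a vertex; otherwise there may be no map to choose from.\<close>

definition ind :: "graph \<Rightarrow> graph \<Rightarrow> real" where
  "ind F G = measure_pmf.prob (pmf_of_set (verts F \<rightarrow>\<^sub>E verts G))
     {\<phi>. inj_on \<phi> (verts F) \<and>
         (\<forall>u\<in>verts F. \<forall>v\<in>verts F. {u, v} \<in> edges F \<longleftrightarrow> {\<phi> u, \<phi> v} \<in> edges G)}"

datatype verdict = Close | Far

text \<open>A deterministic adaptive algorithm making edge queries is a decision tree: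
  \<open>Query i j s t\<close> asks for the pair \<open>i\<close>, \<open>j\<close> and continues with \<open>s\<close> if it is an edge and
  with \<open>t\<close> otherwise. A randomized algorithm is a probability distribution on decision trees,
  depending on the inputs: the real number \<open>\<alpha>\<close> and the number \<open>n\<close> of vertices.\<close>

datatype decision_tree = Output verdict | Query nat nat decision_tree decision_tree

type_synonym randomized_algorithm = "real \<Rightarrow> nat \<Rightarrow> decision_tree pmf"

fun run :: "(nat \<Rightarrow> nat \<Rightarrow> bool) \<Rightarrow> decision_tree \<Rightarrow> verdict" where
  "run adj (Output r) = r"
| "run adj (Query i j s t) = run adj (if adj i j then s else t)"

fun queries :: "(nat \<Rightarrow> nat \<Rightarrow> bool) \<Rightarrow> decision_tree \<Rightarrow> (nat \<times> nat) list" where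
  "queries adj (Output r) = []"
| "queries adj (Query i j s t) = (i, j) # queries adj (if adj i j then s else t)"

text \<open>The algorithm addresses the vertices of the input graph by the indices \<open>0, \<dots>, n - 1\<close>
  with respect to an arbitrary enumeration that is unknown to it.\<close>

definition enumerates :: "(nat \<Rightarrow> nat) \<Rightarrow> graph \<Rightarrow> bool" where
  "enumerates x G \<longleftrightarrow> bij_betw x {..<card (verts G)} (verts G)"

definition edge_access :: "(nat \<Rightarrow> nat) \<Rightarrow> graph \<Rightarrow> nat \<Rightarrow> nat \<Rightarrow> bool" where
  "edge_access x G i j \<longleftrightarrow> {x i, x j} \<in> edges G"

definition legal_queries :: "randomized_algorithm \<Rightarrow> bool" where
  "legal_queries A \<longleftrightarrow> (\<forall>\<alpha> G x. simple_graph G \<and> enumerates x G \<longrightarrow>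
     (\<forall>T\<in>set_pmf (A \<alpha> (card (verts G))). \<forall>(i, j)\<in>set (queries (edge_access x G) T).
        i < card (verts G) \<and> j < card (verts G) \<and> i \<noteq> j))"

definition distance_estimator :: "graph set \<Rightarrow> real \<Rightarrow> randomized_algorithm \<Rightarrow> bool" where
  "distance_estimator P \<epsilon> A \<longleftrightarrow> legal_queries A \<and>
     (\<forall>\<alpha> G x. simple_graph G \<and> enumerates x G \<longrightarrow>
        (close_to P (\<alpha> - \<epsilon>) G \<longrightarrow>
           measure_pmf.prob (A \<alpha> (card (verts G))) {T. run (edge_access x G) T = Close} \<ge> 2/3) \<and>
        (far_from P \<alpha> G \<longrightarrow>
           measure_pmf.prob (A \<alpha> (card (verts G))) {T. run (edge_access x G) T = Far} \<ge> 2/3))"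

definition query_complexity_at_most :: "randomized_algorithm \<Rightarrow> real \<Rightarrow> bool" where
  "query_complexity_at_most A q \<longleftrightarrow> (\<forall>\<alpha> G x. simple_graph G \<and> enumerates x G \<longrightarrow>
     (\<forall>T\<in>set_pmf (A \<alpha> (card (verts G))). real (length (queries (edge_access x G) T)) \<le> q))"

end

theory Submission
  imports Defs
begin

text \<open>The estimator samples \<open>s\<close> vertices, computes the distance of the sampled graph to \<open>P\<close> exactly and
  compares it with a threshold. That the sample is not much further from \<open>P\<close> than \<open>G\<close> is a variance
  computation. For the converse, let \<open>H \<in> P\<close> be a graph on the sample that is near the sampled
  graph; it has to be lifted to a graph \<open>G'\<close> on all vertices that is as near to \<open>G\<close> and contains few copies
  of every small \<open>F \<notin> P\<close>. Then \<open>G'\<close> is not \<open>\<epsilon>/2\<close>-far from \<open>P\<close>, and so \<open>G\<close> is close to \<open>P\<close>.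

  Frieze-Kannan regularity is applied to \<open>H\<close> relative to the sampled graph: up to small
  cut norm, \<open>H\<close> arises from the sampled graph by keeping edges and adding non-edges with probabilities
  that depend only on the labels of the two ends in a partition into \<open>k\<close> parts. No regularity partition of \<open>G\<close>
  is needed. It remains to label all vertices of \<open>G\<close> so that copy densities of the
  resulting weighted graph agree with those on the sample. They are controlled by the densities, within each
  label class, of adjacency profiles towards tuples of a bounded reference set. A labelling of \<open>G\<close>
  minimising the squared deviation of these densities from the sampled ones works: its local optimality turns
  the deviation into a uniform law of large numbers for minima of linear combinations of the profile
  tests, which holds for samples of size \<open>2\<close> to a power polynomial in \<open>M/\<delta>\<close>. Finally the
  weighted graph is rounded to a graph.

  A hypothesis that is not vacuous forces \<open>\<epsilon>\<close> to be at least about \<open>\<delta>/M\<^sup>2\<close> (interpolate between a far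
  graph and its nearest graph in \<open>P\<close>), which is why the query bound does not mention \<open>\<epsilon>\<close>.\<close>


section \<open>Averages over finite sets\<close>

text \<open>The obstacle is the order of quantifiers: \<open>H\<close> and hence the labels on the
  sample are chosen after the sample is known. A union bound over all labellings of \<open>s\<close>
  points faces \<open>k ^ s\<close> cases, more than an exponential tail bound on \<open>s\<close>
  points can absorb. Local optimality trades labellings for cost vectors with one entry per label
  and test, and the number of these entries does not involve \<open>s\<close>. A grid of such
  vectors has doubly exponential size, but only its logarithm, times the squared inverse of the
  precision, has to stay below \<open>s\<close>; so \<open>s\<close> is singly exponential.

  Testing against all tuples of vertices would bring \<open>n\<close> into this count. Hence the
  small reference set, fixed before the sample is drawn. Its use rests on second moments: the mean
  square of a deviation over tuples is an expression in codegrees, and a random set of moderate size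
  reproduces codegrees on average, both for pairs of free vertices and for pairs of sample
  points.\<close>

definition avg :: "'a set \<Rightarrow> ('a \<Rightarrow> real) \<Rightarrow> real" where
  "avg A f = (\<Sum>a\<in>A. f a) / real (card A)"

lemma avg_cong: "A = B \<Longrightarrow> (\<And>a. a \<in> B \<Longrightarrow> f a = g a) \<Longrightarrow> avg A f = avg B g"
  unfolding avg_def by simp

lemma avg_mono: "(\<And>a. a \<in> A \<Longrightarrow> f a \<le> g a) \<Longrightarrow> avg A f \<le> avg A g"
  unfolding avg_def by (intro divide_right_mono sum_mono) auto

lemma avg_add: "avg A (\<lambda>a. f a + g a) = avg A f + avg A g"
  unfolding avg_def by (simp add: sum.distrib add_divide_distrib)

lemma avg_diff: "avg A (\<lambda>a. f a - g a) = avg A f - avg A g"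
  unfolding avg_def by (simp add: sum_subtractf diff_divide_distrib)

lemma avg_cmult: "avg A (\<lambda>a. c * f a) = c * avg A f"
  unfolding avg_def by (simp add: sum_distrib_left)

lemma avg_multc: "avg A (\<lambda>a. f a * c) = avg A f * c"
  unfolding avg_def by (simp add: sum_distrib_right)

lemma avg_sum: "avg A (\<lambda>a. \<Sum>i\<in>I. f i a) = (\<Sum>i\<in>I. avg A (f i))"
  unfolding avg_def by (subst sum.swap) (simp add: sum_divide_distrib)

lemma avg_const: "finite A \<Longrightarrow> A \<noteq> {} \<Longrightarrow> avg A (\<lambda>_. c) = c"
  unfolding avg_def by simp

lemma avg_nonneg: "(\<And>a. a \<in> A \<Longrightarrow> 0 \<le> f a) \<Longrightarrow> 0 \<le> avg A f"
  unfolding avg_def by (intro divide_nonneg_nonneg sum_nonneg) auto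

lemma avg_le: "finite A \<Longrightarrow> A \<noteq> {} \<Longrightarrow> (\<And>a. a \<in> A \<Longrightarrow> f a \<le> c) \<Longrightarrow> avg A f \<le> c"
  using avg_mono[of A f "\<lambda>_. c"] by (simp add: avg_const)

lemma avg_le_one:
  assumes "\<And>a. a \<in> A \<Longrightarrow> f a \<le> 1"
  shows "avg A f \<le> 1"
proof (cases "finite A \<and> A \<noteq> {}")
  case False
  then have "avg A f = 0" by (auto simp: avg_def)
  then show ?thesis by simp
qed (use assms in \<open>auto intro: avg_le\<close>)

lemma avg_abs: "\<bar>avg A f\<bar> \<le> avg A (\<lambda>a. \<bar>f a\<bar>)"
  unfolding avg_def by (simp add: abs_divide divide_right_mono)

lemma avg_swap: "avg A (\<lambda>a. avg B (f a)) = avg B (\<lambda>b. avg A (\<lambda>a. f a b))"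
  unfolding avg_def
  by (subst (1 2) sum_divide_distrib[symmetric]) (simp add: sum.swap[of _ A B] mult.commute)

lemma avg_mult: "avg A f * avg B g = avg A (\<lambda>a. avg B (\<lambda>b. f a * g b))"
  by (simp add: avg_cmult avg_multc)

lemma avg_reindex: "inj_on h A \<Longrightarrow> avg (h ` A) f = avg A (\<lambda>a. f (h a))"
  unfolding avg_def by (simp add: sum.reindex card_image)

lemma avg_square_le: "(avg A f)\<^sup>2 \<le> avg A (\<lambda>a. (f a)\<^sup>2)"
proof (cases "finite A \<and> A \<noteq> {}")
  case True
  then have "0 \<le> avg A (\<lambda>a. (f a - avg A f)\<^sup>2)" by (intro avg_nonneg) auto
  also have "(\<lambda>a. (f a - avg A f)\<^sup>2) = (\<lambda>a. ((f a)\<^sup>2 - (2 * avg A f) * f a) + (avg A f)\<^sup>2)"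
    by (simp add: power2_eq_square algebra_simps)
  also have "avg A \<dots> = avg A (\<lambda>a. (f a)\<^sup>2) - (avg A f)\<^sup>2"
  proof -
    have "avg A (\<lambda>_. (avg A f)\<^sup>2) = (avg A f)\<^sup>2" using True by (intro avg_const) auto
    then show ?thesis by (simp only: avg_add avg_diff avg_cmult) (simp add: power2_eq_square)
  qed
  finally show ?thesis by simp
qed (auto simp: avg_def)

lemma avg_abs_le_sqrt:
  assumes "avg A (\<lambda>a. (f a)\<^sup>2) \<le> c"
  shows "avg A (\<lambda>a. \<bar>f a\<bar>) \<le> sqrt c"
  using avg_square_le[of A "\<lambda>a. \<bar>f a\<bar>"] assms by (intro real_le_rsqrt) simp

lemma avg_markov:
  assumes "\<And>a. a \<in> A \<Longrightarrow> 0 \<le> f a" "0 < t"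
  shows "avg A (\<lambda>a. of_bool (t \<le> f a)) \<le> avg A f / t"
proof -
  have "avg A (\<lambda>a. of_bool (t \<le> f a)) \<le> avg A (\<lambda>a. f a * (1 / t))"
    using assms by (intro avg_mono) (auto simp: field_simps)
  then show ?thesis by (simp only: avg_multc) simp
qed

lemma avg_exists_le:
  assumes "finite A" "A \<noteq> {}"
  shows "\<exists>a\<in>A. f a \<le> avg A f"
proof (rule ccontr)
  assume "\<not> ?thesis"
  then have "\<And>a. a \<in> A \<Longrightarrow> avg A f < f a" by auto
  then have "(\<Sum>a\<in>A. avg A f) < sum f A" using assms by (intro sum_strict_mono) auto
  then show False using assms by (simp add: avg_def field_simps)
qed

section \<open>Averages over products of finite sets\<close>

lemma sum_PiE_split:
  assumes "finite I" "p \<in> I"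
  shows "(\<Sum>y\<in>PiE I A. F y) = (\<Sum>y\<in>PiE (I - {p}) A. \<Sum>x\<in>A p. F (y(p := x)))"
proof -
  have I: "insert p (I - {p}) = I" using assms by auto
  have "(\<Sum>y\<in>PiE I A. F y) = (\<Sum>y\<in>PiE (insert p (I - {p})) A. F y)" using I by simp
  also have "\<dots> = (\<Sum>(x, y)\<in>A p \<times> PiE (I - {p}) A. F (y(p := x)))"
    unfolding PiE_insert_eq
    by (subst sum.reindex[OF inj_combinator]) (auto simp: case_prod_unfold)
  also have "\<dots> = (\<Sum>x\<in>A p. \<Sum>y\<in>PiE (I - {p}) A. F (y(p := x)))"
    by (simp add: sum.cartesian_product)
  finally show ?thesis by (subst (asm) sum.swap)
qed

text \<open>Fubini in one coordinate: the old value at \<open>p\<close> is overwritten, so averaging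
  over it has no effect, and the factor at \<open>p\<close> becomes \<open>B\<close>. With
  \<open>B\<close> different from \<open>A p\<close> this moves one entry of a tuple from one point
  set to another.\<close>

lemma avg_PiE_resample:
  assumes I: "finite I" "p \<in> I" and A: "\<And>i. i \<in> I \<Longrightarrow> finite (A i)" "A p \<noteq> {}"
  shows "avg (PiE I A) (\<lambda>y. avg B (\<lambda>x. F (y(p := x)))) = avg (PiE I (A(p := B))) F"
proof -
  let ?J = "PiE (I - {p}) A"
  have J: "PiE (I - {p}) (A(p := B)) = ?J" by (rule PiE_cong) auto
  have cJ: "card (PiE I C) = card (C p) * card (PiE (I - {p}) C)" for C :: "'a \<Rightarrow> 'b set"
    using I by (simp add: card_PiE prod.remove)
  have "avg (PiE I A) (\<lambda>y. avg B (\<lambda>x. F (y(p := x)))) =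
      (\<Sum>y\<in>?J. \<Sum>x'\<in>A p. avg B (\<lambda>x. F (y(p := x)))) / real (card (A p) * card ?J)"
    unfolding avg_def[of "PiE I A"] cJ by (subst sum_PiE_split[OF I]) simp
  also have "\<dots> = (\<Sum>y\<in>?J. avg B (\<lambda>x. F (y(p := x)))) / real (card ?J)"
    using A I by (simp add: sum_distrib_left[symmetric])
  also have "\<dots> = (\<Sum>y\<in>?J. \<Sum>x\<in>B. F (y(p := x))) / real (card B * card ?J)"
    unfolding avg_def by (simp add: sum_divide_distrib[symmetric])
  also have "\<dots> = avg (PiE I (A(p := B))) F"
    unfolding avg_def cJ by (subst sum_PiE_split[OF I]) (simp add: J)
  finally show ?thesis .
qed

lemma avg_PiE_resample_same:
  assumes "finite I" "p \<in> I" "\<And>i. i \<in> I \<Longrightarrow> finite (A i)" "A p \<noteq> {}"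
  shows "avg (PiE I A) F = avg (PiE I A) (\<lambda>y. avg (A p) (\<lambda>x. F (y(p := x))))"
  using avg_PiE_resample[of I p A "A p" F, OF assms] by simp

lemma avg_PiE_prod:
  assumes "finite I" "\<And>i. i \<in> I \<Longrightarrow> finite (A i)"
  shows "avg (PiE I A) (\<lambda>y. \<Prod>i\<in>I. f i (y i)) = (\<Prod>i\<in>I. avg (A i) (f i))"
  unfolding avg_def using assms by (simp add: prod_dividef prod_sum_PiE card_PiE)

lemma avg_PiE_component:
  assumes "finite I" "p \<in> I" "\<And>i. i \<in> I \<Longrightarrow> finite (A i)" "\<And>i. i \<in> I \<Longrightarrow> A i \<noteq> {}"
  shows "avg (PiE I A) (\<lambda>y. f (y p)) = avg (A p) f"
  using avg_PiE_resample_same[of I p A "\<lambda>y. f (y p)"] assms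
  by (simp add: avg_const finite_PiE PiE_eq_empty_iff)

section \<open>Deviation of averages over independent samples\<close>

lemma avg_iid_square:
  fixes f :: "'a \<Rightarrow> real" and s :: nat
  assumes V: "finite V" "V \<noteq> {}" and s: "0 < s"
    and f: "\<And>v. v \<in> V \<Longrightarrow> \<bar>f v\<bar> \<le> 1" "avg V f = 0"
  shows "avg (PiE {..<s} (\<lambda>_. V)) (\<lambda>u. (avg {..<s} (\<lambda>j. f (u j)))\<^sup>2) \<le> 1 / s"
proof -
  let ?U = "PiE {..<s} (\<lambda>_. V)"
  have U: "finite ?U" using V by (intro finite_PiE) auto
  have U': "?U \<noteq> {}" using V by (simp add: PiE_eq_empty_iff)
  have diag: "avg ?U (\<lambda>u. f (u j) * f (u l)) \<le> of_bool (l = j)" if "j < s" "l < s" for j l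
  proof (cases "l = j")
    case True
    have "f x * f x \<le> 1" if "x \<in> V" for x
      using f(1)[OF that] by (metis abs_mult_self_eq mult_le_one abs_ge_zero)
    then show ?thesis using True that by (auto intro!: avg_le U U')
  next
    case False
    \<comment> \<open>Resampling coordinate \<open>j\<close> leaves \<open>f (u l)\<close> fixed,
      and \<open>f\<close> has mean zero, so the off-diagonal terms vanish.\<close>
    have "avg ?U (\<lambda>u. f (u j) * f (u l)) = avg ?U (\<lambda>u. avg V (\<lambda>x. f x * f (u l)))"
      by (subst avg_PiE_resample_same[where p = j]) (use V that False in auto)
    then show ?thesis using f(2) False by (simp add: avg_multc avg_const U U')
  qed
  have "avg ?U (\<lambda>u. (avg {..<s} (\<lambda>j. f (u j)))\<^sup>2)
      = avg ?U (\<lambda>u. avg {..<s} (\<lambda>j. avg {..<s} (\<lambda>l. f (u j) * f (u l))))"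
    by (simp add: power2_eq_square avg_mult)
  also have "\<dots> = avg {..<s} (\<lambda>j. avg {..<s} (\<lambda>l. avg ?U (\<lambda>u. f (u j) * f (u l))))"
    by (subst avg_swap, rule avg_cong, simp, subst avg_swap, simp)
  also have "\<dots> \<le> avg {..<s} (\<lambda>j. avg {..<s} (\<lambda>l. of_bool (l = j)))"
    by (intro avg_mono diag) auto
  also have "\<dots> = avg {..<s} (\<lambda>j. 1 / s)"
    by (rule avg_cong) (auto simp: avg_def of_bool_def sum.delta)
  finally show ?thesis using s by (simp add: avg_const lessThan_empty_iff)
qed

lemma avg_iid_abs:
  fixes f :: "'a \<Rightarrow> real" and s :: nat
  assumes V: "finite V" "V \<noteq> {}" and s: "0 < s"
    and f: "\<And>v. v \<in> V \<Longrightarrow> 0 \<le> f v" "\<And>v. v \<in> V \<Longrightarrow> f v \<le> 1"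
  shows "avg (PiE {..<s} (\<lambda>_. V)) (\<lambda>u. \<bar>avg {..<s} (\<lambda>j. f (u j)) - avg V f\<bar>) \<le> 1 / sqrt s"
proof -
  define g where "g v = f v - avg V f" for v
  have m: "0 \<le> avg V f" "avg V f \<le> 1" using f V by (auto intro!: avg_nonneg avg_le)
  have "avg (PiE {..<s} (\<lambda>_. V)) (\<lambda>u. (avg {..<s} (\<lambda>j. g (u j)))\<^sup>2) \<le> 1 / s"
  proof (rule avg_iid_square[OF V s])
    show "\<bar>g v\<bar> \<le> 1" if "v \<in> V" for v using f[OF that] m by (auto simp: g_def abs_if)
    show "avg V g = 0" using V by (simp add: g_def[abs_def] avg_diff avg_const)
  qed
  moreover have "avg {..<s} (\<lambda>j. g (u j)) = avg {..<s} (\<lambda>j. f (u j)) - avg V f" for u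
    using s by (simp add: g_def avg_diff avg_const lessThan_empty_iff)
  ultimately show ?thesis using avg_abs_le_sqrt by (fastforce simp: real_sqrt_divide)
qed

text \<open>For negative \<open>x = - y\<close> the claim is
  \<open>1 \<le> (1 - y + y\<^sup>2) * exp y\<close>; the quadratic Taylor lower bound of
  \<open>exp y\<close> turns the right side into \<open>1\<close> plus nonnegative terms.\<close>

lemma exp_le_quadratic:
  fixes x :: real
  assumes "\<bar>x\<bar> \<le> 1"
  shows "exp x \<le> 1 + x + x\<^sup>2"
proof (cases "0 \<le> x")
  case True
  then show ?thesis using assms exp_bound[of x] by simp
next
  case False
  define y where "y = - x"
  have y: "0 \<le> y" using False by (simp add: y_def)
  have "1 + y + y\<^sup>2 / 2 \<le> exp y" using exp_lower_Taylor_quadratic[OF y] by simp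
  moreover have "0 \<le> 1 - y + y\<^sup>2" using False assms by (auto simp: y_def)
  ultimately have "(1 - y + y\<^sup>2) * (1 + y + y\<^sup>2 / 2) \<le> (1 - y + y\<^sup>2) * exp y"
    by (intro mult_left_mono)
  moreover have "(1 - y + y\<^sup>2) * (1 + y + y\<^sup>2 / 2) = 1 + y\<^sup>2 / 2 + y ^ 3 / 2 + y ^ 4 / 2"
    by (simp add: field_simps power2_eq_square power3_eq_cube power4_eq_xxxx)
  moreover have "0 \<le> y\<^sup>2 / 2 + y ^ 3 / 2 + y ^ 4 / 2" using y by simp
  ultimately have "1 \<le> (1 - y + y\<^sup>2) * exp y" by linarith
  then have "exp (- y) \<le> 1 - y + y\<^sup>2" by (simp add: exp_minus field_simps)
  then show ?thesis by (simp add: y_def)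
qed

text \<open>Chernoff's argument: Markov's inequality for the exponential of the sum, whose mean is
  an \<open>s\<close>-th power by independence. The side bounded here is the one that
  \<open>tests_close\<close> asks for.\<close>

lemma avg_iid_tail:
  fixes f :: "'a \<Rightarrow> real" and s :: nat and t :: real
  assumes V: "finite V" "V \<noteq> {}" and s: "0 < s"
    and f: "\<And>v. v \<in> V \<Longrightarrow> \<bar>f v\<bar> \<le> 1" and t: "0 < t" "t \<le> 2"
  shows "avg (PiE {..<s} (\<lambda>_. V)) (\<lambda>u. of_bool (t \<le> avg V f - avg {..<s} (\<lambda>j. f (u j))))
    \<le> exp (- (s * t\<^sup>2 / 16))"
proof -
  let ?U = "PiE {..<s} (\<lambda>_. V)"
  define X where "X v = (avg V f - f v) / 2" for v
  have m: "\<bar>avg V f\<bar> \<le> 1"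
    by (rule order_trans[OF avg_abs]) (use f V in \<open>auto intro!: avg_le\<close>)
  have X: "\<bar>X v\<bar> \<le> 1" if "v \<in> V" for v using f[OF that] m by (auto simp: X_def)
  have X0: "avg V X = 0"
  proof -
    have "avg V X = avg V (\<lambda>v. (1/2) * (avg V f - f v))" by (simp add: X_def[abs_def])
    also have "\<dots> = (1/2) * (avg V (\<lambda>_. avg V f) - avg V f)"
      by (simp only: avg_cmult avg_diff)
    finally show ?thesis using V by (simp add: avg_const)
  qed
  \<comment> \<open>The exponent \<open>s * (l\<^sup>2 - l * t / 2)\<close> is least at
    \<open>l = t / 4\<close>, and \<open>t \<le> 2\<close> keeps \<open>l * X v\<close> in the range
    of \<open>exp_le_quadratic\<close>.\<close>
  define l where "l = t / 4"
  have l: "0 < l" "l \<le> 1" using t by (auto simp: l_def)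
  have E: "avg V (\<lambda>v. exp (l * X v)) \<le> exp (l\<^sup>2)"
  proof -
    have "exp (l * X v) \<le> l * X v + (1 + l\<^sup>2)" if "v \<in> V" for v
    proof -
      have "\<bar>l * X v\<bar> \<le> 1" using X[OF that] l by (simp add: abs_mult mult_le_one)
      then have "exp (l * X v) \<le> 1 + l * X v + (l * X v)\<^sup>2"
        by (rule exp_le_quadratic)
      also have "(l * X v)\<^sup>2 \<le> l\<^sup>2"
        using X[OF that] by (simp add: power_mult_distrib abs_square_le_1 mult_left_le)
      finally show ?thesis by simp
    qed
    then have "avg V (\<lambda>v. exp (l * X v)) \<le> avg V (\<lambda>v. l * X v + (1 + l\<^sup>2))" by (intro avg_mono)
    also have "\<dots> = 1 + l\<^sup>2"
      unfolding avg_add[of V "\<lambda>v. l * X v" "\<lambda>_. 1 + l\<^sup>2"] avg_cmult avg_const[OF V] X0 by simp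
    finally show ?thesis using exp_ge_add_one_self[of "l\<^sup>2"] by linarith
  qed
  have "avg ?U (\<lambda>u. of_bool (t \<le> avg V f - avg {..<s} (\<lambda>j. f (u j))))
      \<le> avg ?U (\<lambda>u. exp (- (l * s * t / 2)) * (\<Prod>j<s. exp (l * X (u j))))"
  proof (intro avg_mono)
    fix u
    have "avg V f - avg {..<s} (\<lambda>j. f (u j)) = 2 * (\<Sum>j<s. X (u j)) / s"
      using s by (simp add: X_def avg_def sum_divide_distrib[symmetric] sum_subtractf field_simps)
    then have "t \<le> avg V f - avg {..<s} (\<lambda>j. f (u j)) \<Longrightarrow> l * s * t / 2 \<le> (\<Sum>j<s. l * X (u j))"
      using s l by (simp add: field_simps sum_distrib_left[symmetric])
    then show "of_bool (t \<le> avg V f - avg {..<s} (\<lambda>j. f (u j)))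
        \<le> exp (- (l * s * t / 2)) * (\<Prod>j<s. exp (l * X (u j)))"
      by (auto simp: exp_sum[symmetric] exp_add[symmetric] mult_exp_exp)
  qed
  also have "\<dots> = exp (- (l * s * t / 2)) * (avg V (\<lambda>v. exp (l * X v))) ^ s"
    using V by (simp add: avg_cmult avg_PiE_prod[of "{..<s}" "\<lambda>_. V" "\<lambda>_ v. exp (l * X v)"])
  also have "\<dots> \<le> exp (- (l * s * t / 2)) * exp (l\<^sup>2) ^ s"
    using E by (intro mult_left_mono power_mono avg_nonneg) auto
  also have "\<dots> = exp (- (l * s * t / 2) + s * l\<^sup>2)"
    by (simp only: exp_add exp_of_nat_mult)
  also have "- (l * s * t / 2) + s * l\<^sup>2 = - (s * t\<^sup>2 / 16)"
    by (simp add: l_def power2_eq_square field_simps)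
  finally show ?thesis .
qed

text \<open>Under \<open>avg\<close> this becomes the union bound.\<close>

lemma of_bool_le_sum:
  assumes "finite I" "P \<Longrightarrow> \<exists>i\<in>I. Q i"
  shows "of_bool P \<le> (\<Sum>i\<in>I. of_bool (Q i) :: real)"
proof (cases P)
  case True
  then obtain i where i: "i \<in> I" "Q i" using assms(2) by blast
  then have "of_bool (Q i) \<le> (\<Sum>i\<in>I. of_bool (Q i) :: real)"
    by (intro member_le_sum assms(1)) auto
  then show ?thesis using i True by (simp only: of_bool_eq)
next
  case False
  then have "of_bool P = (0 :: real)" by simp
  also have "\<dots> \<le> (\<Sum>i\<in>I. of_bool (Q i))" by (intro sum_nonneg) simp
  finally show ?thesis .
qed

lemma avg_bij: "bij_betw h A B \<Longrightarrow> avg B f = avg A (\<lambda>a. f (h a))"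
  unfolding bij_betw_def using avg_reindex[of h A f] by auto

text \<open>Lets patterns of every size \<open>m \<le> M\<close> be counted on tuples of the common
  length \<open>M\<close>; the surplus coordinates average out.\<close>

lemma avg_PiE_extend:
  fixes V :: "'a set" and m M :: nat
  assumes V: "finite V" "V \<noteq> {}" and m: "m \<le> M"
  shows "avg (PiE {..<M} (\<lambda>_. V)) (\<lambda>y. F (restrict y {..<m})) = avg (PiE {..<m} (\<lambda>_. V)) F"
  using m
proof (induction M rule: dec_induct)
  case base
  show ?case by (intro avg_cong) auto
next
  case (step M)
  have "avg (PiE {..<Suc M} (\<lambda>_. V)) (\<lambda>y. F (restrict y {..<m}))
      = (\<Sum>y\<in>PiE {..<M} (\<lambda>_. V). \<Sum>x\<in>V. F (restrict (y(M := x)) {..<m})) / real (card V * card (PiE {..<M} (\<lambda>_. V)))"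
  proof -
    have "{..<Suc M} - {M} = {..<M}" by auto
    then show ?thesis
      unfolding avg_def by (subst sum_PiE_split[where p = M]) (simp_all add: card_PiE)
  qed
  also have "\<dots> = (\<Sum>y\<in>PiE {..<M} (\<lambda>_. V). \<Sum>x\<in>V. F (restrict y {..<m})) / real (card V * card (PiE {..<M} (\<lambda>_. V)))"
  proof -
    have "restrict (y(M := x)) {..<m} = restrict y {..<m}" for y and x :: 'a
      using step.hyps by (auto simp: restrict_def fun_eq_iff)
    then show ?thesis by simp
  qed
  also have "\<dots> = avg (PiE {..<M} (\<lambda>_. V)) (\<lambda>y. F (restrict y {..<m}))"
    using V by (simp add: avg_def sum_distrib_left[symmetric])
  also note step.IH
  finally show ?case .
qed

lemma avg_PiE_two:
  fixes M :: nat
  assumes "p < M" "q < M" "p \<noteq> q" and V: "finite V" "V \<noteq> {}"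
  shows "avg (PiE {..<M} (\<lambda>_. V)) (\<lambda>y. f (y p) (y q)) = avg V (\<lambda>a. avg V (f a))"
proof -
  have "avg (PiE {..<M} (\<lambda>_. V)) (\<lambda>y. f (y p) (y q)) = avg (PiE {..<M} (\<lambda>_. V)) (\<lambda>y. avg V (\<lambda>a. f a (y q)))"
    by (subst avg_PiE_resample_same[where p = p]) (use assms in auto)
  also have "\<dots> = avg V (\<lambda>b. avg V (\<lambda>a. f a b))"
    by (rule avg_PiE_component[where f = "\<lambda>b. avg V (\<lambda>a. f a b)"]) (use assms in auto)
  finally show ?thesis by (subst avg_swap)
qed

lemma of_bool_mono: "(P \<Longrightarrow> Q) \<Longrightarrow> of_bool P \<le> (of_bool Q :: real)"
  by simp

lemma avg_swap3: "avg U (\<lambda>u. avg A (\<lambda>v. avg B (F u v))) = avg A (\<lambda>v. avg B (\<lambda>w. avg U (\<lambda>u. F u v w)))"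
  by (simp only: avg_swap[of U A] avg_swap[of U B])

lemma avg_avg_le:
  fixes n :: nat
  assumes n: "0 < n" and F: "\<And>v w. F v w \<le> c"
  shows "avg {..<n} (\<lambda>v. avg {..<n} (F v)) \<le> c"
  by (rule avg_le; (rule avg_le)?) (use n F in \<open>auto simp: lessThan_empty_iff\<close>)

section \<open>Weak regularity relative to a graph and the counting lemma\<close>

text \<open>The conditional expectation of \<open>h\<close> given the cell, with value
  \<open>0\<close> on an empty cell.\<close>

definition cell_avg :: "'a set \<Rightarrow> ('a \<Rightarrow> 'c) \<Rightarrow> ('a \<Rightarrow> real) \<Rightarrow> 'c \<Rightarrow> real" where
  "cell_avg \<Omega> C h c = avg {\<omega>\<in>\<Omega>. C \<omega> = c} h"

text \<open>The defining property of conditional expectation. Both the energy increment and the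
  invariance of the edit distance under regularisation come from it.\<close>

lemma sum_cell_avg:
  assumes "finite \<Omega>"
  shows "(\<Sum>\<omega>\<in>\<Omega>. cell_avg \<Omega> C h (C \<omega>) * \<phi> (C \<omega>)) = (\<Sum>\<omega>\<in>\<Omega>. h \<omega> * \<phi> (C \<omega>))"
proof -
  have "(\<Sum>\<omega>\<in>{x\<in>\<Omega>. C x = c}. cell_avg \<Omega> C h (C \<omega>) * \<phi> (C \<omega>))
      = (\<Sum>\<omega>\<in>{x\<in>\<Omega>. C x = c}. h \<omega> * \<phi> (C \<omega>))" for c
  proof -
    let ?F = "{x\<in>\<Omega>. C x = c}"
    have "(\<Sum>\<omega>\<in>?F. cell_avg \<Omega> C h (C \<omega>) * \<phi> (C \<omega>)) = real (card ?F) * avg ?F h * \<phi> c"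
      by (simp add: cell_avg_def)
    also have "real (card ?F) * avg ?F h = sum h ?F"
    proof (cases "?F = {}")
      case True
      show ?thesis unfolding True by simp
    next
      case False
      then have "card ?F \<noteq> 0" using assms by simp
      then show ?thesis by (simp add: avg_def)
    qed
    finally show ?thesis by (simp add: sum_distrib_right)
  qed
  then show ?thesis
    using sum.image_gen[OF assms, of "\<lambda>\<omega>. cell_avg \<Omega> C h (C \<omega>) * \<phi> (C \<omega>)" C]
      sum.image_gen[OF assms, of "\<lambda>\<omega>. h \<omega> * \<phi> (C \<omega>)" C] by simp
qed

definition cell_of :: "('a \<Rightarrow> 'a \<Rightarrow> bool) \<Rightarrow> ('a \<Rightarrow> nat) \<Rightarrow> 'a \<times> 'a \<Rightarrow> bool \<times> nat \<times> nat" where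
  "cell_of g \<pi> = (\<lambda>(x, y). (g x y, \<pi> x, \<pi> y))"

text \<open>Energy increment; the cells of \<open>A \<times> A\<close> also record whether the pair is an edge of \<open>g\<close>, so that the
  cell averages have exactly the edit distance of \<open>h\<close> to \<open>g\<close>.\<close>

lemma weak_regularity:
  fixes g :: "'a \<Rightarrow> 'a \<Rightarrow> bool" and h :: "'a \<times> 'a \<Rightarrow> real"
  assumes A: "finite A" and h: "\<And>e. 0 \<le> h e" "\<And>e. h e \<le> 1"
    and \<gamma>: "0 < \<gamma>" and T: "1 < real T * \<gamma>\<^sup>2"
  shows "\<exists>\<pi>. (\<forall>x. \<pi> x < 4 ^ T) \<and> (\<forall>X Y. X \<subseteq> A \<longrightarrow> Y \<subseteq> A \<longrightarrow>
    \<bar>\<Sum>e\<in>X \<times> Y. h e - cell_avg (A \<times> A) (cell_of g \<pi>) h (cell_of g \<pi> e)\<bar> \<le> \<gamma> * (card A)\<^sup>2)"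
proof -
  define c where "c \<pi> e = cell_avg (A \<times> A) (cell_of g \<pi>) h (cell_of g \<pi> e)" for \<pi> e
  define reg where "reg \<pi> \<longleftrightarrow> (\<forall>X Y. X \<subseteq> A \<longrightarrow> Y \<subseteq> A \<longrightarrow>
    \<bar>\<Sum>e\<in>X \<times> Y. h e - c \<pi> e\<bar> \<le> \<gamma> * (card A)\<^sup>2)" for \<pi>
  define energy where "energy \<pi> = (\<Sum>e\<in>A \<times> A. (c \<pi> e)\<^sup>2)" for \<pi>
  have fin: "finite (A \<times> A)" using A by simp
  have c01: "0 \<le> c \<pi> e" "c \<pi> e \<le> 1" for \<pi> e
    unfolding c_def cell_avg_def using h by (auto intro!: avg_nonneg avg_le_one)
  have E1: "energy \<pi> \<le> (card A)\<^sup>2" for \<pi>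
  proof -
    have "energy \<pi> \<le> (\<Sum>e\<in>A \<times> A. 1)"
      unfolding energy_def using c01 by (intro sum_mono power_le_one) auto
    then show ?thesis by (simp add: card_cartesian_product power2_eq_square)
  qed
  have step: "\<exists>\<pi>'. (\<forall>x. \<pi>' x < 4 ^ Suc t) \<and> energy \<pi> + \<gamma>\<^sup>2 * (card A)\<^sup>2 \<le> energy \<pi>'"
    if \<pi>: "\<forall>x. \<pi> x < 4 ^ t" and nr: "\<not> reg \<pi>" for t \<pi>
  proof -
    obtain X Y where XY: "X \<subseteq> A" "Y \<subseteq> A" "\<gamma> * (card A)\<^sup>2 < \<bar>\<Sum>e\<in>X \<times> Y. h e - c \<pi> e\<bar>"
      using nr by (auto simp: reg_def not_le)
    \<comment> \<open>A base-4 digit appended to the label records membership in \<open>X\<close>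
      and in \<open>Y\<close>.\<close>
    define \<pi>' where "\<pi>' x = 4 * \<pi> x + (2 * of_bool (x \<in> X) + of_bool (x \<in> Y))" for x
    have \<pi>'_lt: "\<pi>' x < 4 ^ Suc t" for x
      using \<pi>[rule_format, of x] by (auto simp: \<pi>'_def)
    have div: "\<pi>' x div 4 = \<pi> x" for x
      by (auto simp: \<pi>'_def)
    have md: "\<pi>' x mod 4 = 2 * of_bool (x \<in> X) + of_bool (x \<in> Y)" for x
      by (auto simp: \<pi>'_def)
    \<comment> \<open>\<open>\<rho>\<close> forgets the new digits, so coarse cells are unions of
      fine ones; \<open>\<psi>\<close> reads off from the fine cell whether the pair lies in
      \<open>X \<times> Y\<close>.\<close>
    define \<rho> :: "bool \<times> nat \<times> nat \<Rightarrow> bool \<times> nat \<times> nat"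
      where "\<rho> = (\<lambda>(b, i, j). (b, i div 4, j div 4))"
    have \<rho>: "cell_of g \<pi> e = \<rho> (cell_of g \<pi>' e)" for e
      by (auto simp: cell_of_def \<rho>_def div split: prod.split)
    define \<psi> :: "bool \<times> nat \<times> nat \<Rightarrow> real"
      where "\<psi> = (\<lambda>(b, i, j). of_bool (2 \<le> i mod 4) * of_bool (odd (j mod 4)))"
    have \<psi>: "\<psi> (cell_of g \<pi>' e) = of_bool (e \<in> X \<times> Y)" for e
      by (auto simp: cell_of_def \<psi>_def md of_bool_def split: prod.split if_splits)
    \<comment> \<open>Orthogonality: \<open>c \<pi>\<close> is the projection of
      \<open>c \<pi>'\<close> to the coarser cells, so the squared norm of their difference is the
      difference of the energies.\<close>
    have e1: "(\<Sum>e\<in>A \<times> A. c \<pi>' e * c \<pi> e) = (\<Sum>e\<in>A \<times> A. (c \<pi> e)\<^sup>2)"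
    proof -
      have "(\<Sum>e\<in>A \<times> A. c \<pi>' e * c \<pi> e) = (\<Sum>e\<in>A \<times> A. h e * c \<pi> e)"
        using sum_cell_avg[OF fin, of "cell_of g \<pi>'" h
            "\<lambda>z. cell_avg (A \<times> A) (cell_of g \<pi>) h (\<rho> z)"]
        by (simp add: c_def \<rho>[symmetric])
      also have "\<dots> = (\<Sum>e\<in>A \<times> A. c \<pi> e * c \<pi> e)"
        using sum_cell_avg[OF fin, of "cell_of g \<pi>" h "cell_avg (A \<times> A) (cell_of g \<pi>) h"]
        by (simp add: c_def)
      finally show ?thesis by (simp add: power2_eq_square)
    qed
    have e2: "(\<Sum>e\<in>X \<times> Y. h e - c \<pi> e) = (\<Sum>e\<in>A \<times> A. (c \<pi>' e - c \<pi> e) * of_bool (e \<in> X \<times> Y))"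
    proof -
      have "(\<Sum>e\<in>X \<times> Y. h e - c \<pi> e) = (\<Sum>e\<in>A \<times> A. (h e - c \<pi> e) * of_bool (e \<in> X \<times> Y))"
        using XY A by (intro sum.mono_neutral_cong_left) auto
      also have "\<dots> = (\<Sum>e\<in>A \<times> A. h e * of_bool (e \<in> X \<times> Y)) - (\<Sum>e\<in>A \<times> A. c \<pi> e * of_bool (e \<in> X \<times> Y))"
        by (simp add: left_diff_distrib sum_subtractf)
      also have "(\<Sum>e\<in>A \<times> A. h e * of_bool (e \<in> X \<times> Y)) = (\<Sum>e\<in>A \<times> A. c \<pi>' e * of_bool (e \<in> X \<times> Y))"
        using sum_cell_avg[OF fin, of "cell_of g \<pi>'" h \<psi>] by (simp add: c_def \<psi>)
      finally show ?thesis by (simp add: left_diff_distrib sum_subtractf)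
    qed
    \<comment> \<open>Cauchy-Schwarz against the indicator of \<open>X \<times> Y\<close>: a
      violated cut forces the energy up by
      \<open>\<gamma>\<^sup>2 * (card A)\<^sup>2\<close>.\<close>
    have "(\<gamma> * (card A)\<^sup>2)\<^sup>2 \<le> \<bar>\<Sum>e\<in>X \<times> Y. h e - c \<pi> e\<bar>\<^sup>2"
      using XY(3) \<gamma> by (intro power_mono) auto
    also have "\<dots> = (\<Sum>e\<in>X \<times> Y. h e - c \<pi> e)\<^sup>2" by (rule power2_abs)
    also have "\<dots> \<le> (\<Sum>e\<in>A \<times> A. (c \<pi>' e - c \<pi> e)\<^sup>2) * (\<Sum>e\<in>A \<times> A. (of_bool (e \<in> X \<times> Y))\<^sup>2)"
      unfolding e2 by (rule Cauchy_Schwarz_ineq_sum)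
    also have "\<dots> \<le> (\<Sum>e\<in>A \<times> A. (c \<pi>' e - c \<pi> e)\<^sup>2) * (\<Sum>e\<in>A \<times> A. 1)"
      by (intro mult_left_mono sum_mono sum_nonneg) auto
    also have "(\<Sum>e\<in>A \<times> A. (c \<pi>' e - c \<pi> e)\<^sup>2) = energy \<pi>' - energy \<pi>"
    proof -
      have "(\<Sum>e\<in>A \<times> A. (c \<pi>' e - c \<pi> e)\<^sup>2) =
          (\<Sum>e\<in>A \<times> A. (c \<pi>' e)\<^sup>2) - 2 * (\<Sum>e\<in>A \<times> A. c \<pi>' e * c \<pi> e) + (\<Sum>e\<in>A \<times> A. (c \<pi> e)\<^sup>2)"
        by (simp add: power2_diff sum.distrib sum_subtractf sum_distrib_left mult.assoc)
      then show ?thesis by (simp add: e1 energy_def)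
    qed
    finally have *: "\<gamma>\<^sup>2 * (card A)\<^sup>2 * (card A)\<^sup>2 \<le> (energy \<pi>' - energy \<pi>) * (card A)\<^sup>2"
      by (simp add: card_cartesian_product power2_eq_square mult_ac)
    have "A \<noteq> {}" using XY(3) \<gamma> XY(1) by auto
    then have "0 < real ((card A)\<^sup>2)" using A by (simp add: card_gt_0_iff)
    then have "\<gamma>\<^sup>2 * (card A)\<^sup>2 \<le> energy \<pi>' - energy \<pi>"
      using * by (simp only: mult_le_cancel_right)
    then show ?thesis using \<pi>'_lt by (intro exI[of _ \<pi>']) auto
  qed
  \<comment> \<open>The energy is at most \<open>(card A)\<^sup>2\<close>, so
    \<open>T > 1 / \<gamma>\<^sup>2\<close> rounds cannot all be irregular.\<close>
  have main: "\<exists>\<pi>. (\<forall>x. \<pi> x < 4 ^ t) \<and> (reg \<pi> \<or> t * (\<gamma>\<^sup>2 * (card A)\<^sup>2) \<le> energy \<pi>)" for t :: nat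
  proof (induction t)
    case 0
    show ?case by (intro exI[of _ "\<lambda>_. 0"]) (auto simp: energy_def sum_nonneg)
  next
    case (Suc t)
    then obtain \<pi> where \<pi>: "\<forall>x. \<pi> x < 4 ^ t" "reg \<pi> \<or> t * (\<gamma>\<^sup>2 * (card A)\<^sup>2) \<le> energy \<pi>"
      by blast
    show ?case
    proof (cases "reg \<pi>")
      case True
      have "\<pi> x < 4 ^ Suc t" for x using \<pi>(1)[rule_format, of x] by simp
      then show ?thesis using True by blast
    next
      case False
      then obtain \<pi>' where \<pi>': "\<forall>x. \<pi>' x < 4 ^ Suc t" "energy \<pi> + \<gamma>\<^sup>2 * (card A)\<^sup>2 \<le> energy \<pi>'"
        using step[OF \<pi>(1)] by blast
      have "Suc t * (\<gamma>\<^sup>2 * (card A)\<^sup>2) \<le> energy \<pi>'"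
        using \<pi>'(2) \<pi>(2) False by (simp add: algebra_simps)
      then show ?thesis using \<pi>'(1) by blast
    qed
  qed
  obtain \<pi> where \<pi>: "\<forall>x. \<pi> x < 4 ^ T" "reg \<pi> \<or> T * (\<gamma>\<^sup>2 * (card A)\<^sup>2) \<le> energy \<pi>"
    using main by blast
  have "reg \<pi>"
  proof (rule ccontr)
    assume nr: "\<not> reg \<pi>"
    then have "T * (\<gamma>\<^sup>2 * (card A)\<^sup>2) \<le> (card A)\<^sup>2" using \<pi>(2) E1[of \<pi>] by linarith
    moreover have "A \<noteq> {}" using nr by (auto simp: reg_def)
    then have "0 < real ((card A)\<^sup>2)" using A by (simp add: card_gt_0_iff)
    ultimately have "T * \<gamma>\<^sup>2 \<le> 1"
      by (intro mult_right_le_imp_le[of "T * \<gamma>\<^sup>2" "real ((card A)\<^sup>2)" 1]) (simp_all add: mult.assoc)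
    then show False using T by simp
  qed
  then show ?thesis using \<pi>(1) unfolding reg_def c_def by blast
qed

text \<open>The form is linear in \<open>f\<close> and in \<open>g\<close> separately, so it is
  largest at indicator functions: first of the points \<open>X\<close> with positive coefficient,
  then of the points \<open>Y\<close> found in the same way for the form summed over
  \<open>X\<close>.\<close>

lemma bilinear_le_cut:
  fixes U :: "'a \<Rightarrow> 'a \<Rightarrow> real"
  assumes A: "finite A" and f: "\<And>x. x \<in> A \<Longrightarrow> 0 \<le> f x \<and> f x \<le> (1::real)"
    and g: "\<And>x. x \<in> A \<Longrightarrow> 0 \<le> g x \<and> g x \<le> (1::real)"
    and cut: "\<And>X Y. X \<subseteq> A \<Longrightarrow> Y \<subseteq> A \<Longrightarrow> (\<Sum>x\<in>X. \<Sum>y\<in>Y. U x y) \<le> B"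
  shows "(\<Sum>x\<in>A. \<Sum>y\<in>A. U x y * f x * g y) \<le> B"
proof -
  have pos: "(\<Sum>x\<in>A. a x * f x) \<le> (\<Sum>x\<in>{x\<in>A. 0 < a x}. a x)"
    if f: "\<And>x. x \<in> A \<Longrightarrow> 0 \<le> f x \<and> f x \<le> (1::real)" for a f :: "'a \<Rightarrow> real"
  proof -
    have "(\<Sum>x\<in>A. a x * f x) \<le> (\<Sum>x\<in>A. if 0 < a x then a x else 0)"
      using f by (intro sum_mono) (auto simp: mult_left_le mult_nonpos_nonneg not_less)
    then show ?thesis using A by (simp add: sum.If_cases Int_def)
  qed
  define X where "X = {x\<in>A. 0 < (\<Sum>y\<in>A. U x y * g y)}"
  define Y where "Y = {y\<in>A. 0 < (\<Sum>x\<in>X. U x y)}"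
  have "(\<Sum>x\<in>A. \<Sum>y\<in>A. U x y * f x * g y) = (\<Sum>x\<in>A. (\<Sum>y\<in>A. U x y * g y) * f x)"
    unfolding sum_distrib_right by (intro sum.cong) (auto simp: mult_ac)
  also have "\<dots> \<le> (\<Sum>x\<in>X. \<Sum>y\<in>A. U x y * g y)"
    unfolding X_def by (rule pos) (rule f)
  also have "\<dots> = (\<Sum>y\<in>A. (\<Sum>x\<in>X. U x y) * g y)"
    by (subst sum.swap) (simp add: sum_distrib_right)
  also have "\<dots> \<le> (\<Sum>y\<in>Y. \<Sum>x\<in>X. U x y)"
    unfolding Y_def by (rule pos) (rule g)
  also have "\<dots> = (\<Sum>x\<in>X. \<Sum>y\<in>Y. U x y)" by (rule sum.swap)
  also have "\<dots> \<le> B" by (rule cut) (auto simp: X_def Y_def)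
  finally show ?thesis .
qed

section \<open>Densities with a kernel on every pair, and the counting lemma\<close>

definition pairs :: "nat \<Rightarrow> (nat \<times> nat) set" where
  "pairs M = {(p, q). p < q \<and> q < M}"

lemma finite_pairs [simp]: "finite (pairs M)"
  by (rule finite_subset[of _ "{..<M} \<times> {..<M}"]) (auto simp: pairs_def)

lemma card_pairs_le: "card (pairs M) \<le> M\<^sup>2"
proof -
  have "card (pairs M) \<le> card ({..<M} \<times> {..<M})"
    by (rule card_mono) (auto simp: pairs_def)
  then show ?thesis by (simp add: power2_eq_square)
qed

text \<open>The kernel may depend on the pair of positions, and every position has its own point
  set, so that hybrids between two kernels or between two point sets are again of this form.\<close>

definition hom :: "nat \<Rightarrow> (nat \<Rightarrow> 'a set) \<Rightarrow> (nat \<Rightarrow> nat \<Rightarrow> 'a \<Rightarrow> 'a \<Rightarrow> real) \<Rightarrow> real" where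
  "hom M A K = avg (PiE {..<M} A) (\<lambda>y. \<Prod>e\<in>pairs M. K (fst e) (snd e) (y (fst e)) (y (snd e)))"

text \<open>With all points but those at \<open>p0\<close> and \<open>q0\<close> fixed, no other
  factor sees both of these, so the remaining product splits into a function of one point times a
  function of the other, as \<open>cut\<close> expects.\<close>

lemma counting_one_pair:
  fixes L K K' :: "nat \<Rightarrow> nat \<Rightarrow> 'a \<Rightarrow> 'a \<Rightarrow> real"
  assumes S: "finite S" "S \<noteq> {}"
    and L: "\<And>p q x y. 0 \<le> L p q x y" "\<And>p q x y. L p q x y \<le> 1"
    and e: "(p0, q0) \<in> pairs M"
    and same: "\<And>p q. (p, q) \<noteq> (p0, q0) \<Longrightarrow> K p q = L p q" "\<And>p q. (p, q) \<noteq> (p0, q0) \<Longrightarrow> K' p q = L p q"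
    and cut: "\<And>f g. (\<And>x. 0 \<le> f x \<and> f x \<le> (1::real)) \<Longrightarrow> (\<And>x. 0 \<le> g x \<and> g x \<le> (1::real)) \<Longrightarrow>
      \<bar>avg S (\<lambda>x. avg S (\<lambda>y. (K p0 q0 x y - K' p0 q0 x y) * f x * g y))\<bar> \<le> \<gamma>"
  shows "\<bar>hom M (\<lambda>_. S) K - hom M (\<lambda>_. S) K'\<bar> \<le> \<gamma>"
proof -
  let ?P = "PiE {..<M} (\<lambda>_. S)"
  have P: "finite ?P" "?P \<noteq> {}" using S by (auto simp: PiE_eq_empty_iff intro!: finite_PiE)
  have pq: "p0 < q0" "q0 < M" using e by (auto simp: pairs_def)
  define I where "I = pairs M - {(p0, q0)}"
  define I1 where "I1 = {e\<in>I. fst e \<noteq> q0 \<and> snd e \<noteq> q0}"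
  \<comment> \<open>None of these pairs touches \<open>p0\<close>: pairs are increasing and
    \<open>(p0, q0)\<close> has been removed.\<close>
  define I2 where "I2 = {e\<in>I. fst e = q0 \<or> snd e = q0}"
  have II: "I = I1 \<union> I2" "I1 \<inter> I2 = {}" "finite I1" "finite I2"
    by (auto simp: I1_def I2_def I_def)
  define \<phi> where "\<phi> e y = L (fst e) (snd e) (y (fst e)) (y (snd e))" for e and y :: "nat \<Rightarrow> 'a"
  have prod_eq: "(\<Prod>e\<in>pairs M. Q (fst e) (snd e) (y (fst e)) (y (snd e)))
      = Q p0 q0 (y p0) (y q0) * (\<Prod>e\<in>I. \<phi> e y)"
    if "\<And>p q. (p, q) \<noteq> (p0, q0) \<Longrightarrow> Q p q = L p q" for Q y
  proof -
    have "(\<Prod>e\<in>pairs M - {(p0, q0)}. Q (fst e) (snd e) (y (fst e)) (y (snd e))) = (\<Prod>e\<in>I. \<phi> e y)"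
      unfolding I_def \<phi>_def by (rule prod.cong) (auto simp: that)
    then show ?thesis by (subst prod.remove[OF finite_pairs e]) simp
  qed
  define F where "F y = (K p0 q0 (y p0) (y q0) - K' p0 q0 (y p0) (y q0)) * (\<Prod>e\<in>I. \<phi> e y)" for y
  have "hom M (\<lambda>_. S) K - hom M (\<lambda>_. S) K' = avg ?P F"
  proof -
    have "hom M (\<lambda>_. S) Q = avg ?P (\<lambda>y. Q p0 q0 (y p0) (y q0) * (\<Prod>e\<in>I. \<phi> e y))"
      if "\<And>p q. (p, q) \<noteq> (p0, q0) \<Longrightarrow> Q p q = L p q" for Q
      unfolding hom_def by (rule avg_cong[OF refl]) (rule prod_eq[OF that])
    from this[of K, OF same(1)] this[of K', OF same(2)] show ?thesis
      by (simp add: F_def[abs_def] avg_diff left_diff_distrib)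
  qed
  also have "avg ?P F = avg ?P (\<lambda>y. avg S (\<lambda>x. F (y(p0 := x))))"
    by (subst avg_PiE_resample_same[where p = p0]) (use S pq in auto)
  also have "\<dots> = avg ?P (\<lambda>y. avg S (\<lambda>x'. avg S (\<lambda>x. F (y(q0 := x', p0 := x)))))"
    by (subst avg_PiE_resample_same[where p = q0]) (use S pq in auto)
  also have "\<bar>\<dots>\<bar> \<le> avg ?P (\<lambda>y. \<bar>avg S (\<lambda>x'. avg S (\<lambda>x. F (y(q0 := x', p0 := x))))\<bar>)"
    by (rule avg_abs)
  also have "\<dots> \<le> \<gamma>"
  proof (rule avg_le[OF P])
    fix y
    define f where "f x = (\<Prod>e\<in>I1. \<phi> e (y(p0 := x)))" for x
    define g where "g x = (\<Prod>e\<in>I2. \<phi> e (y(q0 := x)))" for x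
    have f: "0 \<le> f x \<and> f x \<le> 1" for x
      unfolding f_def \<phi>_def using L by (auto intro!: prod_nonneg prod_le_1)
    have g: "0 \<le> g x \<and> g x \<le> 1" for x
      unfolding g_def \<phi>_def using L by (auto intro!: prod_nonneg prod_le_1)
    have FF: "F (y(q0 := x', p0 := x)) = (K p0 q0 x x' - K' p0 q0 x x') * f x * g x'" for x x'
    proof -
      have "(\<Prod>e\<in>I. \<phi> e (y(q0 := x', p0 := x))) =
          (\<Prod>e\<in>I1. \<phi> e (y(q0 := x', p0 := x))) * (\<Prod>e\<in>I2. \<phi> e (y(q0 := x', p0 := x)))"
        using II by (simp add: prod.union_disjoint)
      also have "(\<Prod>e\<in>I1. \<phi> e (y(q0 := x', p0 := x))) = f x"
        unfolding f_def by (rule prod.cong) (auto simp: I1_def \<phi>_def)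
      also have "(\<Prod>e\<in>I2. \<phi> e (y(q0 := x', p0 := x))) = g x'"
        unfolding g_def using pq by (intro prod.cong) (auto simp: I2_def I_def pairs_def \<phi>_def)
      finally have r: "(\<Prod>e\<in>I. \<phi> e (y(q0 := x', p0 := x))) = f x * g x'" .
      show ?thesis unfolding F_def r using pq by simp
    qed
    show "\<bar>avg S (\<lambda>x'. avg S (\<lambda>x. F (y(q0 := x', p0 := x))))\<bar> \<le> \<gamma>"
      unfolding FF by (subst avg_swap) (rule cut[OF f g])
  qed
  finally show ?thesis .
qed

text \<open>The kernels are exchanged one pair at a time; \<open>mix D\<close> has exchanged those
  in \<open>D\<close>.\<close>

lemma counting_lemma:
  fixes K K' :: "nat \<Rightarrow> nat \<Rightarrow> 'a \<Rightarrow> 'a \<Rightarrow> real"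
  assumes S: "finite S" "S \<noteq> {}" and \<gamma>: "0 \<le> \<gamma>"
    and K: "\<And>p q x y. 0 \<le> K p q x y" "\<And>p q x y. K p q x y \<le> 1"
    and K': "\<And>p q x y. 0 \<le> K' p q x y" "\<And>p q x y. K' p q x y \<le> 1"
    and cut: "\<And>p q f g. (p, q) \<in> pairs M \<Longrightarrow> (\<And>x. 0 \<le> f x \<and> f x \<le> (1::real)) \<Longrightarrow>
      (\<And>x. 0 \<le> g x \<and> g x \<le> (1::real)) \<Longrightarrow>
      \<bar>avg S (\<lambda>x. avg S (\<lambda>y. (K p q x y - K' p q x y) * f x * g y))\<bar> \<le> \<gamma>"
  shows "\<bar>hom M (\<lambda>_. S) K - hom M (\<lambda>_. S) K'\<bar> \<le> M\<^sup>2 * \<gamma>"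
proof -
  define mix where "mix D = (\<lambda>p q. if (p, q) \<in> D then K' p q else K p q)" for D
  have "\<bar>hom M (\<lambda>_. S) K - hom M (\<lambda>_. S) (mix D)\<bar> \<le> card D * \<gamma>" if "finite D" "D \<subseteq> pairs M" for D
    using that
  proof (induction D)
    case empty
    then show ?case by (simp add: mix_def)
  next
    case (insert e D)
    obtain p0 q0 where e: "e = (p0, q0)" by fastforce
    have "\<bar>hom M (\<lambda>_. S) (mix D) - hom M (\<lambda>_. S) (mix (insert e D))\<bar> \<le> \<gamma>"
    proof (rule counting_one_pair[OF S, of "mix D" p0 q0])
      show "mix (insert e D) p q = mix D p q" if "(p, q) \<noteq> (p0, q0)" for p q
        using that e by (auto simp: mix_def)
      show "\<bar>avg S (\<lambda>x. avg S (\<lambda>y. (mix D p0 q0 x y - mix (insert e D) p0 q0 x y) * f x * g y))\<bar> \<le> \<gamma>"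
        if "\<And>x. 0 \<le> f x \<and> f x \<le> 1" "\<And>x. 0 \<le> g x \<and> g x \<le> 1" for f g :: "'a \<Rightarrow> real"
        using cut[of p0 q0 f g] that insert e by (auto simp: mix_def)
    qed (use insert e K K' in \<open>auto simp: mix_def\<close>)
    then show ?case using insert by (simp add: algebra_simps)
  qed
  from this[of "pairs M"] have "\<bar>hom M (\<lambda>_. S) K - hom M (\<lambda>_. S) (mix (pairs M))\<bar> \<le> card (pairs M) * \<gamma>"
    by simp
  also have "hom M (\<lambda>_. S) (mix (pairs M)) = hom M (\<lambda>_. S) K'"
    unfolding hom_def mix_def by (intro avg_cong prod.cong) auto
  also have "card (pairs M) * \<gamma> \<le> M\<^sup>2 * \<gamma>"
    using card_pairs_le[of M] \<gamma> by (intro mult_right_mono) (simp_all flip: of_nat_power)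
  finally show ?thesis by simp
qed

section \<open>Transferring a labelling between two point sets\<close>

text \<open>Density of common neighbours for \<open>b = True\<close> and of common non-neighbours
  for \<open>b = False\<close>; a profile prescribes adjacencies of both kinds.\<close>

definition codeg :: "('a \<Rightarrow> 'a \<Rightarrow> bool) \<Rightarrow> 'a set \<Rightarrow> bool \<Rightarrow> 'a \<Rightarrow> 'a \<Rightarrow> real" where
  "codeg g A b v w = avg A (\<lambda>x. of_bool (g v x = b) * of_bool (g w x = b))"

definition profile_test :: "('a \<Rightarrow> 'a \<Rightarrow> bool) \<Rightarrow> nat \<Rightarrow> (nat \<Rightarrow> 'a) \<Rightarrow> (nat \<Rightarrow> bool) \<Rightarrow> 'a \<Rightarrow> real" where
  "profile_test g M X \<sigma> v = (\<Prod>q<M. of_bool (g v (X q) = \<sigma> q))"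

text \<open>The signed measure (\<open>V\<close> minus \<open>S\<close>) of the label class \<open>i\<close>, integrated against \<open>f\<close>.\<close>

definition gap :: "'a set \<Rightarrow> 'a set \<Rightarrow> ('a \<Rightarrow> nat) \<Rightarrow> nat \<Rightarrow> ('a \<Rightarrow> real) \<Rightarrow> real" where
  "gap V S lab i f = avg V (\<lambda>v. of_bool (lab v = i) * f v) - avg S (\<lambda>v. of_bool (lab v = i) * f v)"

lemma codeg_01: "0 \<le> codeg g A b v w" "codeg g A b v w \<le> 1"
  unfolding codeg_def by (auto intro!: avg_nonneg avg_le_one)

lemma gap_mult: "gap V S lab i f * gap V S lab i f' = gap V S lab i (\<lambda>v. gap V S lab i (\<lambda>w. f v * f' w))"
proof -
  have "gap V S lab i (\<lambda>w. c * f' w) = c * gap V S lab i f'" for c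
    unfolding gap_def by (simp add: avg_cmult right_diff_distrib mult.left_commute[of _ c])
  then show ?thesis
    unfolding gap_def[of V S lab i f] gap_def[of V S lab i "\<lambda>v. gap V S lab i (\<lambda>w. f v * f' w)"]
    by (simp add: left_diff_distrib avg_multc mult.assoc[symmetric])
qed

lemma gap_avg: "avg P (\<lambda>X. gap V S lab i (F X)) = gap V S lab i (\<lambda>v. avg P (\<lambda>X. F X v))"
  unfolding gap_def by (simp add: avg_diff avg_swap[of P] avg_cmult)

lemma gap_diff: "gap V S lab i (\<lambda>v. f v - f' v) = gap V S lab i f - gap V S lab i f'"
  unfolding gap_def by (simp add: right_diff_distrib avg_diff)

lemma gap_abs_le: "\<bar>gap V S lab i f\<bar> \<le> avg V (\<lambda>v. \<bar>f v\<bar>) + avg S (\<lambda>v. \<bar>f v\<bar>)"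
proof -
  have "\<bar>avg B (\<lambda>v. of_bool (lab v = i) * f v)\<bar> \<le> avg B (\<lambda>v. \<bar>f v\<bar>)" for B
    by (rule order_trans[OF avg_abs]) (auto intro!: avg_mono)
  from this[of V] this[of S] show ?thesis unfolding gap_def by linarith
qed

text \<open>Squaring doubles the point of integration. The average over \<open>X\<close> then acts
  on a product over independent coordinates, and each coordinate contributes one codegree.\<close>

lemma gap_mean_square:
  assumes "\<And>q. q < M \<Longrightarrow> finite (A q)"
  shows "avg (PiE {..<M} A) (\<lambda>X. (gap V S lab i (profile_test g M X \<sigma>))\<^sup>2)
    = gap V S lab i (\<lambda>v. gap V S lab i (\<lambda>w. \<Prod>q<M. codeg g (A q) (\<sigma> q) v w))"
proof -
  have "avg (PiE {..<M} A) (\<lambda>X. profile_test g M X \<sigma> v * profile_test g M X \<sigma> w)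
      = (\<Prod>q<M. codeg g (A q) (\<sigma> q) v w)" for v w
    unfolding codeg_def profile_test_def prod.distrib[symmetric]
    by (rule avg_PiE_prod[of "{..<M}" A "\<lambda>q x. of_bool (g v x = \<sigma> q) * of_bool (g w x = \<sigma> q)"])
      (use assms in auto)
  then show ?thesis by (simp add: power2_eq_square gap_mult gap_avg)
qed

text \<open>The mean square over tuples factorises into codegrees, so coordinates from different
  sets can be exchanged for coordinates from \<open>R\<close> one at a time.\<close>

lemma gap_mean_square_transfer:
  assumes fin: "finite V" "finite S" "finite R"
    and A: "\<And>q. q < M \<Longrightarrow> A q = V \<or> A q = S"
    and \<theta>: "\<And>Q B C b. Q \<in> {V, S} \<Longrightarrow> B \<in> {V, S} \<Longrightarrow> C \<in> {V, S} \<Longrightarrow>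
      avg B (\<lambda>v. avg C (\<lambda>w. \<bar>codeg g Q b v w - codeg g R b v w\<bar>)) \<le> \<theta>"
  shows "avg (PiE {..<M} A) (\<lambda>X. (gap V S lab i (profile_test g M X \<sigma>))\<^sup>2)
    \<le> avg (PiE {..<M} (\<lambda>_. R)) (\<lambda>X. (gap V S lab i (profile_test g M X \<sigma>))\<^sup>2) + 4 * real M * \<theta>"
proof -
  define P where "P v w = (\<Prod>q<M. codeg g (A q) (\<sigma> q) v w)" for v w
  define Q where "Q v w = (\<Prod>q<M. codeg g R (\<sigma> q) v w)" for v w
  have finA: "finite (A q)" if "q < M" for q using A[OF that] fin by auto
  have PQ: "\<bar>P v w - Q v w\<bar> \<le> (\<Sum>q<M. \<bar>codeg g (A q) (\<sigma> q) v w - codeg g R (\<sigma> q) v w\<bar>)" for v w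
    unfolding P_def Q_def
    using norm_prod_diff[of "{..<M}" "\<lambda>q. codeg g (A q) (\<sigma> q) v w" "\<lambda>q. codeg g R (\<sigma> q) v w"]
    by (simp add: codeg_01)
  have BC: "avg B (\<lambda>v. avg C (\<lambda>w. \<bar>P v w - Q v w\<bar>)) \<le> M * \<theta>" if "B \<in> {V, S}" "C \<in> {V, S}" for B C
  proof -
    have "avg B (\<lambda>v. avg C (\<lambda>w. \<bar>P v w - Q v w\<bar>))
        \<le> avg B (\<lambda>v. avg C (\<lambda>w. \<Sum>q<M. \<bar>codeg g (A q) (\<sigma> q) v w - codeg g R (\<sigma> q) v w\<bar>))"
      by (intro avg_mono PQ)
    also have "\<dots> = (\<Sum>q<M. avg B (\<lambda>v. avg C (\<lambda>w. \<bar>codeg g (A q) (\<sigma> q) v w - codeg g R (\<sigma> q) v w\<bar>)))"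
      by (simp add: avg_sum)
    also have "\<dots> \<le> (\<Sum>q<M. \<theta>)" using A that by (intro sum_mono \<theta>) auto
    finally show ?thesis by simp
  qed
  have "gap V S lab i (\<lambda>v. gap V S lab i (P v)) - gap V S lab i (\<lambda>v. gap V S lab i (Q v))
      = gap V S lab i (\<lambda>v. gap V S lab i (\<lambda>w. P v w - Q v w))"
    by (simp add: gap_diff)
  also have "\<dots> \<le> avg V (\<lambda>v. \<bar>gap V S lab i (\<lambda>w. P v w - Q v w)\<bar>) + avg S (\<lambda>v. \<bar>gap V S lab i (\<lambda>w. P v w - Q v w)\<bar>)"
    using gap_abs_le[of V S lab i "\<lambda>v. gap V S lab i (\<lambda>w. P v w - Q v w)"] by linarith
  also have "\<dots> \<le> avg V (\<lambda>v. avg V (\<lambda>w. \<bar>P v w - Q v w\<bar>) + avg S (\<lambda>w. \<bar>P v w - Q v w\<bar>))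
      + avg S (\<lambda>v. avg V (\<lambda>w. \<bar>P v w - Q v w\<bar>) + avg S (\<lambda>w. \<bar>P v w - Q v w\<bar>))"
    by (intro add_mono avg_mono gap_abs_le)
  also have "\<dots> \<le> 4 * M * \<theta>"
    using BC[of V V] BC[of V S] BC[of S V] BC[of S S] by (simp add: avg_add)
  finally have "gap V S lab i (\<lambda>v. gap V S lab i (P v)) \<le> gap V S lab i (\<lambda>v. gap V S lab i (Q v)) + 4 * M * \<theta>"
    by simp
  then show ?thesis
    using gap_mean_square[of M A V S lab i g \<sigma>] gap_mean_square[of M "\<lambda>_. R" V S lab i g \<sigma>] finA fin
    by (simp add: P_def[abs_def] Q_def[abs_def])
qed

text \<open>Such an \<open>f\<close> is a combination of the indicators of the cells (label,
  profile) with coefficients in \<open>[0, 1]\<close>, so its deviation is at most the sum of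
  theirs.\<close>

lemma profile_function_gap:
  fixes \<Psi> :: "nat \<Rightarrow> (nat \<Rightarrow> bool) \<Rightarrow> real"
  assumes lab: "\<And>z. z \<in> V \<union> S \<Longrightarrow> lab z < k"
    and \<Psi>: "\<And>i \<sigma>. 0 \<le> \<Psi> i \<sigma>" "\<And>i \<sigma>. \<Psi> i \<sigma> \<le> 1"
    and f: "\<And>z. z \<in> V \<union> S \<Longrightarrow> f z = \<Psi> (lab z) (restrict (\<lambda>q. g z (X q)) {..<M})"
  shows "\<bar>avg V f - avg S f\<bar>
    \<le> (\<Sum>i<k. \<Sum>\<sigma>\<in>PiE {..<M} (\<lambda>_. UNIV). \<bar>gap V S lab i (profile_test g M X \<sigma>)\<bar>)"
proof -
  let ?\<Sigma> = "PiE {..<M} (\<lambda>_. UNIV :: bool set)"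
  have fin: "finite ?\<Sigma>" by (intro finite_PiE) auto
  have test: "profile_test g M X \<sigma> z = of_bool (\<sigma> = restrict (\<lambda>q. g z (X q)) {..<M})" if "\<sigma> \<in> ?\<Sigma>" for \<sigma> z
  proof (cases "\<forall>q<M. g z (X q) = \<sigma> q")
    case True
    then have "\<sigma> = restrict (\<lambda>q. g z (X q)) {..<M}"
      using that by (intro PiE_ext[OF that]) auto
    then show ?thesis by (simp add: profile_test_def)
  next
    case False
    then have "(\<Prod>q<M. of_bool (g z (X q) = \<sigma> q)) = (0::real)" by (auto intro!: prod_zero)
    moreover have "\<sigma> \<noteq> restrict (\<lambda>q. g z (X q)) {..<M}" using False by auto
    ultimately show ?thesis by (simp add: profile_test_def)
  qed
  have f_eq: "f z = (\<Sum>i<k. \<Sum>\<sigma>\<in>?\<Sigma>. \<Psi> i \<sigma> * (of_bool (lab z = i) * profile_test g M X \<sigma> z))"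
    if z: "z \<in> V \<union> S" for z
  proof -
    have "(\<Sum>i<k. \<Sum>\<sigma>\<in>?\<Sigma>. \<Psi> i \<sigma> * (of_bool (lab z = i) * profile_test g M X \<sigma> z))
        = (\<Sum>i<k. \<Sum>\<sigma>\<in>?\<Sigma>. if \<sigma> = restrict (\<lambda>q. g z (X q)) {..<M} then
             (if i = lab z then \<Psi> i \<sigma> else 0) else 0)"
      by (intro sum.cong) (auto simp: test)
    also have "\<dots> = \<Psi> (lab z) (restrict (\<lambda>q. g z (X q)) {..<M})"
      using fin lab[OF z] by (simp add: sum.delta)
    finally show ?thesis using f[OF z] by simp
  qed
  have avg_f: "avg B f = (\<Sum>i<k. \<Sum>\<sigma>\<in>?\<Sigma>. \<Psi> i \<sigma> * avg B (\<lambda>z. of_bool (lab z = i) * profile_test g M X \<sigma> z))"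
    if "B \<subseteq> V \<union> S" for B
  proof -
    have "avg B f = avg B (\<lambda>z. \<Sum>i<k. \<Sum>\<sigma>\<in>?\<Sigma>. \<Psi> i \<sigma> * (of_bool (lab z = i) * profile_test g M X \<sigma> z))"
      using that by (intro avg_cong refl f_eq) auto
    then show ?thesis by (simp only: avg_sum avg_cmult)
  qed
  have "avg V f - avg S f = (\<Sum>i<k. \<Sum>\<sigma>\<in>?\<Sigma>. \<Psi> i \<sigma> * gap V S lab i (profile_test g M X \<sigma>))"
    by (simp add: avg_f gap_def right_diff_distrib sum_subtractf)
  also have "\<bar>\<dots>\<bar> \<le> (\<Sum>i<k. \<Sum>\<sigma>\<in>?\<Sigma>. \<bar>\<Psi> i \<sigma> * gap V S lab i (profile_test g M X \<sigma>)\<bar>)"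
    by (rule order_trans[OF sum_abs sum_mono]) (rule sum_abs)
  also have "\<dots> \<le> (\<Sum>i<k. \<Sum>\<sigma>\<in>?\<Sigma>. \<bar>gap V S lab i (profile_test g M X \<sigma>)\<bar>)"
    using \<Psi> by (intro sum_mono) (auto simp: abs_mult intro: mult_left_le_one_le)
  finally show ?thesis .
qed

text \<open>With the other points fixed, the weight of a tuple sees of one point only its label and
  its adjacency profile towards the others. So points move from \<open>V\<close> to \<open>S\<close>
  one position at a time; the mean deviation over mixed tuples is bounded by Cauchy-Schwarz, and the
  mean square moves to tuples in \<open>R\<close> through codegrees.\<close>

lemma hom_transfer:
  fixes g :: "'a \<Rightarrow> 'a \<Rightarrow> bool" and c :: "nat \<Rightarrow> nat \<Rightarrow> bool \<Rightarrow> nat \<Rightarrow> nat \<Rightarrow> real"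
    and k :: nat
  assumes fin: "finite V" "V \<noteq> {}" "finite S" "S \<noteq> {}" "finite R"
    and g: "\<And>x y. g x y = g y x"
    and lab: "\<And>z. z \<in> V \<union> S \<Longrightarrow> lab z < k"
    and c: "\<And>p q b i j. 0 \<le> c p q b i j" "\<And>p q b i j. c p q b i j \<le> 1"
    and \<theta>a: "\<And>i \<sigma>. i < k \<Longrightarrow> \<sigma> \<in> PiE {..<M} (\<lambda>_. UNIV) \<Longrightarrow>
      avg (PiE {..<M} (\<lambda>_. R)) (\<lambda>X. (gap V S lab i (profile_test g M X \<sigma>))\<^sup>2) \<le> \<theta>a"
    and \<theta>b: "\<And>Q B C b. Q \<in> {V, S} \<Longrightarrow> B \<in> {V, S} \<Longrightarrow> C \<in> {V, S} \<Longrightarrow>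
      avg B (\<lambda>v. avg C (\<lambda>w. \<bar>codeg g Q b v w - codeg g R b v w\<bar>)) \<le> \<theta>b"
  defines "K \<equiv> \<lambda>p q x y. c p q (g x y) (lab x) (lab y)"
  shows "\<bar>hom M (\<lambda>_. V) K - hom M (\<lambda>_. S) K\<bar> \<le> real M * (real k * 2 ^ M * sqrt (\<theta>a + 4 * real M * \<theta>b))"
proof -
  let ?\<Sigma> = "PiE {..<M} (\<lambda>_. UNIV :: bool set)"
  \<comment> \<open>Positions below \<open>p\<close> have already moved to \<open>S\<close>.\<close>
  define A where "A p = (\<lambda>q. if q < p then S else V)" for p :: nat
  define F where "F y = (\<Prod>e\<in>pairs M. K (fst e) (snd e) (y (fst e)) (y (snd e)))" for y
  have step: "\<bar>hom M (A p) K - hom M (A (Suc p)) K\<bar> \<le> real k * 2 ^ M * sqrt (\<theta>a + 4 * real M * \<theta>b)"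
    if p: "p < M" for p
  proof -
    have Ap: "A p p = V" "(A p)(p := S) = A (Suc p)" by (auto simp: A_def fun_eq_iff less_Suc_eq)
    have finA: "finite (A p q)" for q using fin by (simp add: A_def)
    have h1: "hom M (A p) K = avg (PiE {..<M} (A p)) (\<lambda>y. avg V (\<lambda>z. F (y(p := z))))"
      unfolding hom_def F_def[symmetric]
      by (subst avg_PiE_resample_same[where p = p]) (use p finA fin Ap in auto)
    have h2: "hom M (A (Suc p)) K = avg (PiE {..<M} (A p)) (\<lambda>y. avg S (\<lambda>z. F (y(p := z))))"
      unfolding hom_def F_def[symmetric] Ap(2)[symmetric]
      by (subst avg_PiE_resample[where p = p]) (use p finA fin Ap in auto)
    have one: "\<bar>avg V (\<lambda>z. F (y(p := z))) - avg S (\<lambda>z. F (y(p := z)))\<bar>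
        \<le> (\<Sum>i<k. \<Sum>\<sigma>\<in>?\<Sigma>. \<bar>gap V S lab i (profile_test g M y \<sigma>)\<bar>)" for y
    proof -
      \<comment> \<open>The integrand in terms of the label \<open>i\<close> and the profile
        \<open>\<sigma>\<close> of the moving point; by symmetry of \<open>g\<close> one profile
        serves the pairs in which this point comes first and those in which it comes second.\<close>
      define \<Psi> where "\<Psi> i \<sigma> = (\<Prod>e\<in>pairs M.
        if fst e = p then c p (snd e) (\<sigma> (snd e)) i (lab (y (snd e)))
        else if snd e = p then c (fst e) p (\<sigma> (fst e)) (lab (y (fst e))) i
        else K (fst e) (snd e) (y (fst e)) (y (snd e)))" for i \<sigma>
      show ?thesis
      proof (rule profile_function_gap[OF lab])
        show "0 \<le> \<Psi> i \<sigma>" "\<Psi> i \<sigma> \<le> 1" for i \<sigma>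
          unfolding \<Psi>_def K_def using c by (auto intro!: prod_nonneg prod_le_1)
        show "F (y(p := z)) = \<Psi> (lab z) (restrict (\<lambda>q. g z (y q)) {..<M})" for z
          unfolding F_def \<Psi>_def using p by (intro prod.cong) (auto simp: pairs_def K_def g)
      qed
    qed
    have cell: "avg (PiE {..<M} (A p)) (\<lambda>y. \<bar>gap V S lab i (profile_test g M y \<sigma>)\<bar>) \<le> sqrt (\<theta>a + 4 * real M * \<theta>b)"
      if "i < k" "\<sigma> \<in> ?\<Sigma>" for i \<sigma>
    proof (rule avg_abs_le_sqrt)
      have "avg (PiE {..<M} (A p)) (\<lambda>y. (gap V S lab i (profile_test g M y \<sigma>))\<^sup>2)
          \<le> avg (PiE {..<M} (\<lambda>_. R)) (\<lambda>X. (gap V S lab i (profile_test g M X \<sigma>))\<^sup>2) + 4 * real M * \<theta>b"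
        by (rule gap_mean_square_transfer) (use fin \<theta>b in \<open>auto simp: A_def\<close>)
      then show "avg (PiE {..<M} (A p)) (\<lambda>y. (gap V S lab i (profile_test g M y \<sigma>))\<^sup>2) \<le> \<theta>a + 4 * real M * \<theta>b"
        using \<theta>a[OF that] by linarith
    qed
    have "\<bar>hom M (A p) K - hom M (A (Suc p)) K\<bar>
        \<le> avg (PiE {..<M} (A p)) (\<lambda>y. \<bar>avg V (\<lambda>z. F (y(p := z))) - avg S (\<lambda>z. F (y(p := z)))\<bar>)"
      unfolding h1 h2 avg_diff[symmetric] by (rule avg_abs)
    also have "\<dots> \<le> avg (PiE {..<M} (A p)) (\<lambda>y. \<Sum>i<k. \<Sum>\<sigma>\<in>?\<Sigma>. \<bar>gap V S lab i (profile_test g M y \<sigma>)\<bar>)"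
      by (intro avg_mono one)
    also have "\<dots> \<le> (\<Sum>i<k. \<Sum>\<sigma>\<in>?\<Sigma>. sqrt (\<theta>a + 4 * real M * \<theta>b))"
      unfolding avg_sum by (intro sum_mono cell) auto
    also have "\<dots> = real k * 2 ^ M * sqrt (\<theta>a + 4 * real M * \<theta>b)"
      by (simp add: card_PiE)
    finally show ?thesis .
  qed
  have main: "\<bar>hom M (A 0) K - hom M (A p) K\<bar> \<le> p * (real k * 2 ^ M * sqrt (\<theta>a + 4 * real M * \<theta>b))" if "p \<le> M" for p
    using that
  proof (induction p)
    case (Suc p)
    then show ?case using step[of p] by (simp add: algebra_simps)
  qed simp
  have "hom M (A 0) K = hom M (\<lambda>_. V) K" by (simp add: A_def)
  moreover have "hom M (A M) K = hom M (\<lambda>_. S) K"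
    unfolding hom_def by (intro avg_cong PiE_cong) (auto simp: A_def)
  ultimately show ?thesis using main[of M] by simp
qed

text \<open>For a minimiser \<open>\<pi>\<close> no single vertex gains by changing its label; hence \<open>\<pi>\<close> nearly minimises
  the linear functional given by its own residuals, and testing that functional against \<open>z\<close> bounds
  the sum of the squared residuals.\<close>

lemma matching:
  fixes \<tau> :: "'t \<Rightarrow> 'a \<Rightarrow> real" and z :: "nat \<Rightarrow> 't \<Rightarrow> real"
  assumes V: "finite V" "V \<noteq> {}" and k: "0 < k" and \<Theta>: "finite \<Theta>"
    and \<tau>: "\<And>t v. 0 \<le> \<tau> t v" "\<And>t v. \<tau> t v \<le> 1"
    and z: "\<And>i t. 0 \<le> z i t" "\<And>i t. z i t \<le> 1"
    and lln: "\<And>\<mu>. (\<And>i t. \<bar>\<mu> i t\<bar> \<le> 1) \<Longrightarrow>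
      avg V (\<lambda>v. MIN i\<in>{..<k}. \<Sum>t\<in>\<Theta>. \<mu> i t * \<tau> t v) \<le> (\<Sum>i<k. \<Sum>t\<in>\<Theta>. \<mu> i t * z i t) + \<omega>"
  shows "\<exists>\<pi>. (\<forall>v\<in>V. \<pi> v < k) \<and>
    (\<Sum>i<k. \<Sum>t\<in>\<Theta>. (avg V (\<lambda>v. of_bool (\<pi> v = i) * \<tau> t v) - z i t)\<^sup>2) \<le> card \<Theta> / card V + \<omega>"
proof -
  define n where "n = real (card V)"
  have n: "0 < n" using V by (simp add: n_def card_gt_0_iff)
  define r where "r \<pi> i t = avg V (\<lambda>v. of_bool (\<pi> v = i) * \<tau> t v) - z i t" for \<pi> :: "'a \<Rightarrow> nat" and i t
  define E where "E \<pi> = (\<Sum>i<k. \<Sum>t\<in>\<Theta>. (r \<pi> i t)\<^sup>2)" for \<pi>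
  have fin: "finite (PiE V (\<lambda>_. {..<k}))" using V by (intro finite_PiE) auto
  moreover have ne: "PiE V (\<lambda>_. {..<k}) \<noteq> {}" using k by (auto simp: PiE_eq_empty_iff)
  ultimately obtain \<pi> where \<pi>: "\<pi> \<in> PiE V (\<lambda>_. {..<k})" and "is_arg_min E (\<lambda>\<pi>. \<pi> \<in> PiE V (\<lambda>_. {..<k})) \<pi>"
    using ex_is_arg_min_if_finite[of "PiE V (\<lambda>_. {..<k})" E] by (auto simp: is_arg_min_def)
  then have opt: "E \<pi> \<le> E \<pi>'" if "\<pi>' \<in> PiE V (\<lambda>_. {..<k})" for \<pi>'
    using that by (auto simp: is_arg_min_linorder)
  define l where "l = r \<pi>"
  define L where "L i v = (\<Sum>t\<in>\<Theta>. l i t * \<tau> t v)" for i v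
  have lab: "\<pi> v < k" if "v \<in> V" for v using \<pi> that by auto
  have loc: "L (\<pi> v) v \<le> L j v + card \<Theta> / n" if v: "v \<in> V" and j: "j < k" for v j
  proof -
    \<comment> \<open>The change of the residuals when \<open>v\<close> moves from its label to
      \<open>j\<close>: at most two rows change, each entry by at most \<open>1 / n\<close>.\<close>
    define d where "d i t = (of_bool (i = j) - of_bool (i = \<pi> v)) * \<tau> t v / n" for i t
    have "\<pi>(v := j) \<in> PiE V (\<lambda>_. {..<k})" using \<pi> v j by (auto simp: PiE_iff extensional_def)
    then have le: "E \<pi> \<le> E (\<pi>(v := j))" by (rule opt)
    have r': "r (\<pi>(v := j)) i t = l i t + d i t" for i t
    proof -
      have "(\<Sum>w\<in>V. of_bool ((\<pi>(v := j)) w = i) * \<tau> t w)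
          = of_bool (j = i) * \<tau> t v + (\<Sum>w\<in>V - {v}. of_bool (\<pi> w = i) * \<tau> t w)"
        using V v by (subst sum.remove[of _ v]) (auto intro!: sum.cong)
      moreover have "(\<Sum>w\<in>V. of_bool (\<pi> w = i) * \<tau> t w)
          = of_bool (\<pi> v = i) * \<tau> t v + (\<Sum>w\<in>V - {v}. of_bool (\<pi> w = i) * \<tau> t w)"
        using V v by (subst sum.remove[of _ v]) auto
      ultimately have "(\<Sum>w\<in>V. of_bool ((\<pi>(v := j)) w = i) * \<tau> t w)
          = (\<Sum>w\<in>V. of_bool (\<pi> w = i) * \<tau> t w) + (of_bool (i = j) - of_bool (i = \<pi> v)) * \<tau> t v"
        by (auto simp: algebra_simps)
      then show ?thesis by (simp add: r_def l_def d_def avg_def n_def add_divide_distrib)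
    qed
    have d1: "(\<Sum>i<k. \<Sum>t\<in>\<Theta>. l i t * d i t) = (L j v - L (\<pi> v) v) / n"
    proof -
      have "(\<Sum>i<k. \<Sum>t\<in>\<Theta>. l i t * d i t) = (\<Sum>i<k. (of_bool (i = j) - of_bool (i = \<pi> v)) * (L i v / n))"
        unfolding L_def d_def sum_divide_distrib sum_distrib_left
        by (intro sum.cong refl) (simp add: mult_ac)
      also have "\<dots> = (\<Sum>i<k. if i = j then L i v / n else 0) - (\<Sum>i<k. if i = \<pi> v then L i v / n else 0)"
        unfolding sum_subtractf[symmetric] by (intro sum.cong) auto
      finally show ?thesis using j lab[OF v] by (simp add: sum.delta diff_divide_distrib)
    qed
    have d2: "(\<Sum>i<k. \<Sum>t\<in>\<Theta>. (d i t)\<^sup>2) \<le> 2 * (card \<Theta> / n\<^sup>2)"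
    proof -
      have "(\<Sum>i<k. \<Sum>t\<in>\<Theta>. (d i t)\<^sup>2) \<le> (\<Sum>i<k. \<Sum>t\<in>\<Theta>. (if i = j then 1 / n\<^sup>2 else 0) + (if i = \<pi> v then 1 / n\<^sup>2 else 0))"
        using \<tau> n by (intro sum_mono) (auto simp: d_def power_divide intro!: divide_right_mono power_le_one)
      also have "\<dots> = (\<Sum>i<k. (if i = j then card \<Theta> / n\<^sup>2 else 0)) + (\<Sum>i<k. if i = \<pi> v then card \<Theta> / n\<^sup>2 else 0)"
        unfolding sum.distrib[symmetric] by (intro sum.cong) auto
      finally show ?thesis using j lab[OF v] by (simp add: sum.delta)
    qed
    have "E (\<pi>(v := j)) = E \<pi> + 2 * (\<Sum>i<k. \<Sum>t\<in>\<Theta>. l i t * d i t) + (\<Sum>i<k. \<Sum>t\<in>\<Theta>. (d i t)\<^sup>2)"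
      unfolding E_def r' l_def[symmetric]
      by (simp add: power2_sum sum.distrib sum_distrib_left mult.assoc)
    \<comment> \<open>Minimality of \<open>\<pi>\<close>, halved: the first-order change plus half
      of the second-order term cannot be negative. Multiplied by \<open>n\<close>, the latter is the
      loss \<open>card \<Theta> / n\<close>.\<close>
    then have "0 \<le> (L j v - L (\<pi> v) v) / n + card \<Theta> / n\<^sup>2"
      using le d1 d2 by linarith
    then have "0 \<le> n * ((L j v - L (\<pi> v) v) / n + card \<Theta> / n\<^sup>2)"
      using n by (intro mult_nonneg_nonneg) auto
    moreover have "n * ((L j v - L (\<pi> v) v) / n + card \<Theta> / n\<^sup>2) = L j v - L (\<pi> v) v + card \<Theta> / n"
      using n by (simp add: field_simps power2_eq_square)
    ultimately show ?thesis by linarith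
  qed
  have l1: "\<bar>l i t\<bar> \<le> 1" for i t
  proof -
    have "0 \<le> avg V (\<lambda>v. of_bool (\<pi> v = i) * \<tau> t v)" "avg V (\<lambda>v. of_bool (\<pi> v = i) * \<tau> t v) \<le> 1"
      using \<tau> by (auto intro!: avg_nonneg avg_le_one)
    then show ?thesis using z[of i t] by (auto simp: l_def r_def)
  qed
  \<comment> \<open>One factor of each squared residual stays as the coefficient \<open>l\<close>,
    the other is expanded: the two sums are the costs of \<open>\<pi>\<close> and of
    \<open>z\<close> under one linear functional.\<close>
  have "E \<pi> = (\<Sum>i<k. \<Sum>t\<in>\<Theta>. l i t * avg V (\<lambda>v. of_bool (\<pi> v = i) * \<tau> t v)) - (\<Sum>i<k. \<Sum>t\<in>\<Theta>. l i t * z i t)"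
    by (simp add: E_def l_def r_def power2_eq_square right_diff_distrib sum_subtractf)
  also have "(\<Sum>i<k. \<Sum>t\<in>\<Theta>. l i t * avg V (\<lambda>v. of_bool (\<pi> v = i) * \<tau> t v)) = avg V (\<lambda>v. L (\<pi> v) v)"
  proof -
    have "avg V (\<lambda>v. L (\<pi> v) v) = avg V (\<lambda>v. \<Sum>i<k. \<Sum>t\<in>\<Theta>. l i t * (of_bool (\<pi> v = i) * \<tau> t v))"
    proof (rule avg_cong[OF refl])
      fix v assume v: "v \<in> V"
      have "(\<Sum>i<k. \<Sum>t\<in>\<Theta>. l i t * (of_bool (\<pi> v = i) * \<tau> t v)) = (\<Sum>i<k. if i = \<pi> v then L i v else 0)"
        by (intro sum.cong) (auto simp: L_def)
      then show "L (\<pi> v) v = (\<Sum>i<k. \<Sum>t\<in>\<Theta>. l i t * (of_bool (\<pi> v = i) * \<tau> t v))"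
        using lab[OF v] by (simp add: sum.delta)
    qed
    then show ?thesis by (simp only: avg_sum avg_cmult)
  qed
  also have "avg V (\<lambda>v. L (\<pi> v) v) \<le> avg V (\<lambda>v. (MIN i\<in>{..<k}. L i v) + card \<Theta> / n)"
  proof (intro avg_mono)
    fix v assume v: "v \<in> V"
    have "(MIN i\<in>{..<k}. L i v) \<in> (\<lambda>i. L i v) ` {..<k}" using k by (intro Min_in) auto
    then obtain j where "j < k" "(MIN i\<in>{..<k}. L i v) = L j v" by auto
    then show "L (\<pi> v) v \<le> (MIN i\<in>{..<k}. L i v) + card \<Theta> / n" using loc[OF v] by auto
  qed
  also have "\<dots> = avg V (\<lambda>v. MIN i\<in>{..<k}. L i v) + card \<Theta> / n"
    using V by (simp add: avg_add avg_const)
  also have "avg V (\<lambda>v. MIN i\<in>{..<k}. L i v) \<le> (\<Sum>i<k. \<Sum>t\<in>\<Theta>. l i t * z i t) + \<omega>"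
    unfolding L_def using l1 by (rule lln)
  finally have "E \<pi> \<le> card \<Theta> / n + \<omega>" by linarith
  then show ?thesis using lab unfolding E_def r_def n_def by blast
qed

section \<open>Rounding a fractional graph\<close>

definition indep_at :: "'e \<Rightarrow> (('e \<Rightarrow> real) \<Rightarrow> real) \<Rightarrow> bool" where
  "indep_at e F \<longleftrightarrow> (\<forall>w t. F (w(e := t)) = F w)"

definition affine_at :: "'e \<Rightarrow> (('e \<Rightarrow> real) \<Rightarrow> real) \<Rightarrow> bool" where
  "affine_at e F \<longleftrightarrow> (\<forall>w t. F (w(e := t)) = (1 - t) * F (w(e := 0)) + t * F (w(e := 1)))"

lemma indep_at_imp_affine_at: "indep_at e F \<Longrightarrow> affine_at e F"
  by (simp add: indep_at_def affine_at_def algebra_simps)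

lemma affine_at_add: "affine_at e F \<Longrightarrow> affine_at e F' \<Longrightarrow> affine_at e (\<lambda>w. F w + F' w)"
  unfolding affine_at_def by (simp add: algebra_simps)

lemma affine_at_diff_const: "affine_at e F \<Longrightarrow> affine_at e (\<lambda>w. F w - c)"
  unfolding affine_at_def by (simp add: algebra_simps)

lemma affine_at_const_diff: "affine_at e F \<Longrightarrow> affine_at e (\<lambda>w. c - F w)"
  unfolding affine_at_def by (simp add: algebra_simps)

lemma affine_at_mult:
  assumes F: "affine_at e F" and F': "indep_at e F'"
  shows "affine_at e (\<lambda>w. F w * F' w)"
  unfolding affine_at_def
proof (intro allI)
  fix w t
  have "F (w(e := t)) = (1 - t) * F (w(e := 0)) + t * F (w(e := 1))"
    using F unfolding affine_at_def by blast
  moreover have "F' (w(e := s)) = F' w" for s using F' by (simp add: indep_at_def)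
  ultimately show "F (w(e := t)) * F' (w(e := t))
      = (1 - t) * (F (w(e := 0)) * F' (w(e := 0))) + t * (F (w(e := 1)) * F' (w(e := 1)))"
    by (simp only:) (simp add: algebra_simps)
qed

lemma affine_at_cmult: "affine_at e F \<Longrightarrow> affine_at e (\<lambda>w. c * F w)"
  using affine_at_mult[of e F "\<lambda>_. c"] by (simp add: indep_at_def mult.commute)

lemma affine_at_sum:
  assumes "\<And>i. i \<in> I \<Longrightarrow> affine_at e (F i)"
  shows "affine_at e (\<lambda>w. \<Sum>i\<in>I. F i w)"
  using assms
proof (induction I rule: infinite_finite_induct)
  case (insert i I)
  then have "affine_at e (\<lambda>w. F i w + (\<Sum>i\<in>I. F i w))" by (intro affine_at_add) auto
  then show ?case using insert by simp
qed (auto simp: affine_at_def)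

lemma affine_at_avg:
  assumes "\<And>i. i \<in> I \<Longrightarrow> affine_at e (F i)"
  shows "affine_at e (\<lambda>w. avg I (\<lambda>i. F i w))"
proof -
  have "affine_at e (\<lambda>w. (1 / card I) * (\<Sum>i\<in>I. F i w))"
    by (intro affine_at_cmult affine_at_sum assms)
  then show ?thesis by (simp add: avg_def)
qed

lemma affine_at_coord: "affine_at e (\<lambda>w. w x)"
  by (auto simp: affine_at_def algebra_simps)

lemma affine_at_if: "affine_at e F \<Longrightarrow> affine_at e F' \<Longrightarrow> affine_at e (\<lambda>w. if b then F w else F' w)"
  by (cases b) simp_all

lemma indep_at_prod: "(\<And>i. i \<in> I \<Longrightarrow> indep_at e (F i)) \<Longrightarrow> indep_at e (\<lambda>w. \<Prod>i\<in>I. F i w)"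
  by (simp add: indep_at_def)

lemma affine_at_prod:
  assumes I: "finite I" and aff: "\<And>i. i \<in> I \<Longrightarrow> affine_at e (F i)"
    and one: "\<And>i j. i \<in> I \<Longrightarrow> j \<in> I \<Longrightarrow> i \<noteq> j \<Longrightarrow> indep_at e (F i) \<or> indep_at e (F j)"
  shows "affine_at e (\<lambda>w. \<Prod>i\<in>I. F i w)"
proof (cases "\<exists>i\<in>I. \<not> indep_at e (F i)")
  case True
  then obtain i where i: "i \<in> I" "\<not> indep_at e (F i)" by blast
  have "affine_at e (\<lambda>w. F i w * (\<Prod>j\<in>I - {i}. F j w))"
    using i one by (intro affine_at_mult aff indep_at_prod) auto
  then show ?thesis using i I by (simp add: prod.remove)
qed (auto intro: indep_at_imp_affine_at indep_at_prod)

text \<open>The method of conditional expectations: along one coordinate the value is a convex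
  combination of the values at \<open>0\<close> and \<open>1\<close>, so one of these does not
  exceed it.\<close>

lemma multi_affine_rounding:
  assumes "finite E" "\<And>e. e \<in> E \<Longrightarrow> affine_at e F" "\<And>e. 0 \<le> w e" "\<And>e. w e \<le> 1"
  shows "\<exists>w'. (\<forall>e\<in>E. w' e = 0 \<or> w' e = 1) \<and> (\<forall>e. 0 \<le> w' e \<and> w' e \<le> 1) \<and> F w' \<le> F w"
  using assms
proof (induction E arbitrary: F w)
  case empty
  then show ?case by (intro exI[of _ w]) auto
next
  case (insert e E)
  have eq: "F w = (1 - w e) * F (w(e := 0)) + w e * F (w(e := 1))"
    using insert.prems(1)[of e] unfolding affine_at_def by (metis fun_upd_triv insertI1)
  have "\<exists>b\<in>{0, 1}. F (w(e := b)) \<le> F w"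
  proof (rule ccontr)
    assume "\<not> ?thesis"
    then have lt: "F w < F (w(e := 0))" "F w < F (w(e := 1))" by auto
    have "(1 - w e) * F w + w e * F w < (1 - w e) * F (w(e := 0)) + w e * F (w(e := 1))"
    proof (cases "w e = 0")
      case False
      then have "w e * F w < w e * F (w(e := 1))"
        using insert.prems(2)[of e] lt by (intro mult_strict_left_mono) auto
      moreover have "(1 - w e) * F w \<le> (1 - w e) * F (w(e := 0))"
        using insert.prems(3)[of e] lt by (intro mult_left_mono) auto
      ultimately show ?thesis by linarith
    qed (use lt in simp)
    then show False using eq by (simp add: algebra_simps)
  qed
  then obtain b :: real where b: "b \<in> {0, 1}" "F (w(e := b)) \<le> F w" by blast
  have aff: "affine_at e' (\<lambda>w. F (w(e := b)))" if "e' \<in> E" for e'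
  proof -
    have "e' \<noteq> e" using that insert.hyps by auto
    then show ?thesis
      using insert.prems(1)[of e'] that unfolding affine_at_def by (metis fun_upd_twist insertI2)
  qed
  have rounded: "\<exists>w'. (\<forall>e\<in>E. w' e = 0 \<or> w' e = 1) \<and> (\<forall>e. 0 \<le> w' e \<and> w' e \<le> 1) \<and>
      F (w'(e := b)) \<le> F (w(e := b))"
    using insert.IH[of "\<lambda>w. F (w(e := b))" w, OF aff insert.prems(2,3)] by simp
  then obtain w' where w': "\<forall>e\<in>E. w' e = 0 \<or> w' e = 1" "\<forall>e. 0 \<le> w' e \<and> w' e \<le> 1" "F (w'(e := b)) \<le> F (w(e := b))"
    using rounded by blast
  show ?case
  proof (intro exI[of _ "w'(e := b)"] conjI)
    show "F (w'(e := b)) \<le> F w" using w'(3) b(2) by linarith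
  qed (use w' b in auto)
qed

section \<open>Edit distance and copy counts as functions of edge weights\<close>

definition ordered :: "nat \<Rightarrow> nat \<Rightarrow> nat \<times> nat" where
  "ordered a b = (min a b, max a b)"

definition edit_fun :: "nat \<Rightarrow> (nat \<Rightarrow> nat \<Rightarrow> bool) \<Rightarrow> (nat \<times> nat \<Rightarrow> real) \<Rightarrow> real" where
  "edit_fun n g w = avg {..<n} (\<lambda>a. avg {..<n} (\<lambda>b. if g a b then 1 - w (ordered a b) else w (ordered a b)))"

text \<open>The injectivity factor ensures that distinct pairs of positions use distinct edge
  weights, which makes the product affine in every weight.\<close>

definition copy_fun :: "nat \<Rightarrow> (nat \<Rightarrow> nat \<Rightarrow> bool) \<Rightarrow> (nat \<Rightarrow> nat) \<Rightarrow> (nat \<times> nat \<Rightarrow> real) \<Rightarrow> real" where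
  "copy_fun m J x w = of_bool (inj_on x {..<m}) * (\<Prod>e\<in>pairs m.
     if J (fst e) (snd e) then w (ordered (x (fst e)) (x (snd e)))
     else 1 - w (ordered (x (fst e)) (x (snd e))))"

definition copies :: "nat \<Rightarrow> nat \<Rightarrow> nat \<times> (nat \<Rightarrow> nat \<Rightarrow> bool) \<Rightarrow> (nat \<times> nat \<Rightarrow> real) \<Rightarrow> real" where
  "copies n M mJ w = avg (PiE {..<M} (\<lambda>_. {..<n})) (\<lambda>x. copy_fun (fst mJ) (snd mJ) x w)"

lemma affine_at_edit_fun: "affine_at e (edit_fun n g)"
  unfolding edit_fun_def[abs_def]
  by (intro affine_at_avg affine_at_if affine_at_coord affine_at_const_diff)

lemma ordered_eq_iff: "ordered a b = ordered c d \<longleftrightarrow> {a, b} = {c, d}"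
  by (auto simp: ordered_def min_def max_def doubleton_eq_iff)

lemma copy_fun_01:
  assumes "\<forall>e. 0 \<le> w e \<and> w e \<le> 1"
  shows "0 \<le> copy_fun m J x w" "copy_fun m J x w \<le> 1"
proof -
  let ?P = "\<Prod>e\<in>pairs m. if J (fst e) (snd e) then w (ordered (x (fst e)) (x (snd e)))
     else 1 - w (ordered (x (fst e)) (x (snd e)))"
  have "0 \<le> w (ordered a b)" "w (ordered a b) \<le> 1" for a b using assms by blast+
  then have "0 \<le> ?P" "?P \<le> 1" by (auto intro!: prod_nonneg prod_le_1)
  then show "0 \<le> copy_fun m J x w" "copy_fun m J x w \<le> 1" by (auto simp: copy_fun_def)
qed

lemma affine_at_copy_fun: "affine_at e (copy_fun m J x)"
proof (cases "inj_on x {..<m}")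
  case True
  have ind: "indep_at e (\<lambda>w. if J (fst d) (snd d) then w (ordered (x (fst d)) (x (snd d)))
     else 1 - w (ordered (x (fst d)) (x (snd d))))" if "ordered (x (fst d)) (x (snd d)) \<noteq> e" for d
    using that by (auto simp: indep_at_def)
  have inj: "ordered (x (fst d)) (x (snd d)) \<noteq> ordered (x (fst d')) (x (snd d'))"
    if "d \<in> pairs m" "d' \<in> pairs m" "d \<noteq> d'" for d d'
  proof
    assume "ordered (x (fst d)) (x (snd d)) = ordered (x (fst d')) (x (snd d'))"
    then have "x ` {fst d, snd d} = x ` {fst d', snd d'}" by (simp add: ordered_eq_iff)
    then have "{fst d, snd d} = {fst d', snd d'}"
      using that by (subst (asm) inj_on_image_eq_iff[OF True]) (auto simp: pairs_def)
    then show False using that by (auto simp: pairs_def doubleton_eq_iff)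
  qed
  show ?thesis
    unfolding copy_fun_def[abs_def]
  proof (intro affine_at_cmult affine_at_prod)
    show "affine_at e (\<lambda>w. if J (fst d) (snd d) then w (ordered (x (fst d)) (x (snd d)))
       else 1 - w (ordered (x (fst d)) (x (snd d))))" for d
      by (intro affine_at_if affine_at_coord affine_at_const_diff)
  next
    fix d d' assume "d \<in> pairs m" "d' \<in> pairs m" "d \<noteq> d'"
    then have "ordered (x (fst d)) (x (snd d)) \<noteq> e \<or> ordered (x (fst d')) (x (snd d')) \<noteq> e"
      using inj by metis
    then show "indep_at e (\<lambda>w. if J (fst d) (snd d) then w (ordered (x (fst d)) (x (snd d)))
       else 1 - w (ordered (x (fst d)) (x (snd d)))) \<or>
      indep_at e (\<lambda>w. if J (fst d') (snd d') then w (ordered (x (fst d')) (x (snd d')))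
       else 1 - w (ordered (x (fst d')) (x (snd d'))))"
      using ind[of d] ind[of d'] by blast
  qed simp
qed (auto simp: copy_fun_def[abs_def] affine_at_def)

lemma indep_at_copy_fun:
  assumes "a \<notin> x ` {..<m} \<or> b \<notin> x ` {..<m}"
  shows "indep_at (a, b) (copy_fun m J x)"
proof -
  have "ordered (x (fst d)) (x (snd d)) \<noteq> (a, b)" if "d \<in> pairs m" for d
  proof
    assume "ordered (x (fst d)) (x (snd d)) = (a, b)"
    then have "a \<in> {x (fst d), x (snd d)}" "b \<in> {x (fst d), x (snd d)}"
      by (auto simp: ordered_def min_def max_def split: if_splits)
    then show False using assms that by (auto simp: pairs_def)
  qed
  then show ?thesis
    unfolding indep_at_def copy_fun_def by (auto intro!: prod.cong)
qed

lemma avg_hits_le: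
  fixes n m M :: nat and x :: "nat \<Rightarrow> nat"
  assumes n: "0 < n" and m: "m \<le> M"
  shows "avg (PiE {..<M} (\<lambda>_. {..<n})) (\<lambda>y. of_bool (x ` {..<m} \<inter> y ` {..<m} \<noteq> {})) \<le> M\<^sup>2 / n"
proof -
  let ?P = "PiE {..<M} (\<lambda>_. {..<n})"
  have one: "avg ?P (\<lambda>y. of_bool (y p = c)) \<le> 1 / n" if "p < M" for p c
  proof -
    have "avg ?P (\<lambda>y. of_bool (y p = c)) = avg {..<n} (\<lambda>v. of_bool (v = c))"
      by (rule avg_PiE_component[where f = "\<lambda>v. of_bool (v = c)"]) (use that n in auto)
    also have "\<dots> \<le> 1 / n"
      unfolding avg_def by (auto simp: of_bool_def sum.delta intro!: divide_right_mono)
    finally show ?thesis .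
  qed
  have "avg ?P (\<lambda>y. of_bool (x ` {..<m} \<inter> y ` {..<m} \<noteq> {}))
      \<le> avg ?P (\<lambda>y. \<Sum>e\<in>{..<m} \<times> {..<m}. of_bool (y (fst e) = x (snd e)))"
    by (intro avg_mono of_bool_le_sum) (force simp: disjoint_iff)+
  also have "\<dots> = (\<Sum>e\<in>{..<m} \<times> {..<m}. avg ?P (\<lambda>y. of_bool (y (fst e) = x (snd e))))" by (simp only: avg_sum)
  also have "\<dots> \<le> (\<Sum>e\<in>{..<m} \<times> {..<m}. 1 / n)" using m by (intro sum_mono one) auto
  also have "\<dots> = m\<^sup>2 / n" by (simp add: power2_eq_square)
  also have "\<dots> \<le> M\<^sup>2 / n" using m by (intro divide_right_mono power_mono) auto
  finally show ?thesis .
qed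

text \<open>For each pattern the sum of \<open>(P x - c) (P y - c)\<close> over pairs of disjoint tuples is almost the
  squared deviation of the copy density, and unlike the latter it is affine in every edge weight.\<close>

lemma rounding:
  fixes n M :: nat and L :: real
  assumes n: "0 < n" and JJ: "finite JJ" "\<And>mJ. mJ \<in> JJ \<Longrightarrow> fst mJ \<le> M"
    and W: "\<forall>e. 0 \<le> W e \<and> W e \<le> 1" and L: "0 \<le> L"
  defines "err \<equiv> 2 * L * card JJ * M\<^sup>2 / n"
  shows "\<exists>w. (\<forall>a b. a < b \<longrightarrow> b < n \<longrightarrow> w (a, b) = 0 \<or> w (a, b) = 1) \<and> (\<forall>e. 0 \<le> w e \<and> w e \<le> 1) \<and>
    edit_fun n g w \<le> edit_fun n g W + err \<and>
    (\<forall>mJ\<in>JJ. L * (copies n M mJ w - copies n M mJ W)\<^sup>2 \<le> 1 + err)"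
proof -
  let ?P = "PiE {..<M} (\<lambda>_. {..<n})"
  have P: "finite ?P" "?P \<noteq> {}" using n by (auto simp: PiE_eq_empty_iff intro!: finite_PiE)
  define c where "c mJ = copies n M mJ W" for mJ
  define X where "X mJ x w = copy_fun (fst mJ) (snd mJ) x w - c mJ" for mJ x w
  define dj where "dj m x y \<longleftrightarrow> x ` {..<m} \<inter> y ` {..<m} = {}" for m :: nat and x y :: "nat \<Rightarrow> nat"
  define Q where "Q mJ w = avg ?P (\<lambda>x. avg ?P (\<lambda>y. of_bool (dj (fst mJ) x y) * (X mJ x w * X mJ y w)))" for mJ w
  define F where "F w = edit_fun n g w + L * (\<Sum>mJ\<in>JJ. Q mJ w)" for w
  have c01: "0 \<le> c mJ" "c mJ \<le> 1" for mJ
    unfolding c_def copies_def using copy_fun_01[OF W] by (auto intro!: avg_nonneg avg_le_one)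
  have mean: "avg ?P (\<lambda>x. X mJ x w) = copies n M mJ w - c mJ" for mJ w
    unfolding X_def copies_def using P by (simp add: avg_diff avg_const)
  have Qerr: "\<bar>(copies n M mJ w - c mJ)\<^sup>2 - Q mJ w\<bar> \<le> M\<^sup>2 / n"
    if mJ: "mJ \<in> JJ" and w: "\<forall>e. 0 \<le> w e \<and> w e \<le> 1" for mJ w
  proof -
    have X1: "\<bar>X mJ x w\<bar> \<le> 1" for x
      using copy_fun_01[OF w, of "fst mJ" "snd mJ" x] c01[of mJ] by (auto simp: X_def)
    have "(copies n M mJ w - c mJ)\<^sup>2 = avg ?P (\<lambda>x. avg ?P (\<lambda>y. X mJ x w * X mJ y w))"
      unfolding mean[symmetric] power2_eq_square avg_mult ..
    then have "(copies n M mJ w - c mJ)\<^sup>2 - Q mJ w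
        = avg ?P (\<lambda>x. avg ?P (\<lambda>y. X mJ x w * X mJ y w - of_bool (dj (fst mJ) x y) * (X mJ x w * X mJ y w)))"
      by (simp only: Q_def avg_diff)
    also have "\<bar>\<dots>\<bar> \<le> avg ?P (\<lambda>x. avg ?P (\<lambda>y. \<bar>X mJ x w * X mJ y w - of_bool (dj (fst mJ) x y) * (X mJ x w * X mJ y w)\<bar>))"
      by (rule order_trans[OF avg_abs avg_mono[OF avg_abs]])
    also have "\<dots> \<le> avg ?P (\<lambda>x. avg ?P (\<lambda>y. of_bool (x ` {..<fst mJ} \<inter> y ` {..<fst mJ} \<noteq> {})))"
      using X1 by (intro avg_mono) (auto simp: dj_def abs_mult mult_le_one)
    also have "\<dots> \<le> avg ?P (\<lambda>x. M\<^sup>2 / n)"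
      using avg_hits_le[OF n JJ(2)[OF mJ]] by (intro avg_mono) auto
    also have "\<dots> = M\<^sup>2 / n" using P by (simp add: avg_const)
    finally show ?thesis .
  qed
  let ?E = "{(a, b). a < b \<and> b < n}"
  have "finite ?E" by (rule finite_subset[of _ "{..<n} \<times> {..<n}"]) auto
  moreover have "affine_at e F" if "e \<in> ?E" for e
  proof -
    obtain a b where ab: "e = (a, b)" "a < b" "b < n" using \<open>e \<in> ?E\<close> by auto
    have "affine_at e (\<lambda>w. of_bool (dj (fst mJ) x y) * (X mJ x w * X mJ y w))" for mJ x y
    proof (cases "dj (fst mJ) x y")
      case True
      \<comment> \<open>If one tuple contains both \<open>a\<close> and \<open>b\<close>, a disjoint
        one contains neither; so at most one factor depends on the weight of this pair.\<close>
      then have "(a \<notin> x ` {..<fst mJ} \<or> b \<notin> x ` {..<fst mJ}) \<or> (a \<notin> y ` {..<fst mJ} \<or> b \<notin> y ` {..<fst mJ})"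
        by (auto simp: dj_def disjoint_iff)
      then have "indep_at e (X mJ x) \<or> indep_at e (X mJ y)"
        using indep_at_copy_fun[of a x "fst mJ" b "snd mJ"] indep_at_copy_fun[of a y "fst mJ" b "snd mJ"]
        by (auto simp: ab X_def[abs_def] indep_at_def)
      moreover have "affine_at e (X mJ x)" "affine_at e (X mJ y)"
        unfolding X_def[abs_def] by (intro affine_at_diff_const affine_at_copy_fun)+
      ultimately have "affine_at e (\<lambda>w. X mJ x w * X mJ y w)"
        using affine_at_mult[of e "X mJ x" "X mJ y"] affine_at_mult[of e "X mJ y" "X mJ x"]
        by (auto simp: mult.commute)
      then show ?thesis by (intro affine_at_cmult)
    qed (simp add: affine_at_def)
    then have "affine_at e (Q mJ)" for mJ
      unfolding Q_def[abs_def] by (intro affine_at_avg)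
    then show ?thesis
      unfolding F_def[abs_def]
      by (intro affine_at_add affine_at_edit_fun affine_at_cmult affine_at_sum)
  qed
  ultimately obtain w where w: "\<forall>e\<in>?E. w e = 0 \<or> w e = 1" "\<forall>e. 0 \<le> w e \<and> w e \<le> 1" "F w \<le> F W"
    using multi_affine_rounding[of ?E F W] W by blast
  have edit01: "0 \<le> edit_fun n g u" "edit_fun n g u \<le> 1" if u: "\<forall>e. 0 \<le> u e \<and> u e \<le> 1" for u
  proof -
    have "0 \<le> u (ordered a b)" "u (ordered a b) \<le> 1" for a b using u by blast+
    then show "0 \<le> edit_fun n g u" "edit_fun n g u \<le> 1"
      unfolding edit_fun_def by (auto intro!: avg_nonneg avg_le_one)
  qed
  \<comment> \<open>At \<open>W\<close> the true deviations vanish, so each \<open>Q\<close> is at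
    most the error \<open>M\<^sup>2 / n\<close> of leaving out intersecting tuples. The same error
    at \<open>w\<close> is the other half of \<open>err\<close>.\<close>
  have "F W \<le> edit_fun n g W + L * (\<Sum>mJ\<in>JJ. M\<^sup>2 / n)"
    unfolding F_def using Qerr[OF _ W] L by (intro add_mono mult_left_mono sum_mono) (auto simp: c_def abs_le_iff)
  then have FW: "F W \<le> edit_fun n g W + err / 2" by (simp add: err_def mult_ac)
  have "edit_fun n g w + L * (\<Sum>mJ\<in>JJ. (copies n M mJ w - c mJ)\<^sup>2 - M\<^sup>2 / n) \<le> F w"
    unfolding F_def using Qerr[of _ w] w L
    by (intro add_mono mult_left_mono sum_mono) (force simp: abs_le_iff)+
  then have Fw: "edit_fun n g w + L * (\<Sum>mJ\<in>JJ. (copies n M mJ w - c mJ)\<^sup>2) - err / 2 \<le> F w"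
    by (simp add: sum_subtractf right_diff_distrib err_def mult_ac)
  have key: "edit_fun n g w + L * (\<Sum>mJ\<in>JJ. (copies n M mJ w - c mJ)\<^sup>2) \<le> edit_fun n g W + err"
    using FW Fw w(3) by linarith
  have nn: "0 \<le> L * (\<Sum>mJ\<in>JJ. (copies n M mJ w - c mJ)\<^sup>2)" using L by (simp add: sum_nonneg)
  \<comment> \<open>\<open>edit_fun\<close> lies in \<open>[0, 1]\<close>, so the penalty cannot
    exceed \<open>1 + err\<close>; a large \<open>L\<close> then makes every single deviation
    small.\<close>
  have "L * (copies n M mJ w - copies n M mJ W)\<^sup>2 \<le> 1 + err" if "mJ \<in> JJ" for mJ
  proof -
    have "(copies n M mJ w - c mJ)\<^sup>2 \<le> (\<Sum>mJ\<in>JJ. (copies n M mJ w - c mJ)\<^sup>2)"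
      using JJ that by (intro member_le_sum) auto
    then have "L * (copies n M mJ w - c mJ)\<^sup>2 \<le> L * (\<Sum>mJ\<in>JJ. (copies n M mJ w - c mJ)\<^sup>2)"
      using L by (rule mult_left_mono)
    then show ?thesis using key edit01(1)[of w] edit01(2)[of W] w(2) W by (simp add: c_def)
  qed
  then show ?thesis using key nn w by (intro exI[of _ w]) auto
qed

section \<open>From point sets to lists of points given by index functions\<close>

lemma avg_PiE_reindex:
  assumes f: "inj_on f A"
  shows "avg (PiE I (\<lambda>_. f ` A)) F = avg (PiE I (\<lambda>_. A)) (\<lambda>y. F (restrict (\<lambda>i. f (y i)) I))"
proof -
  have eq: "PiE I (\<lambda>_. f ` A) = (\<lambda>y. restrict (\<lambda>i. f (y i)) I) ` PiE I (\<lambda>_. A)"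
  proof (intro set_eqI iffI)
    fix y assume y: "y \<in> PiE I (\<lambda>_. f ` A)"
    have "y = restrict (\<lambda>i. f (restrict (\<lambda>i. inv_into A f (y i)) I i)) I"
      using y by (intro PiE_ext[OF y]) (auto simp: f_inv_into_f PiE_iff)
    moreover have "restrict (\<lambda>i. inv_into A f (y i)) I \<in> PiE I (\<lambda>_. A)"
      using y by (auto intro!: inv_into_into simp: PiE_iff)
    ultimately show "y \<in> (\<lambda>y. restrict (\<lambda>i. f (y i)) I) ` PiE I (\<lambda>_. A)" by blast
  qed auto
  have "inj_on (\<lambda>y. restrict (\<lambda>i. f (y i)) I) (PiE I (\<lambda>_. A))"
  proof (rule inj_onI)
    fix y y' assume yy: "y \<in> PiE I (\<lambda>_. A)" "y' \<in> PiE I (\<lambda>_. A)"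
      and e: "restrict (\<lambda>i. f (y i)) I = restrict (\<lambda>i. f (y' i)) I"
    show "y = y'"
    proof (rule PiE_ext[OF yy])
      fix i assume i: "i \<in> I"
      then have "f (y i) = f (y' i)" using fun_cong[OF e, of i] by simp
      then show "y i = y' i" using f yy i by (auto dest!: inj_onD simp: PiE_iff)
    qed
  qed
  then show ?thesis unfolding eq by (rule avg_reindex)
qed

lemma hom_reindex:
  assumes "inj_on f A"
  shows "hom M (\<lambda>_. f ` A) K = hom M (\<lambda>_. A) (\<lambda>p q x y. K p q (f x) (f y))"
proof -
  have "(\<Prod>e\<in>pairs M. K (fst e) (snd e) (restrict (\<lambda>i. f (y i)) {..<M} (fst e)) (restrict (\<lambda>i. f (y i)) {..<M} (snd e)))
      = (\<Prod>e\<in>pairs M. K (fst e) (snd e) (f (y (fst e))) (f (y (snd e))))" for y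
    by (rule prod.cong) (auto simp: pairs_def)
  then show ?thesis unfolding hom_def by (subst avg_PiE_reindex[OF assms]) simp
qed

definition sample_codeg :: "(nat \<Rightarrow> nat \<Rightarrow> bool) \<Rightarrow> nat \<Rightarrow> (nat \<Rightarrow> nat) \<Rightarrow> bool \<Rightarrow> nat \<Rightarrow> nat \<Rightarrow> real" where
  "sample_codeg g s u b v w = avg {..<s} (\<lambda>j. of_bool (g v (u j) = b) * of_bool (g w (u j) = b))"

text \<open>A length paired with an index function stands for a list of points with repetitions:
  \<open>(n, id)\<close> for all vertices, \<open>(s, u)\<close> for the sample,
  \<open>(r, \<rho>)\<close> for the reference sample.\<close>

definition codeg_error ::
  "(nat \<Rightarrow> nat \<Rightarrow> bool) \<Rightarrow> nat \<times> (nat \<Rightarrow> nat) \<Rightarrow> nat \<times> (nat \<Rightarrow> nat) \<Rightarrow> nat \<times> (nat \<Rightarrow> nat) \<Rightarrow> nat \<times> (nat \<Rightarrow> nat) \<Rightarrow> bool \<Rightarrow> real" where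
  "codeg_error g Q R B C b = avg {..<fst B} (\<lambda>v. avg {..<fst C} (\<lambda>w.
     \<bar>sample_codeg g (fst Q) (snd Q) b (snd B v) (snd C w) - sample_codeg g (fst R) (snd R) b (snd B v) (snd C w)\<bar>))"

definition tests :: "nat \<Rightarrow> nat \<Rightarrow> ((nat \<Rightarrow> nat) \<times> (nat \<Rightarrow> bool)) set" where
  "tests M r = PiE {..<M} (\<lambda>_. {..<r}) \<times> PiE {..<M} (\<lambda>_. UNIV)"

definition test_val :: "(nat \<Rightarrow> nat \<Rightarrow> bool) \<Rightarrow> nat \<Rightarrow> (nat \<Rightarrow> nat) \<Rightarrow> (nat \<Rightarrow> nat) \<times> (nat \<Rightarrow> bool) \<Rightarrow> nat \<Rightarrow> real" where
  "test_val g M \<rho> t v = (\<Prod>q<M. of_bool (g v (\<rho> (fst t q)) = snd t q))"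

text \<open>The cost of the cheapest label for \<open>v\<close> when label \<open>i\<close> pays
  \<open>\<mu> i t\<close> for every test \<open>t\<close> that \<open>v\<close> passes.\<close>

definition min_test :: "(nat \<Rightarrow> nat \<Rightarrow> bool) \<Rightarrow> nat \<Rightarrow> nat \<Rightarrow> nat \<Rightarrow> (nat \<Rightarrow> nat) \<Rightarrow>
    (nat \<Rightarrow> (nat \<Rightarrow> nat) \<times> (nat \<Rightarrow> bool) \<Rightarrow> real) \<Rightarrow> nat \<Rightarrow> real" where
  "min_test g M k r \<rho> \<mu> v = (MIN i\<in>{..<k}. \<Sum>t\<in>tests M r. \<mu> i t * test_val g M \<rho> t v)"

definition codeg_close :: "(nat \<Rightarrow> nat \<Rightarrow> bool) \<Rightarrow> nat \<Rightarrow> nat \<Rightarrow> (nat \<Rightarrow> nat) \<Rightarrow> nat \<Rightarrow> (nat \<Rightarrow> nat) \<Rightarrow> real \<Rightarrow> bool" where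
  "codeg_close g n s u r \<rho> \<theta> \<longleftrightarrow> (\<forall>Q\<in>{(n, id), (s, u)}. \<forall>B\<in>{(n, id), (s, u)}. \<forall>C\<in>{(n, id), (s, u)}.
     \<forall>b. codeg_error g Q (r, \<rho>) B C b \<le> \<theta>)"

text \<open>Uniform in \<open>\<mu>\<close>, because the vector to which it is applied consists of
  the residuals of the matched labelling and so depends on the sample.\<close>

definition tests_close :: "(nat \<Rightarrow> nat \<Rightarrow> bool) \<Rightarrow> nat \<Rightarrow> nat \<Rightarrow> (nat \<Rightarrow> nat) \<Rightarrow> nat \<Rightarrow> nat \<Rightarrow> nat \<Rightarrow> (nat \<Rightarrow> nat) \<Rightarrow> real \<Rightarrow> bool" where
  "tests_close g n s u M k r \<rho> \<omega> \<longleftrightarrow> (\<forall>\<mu>. (\<forall>i t. \<bar>\<mu> i t\<bar> \<le> 1) \<longrightarrow>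
     avg {..<n} (min_test g M k r \<rho> \<mu>) \<le> avg {..<s} (\<lambda>j. min_test g M k r \<rho> \<mu> (u j)) + \<omega>)"

lemma finite_tests [simp]: "finite (tests M r)"
  by (auto simp: tests_def intro!: finite_PiE)

lemma card_tests: "card (tests M r) = (2 * r) ^ M"
  by (simp add: tests_def card_cartesian_product card_PiE power_mult_distrib mult.commute)

lemma test_val_01: "0 \<le> test_val g M \<rho> t v" "test_val g M \<rho> t v \<le> 1"
  unfolding test_val_def by (auto intro!: prod_nonneg prod_le_1)

text \<open>Inside the proof the points are tagged pairs: \<open>(0, v)\<close> for vertices, \<open>(1, j)\<close> for sample indices,
  \<open>(2, j)\<close> for indices of the reference sample \<open>\<rho>\<close>; repeated sample vertices thus remain distinct points.\<close>

lemma sample_transfer: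
  fixes g :: "nat \<Rightarrow> nat \<Rightarrow> bool"
  assumes pos: "0 < n" "0 < s" "0 < r" "0 < k"
    and g: "\<And>x y. g x y = g y x"
    and lab: "\<And>j. j < s \<Longrightarrow> lab j < k"
    and codeg: "codeg_close g n s u r \<rho> \<theta>"
    and lln: "tests_close g n s u M k r \<rho> \<omega>"
  shows "\<exists>\<pi>. (\<forall>v<n. \<pi> v < k) \<and> (\<forall>c. (\<forall>p q b i j. 0 \<le> c p q b i j \<and> c p q b i j \<le> (1::real)) \<longrightarrow>
    \<bar>hom M (\<lambda>_. {..<n}) (\<lambda>p q a b. c p q (g a b) (\<pi> a) (\<pi> b))
     - hom M (\<lambda>_. {..<s}) (\<lambda>p q i j. c p q (g (u i) (u j)) (lab i) (lab j))\<bar>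
    \<le> real M * (real k * 2 ^ M * sqrt (2 ^ M / real n + \<omega> / real r ^ M + 4 * real M * \<theta>)))"
proof -
  let ?\<tau> = "test_val g M \<rho>"
  define z where "z i t = avg {..<s} (\<lambda>j. of_bool (lab j = i) * ?\<tau> t (u j))" for i t
  have "\<exists>\<pi>. (\<forall>v\<in>{..<n}. \<pi> v < k) \<and>
    (\<Sum>i<k. \<Sum>t\<in>tests M r. (avg {..<n} (\<lambda>v. of_bool (\<pi> v = i) * ?\<tau> t v) - z i t)\<^sup>2)
      \<le> card (tests M r) / card {..<n} + \<omega>"
  proof (rule matching[OF _ _ pos(4) finite_tests test_val_01])
    show "0 \<le> z i t" "z i t \<le> 1" for i t
      unfolding z_def by (auto intro!: avg_nonneg avg_le_one simp: test_val_01)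
    fix \<mu> :: "nat \<Rightarrow> (nat \<Rightarrow> nat) \<times> (nat \<Rightarrow> bool) \<Rightarrow> real"
    assume \<mu>: "\<And>i t. \<bar>\<mu> i t\<bar> \<le> 1"
    have "avg {..<s} (\<lambda>j. min_test g M k r \<rho> \<mu> (u j))
        \<le> avg {..<s} (\<lambda>j. \<Sum>i<k. \<Sum>t\<in>tests M r. \<mu> i t * (of_bool (lab j = i) * ?\<tau> t (u j)))"
    proof (intro avg_mono)
      fix j assume j: "j \<in> {..<s}"
      have "(\<Sum>i<k. \<Sum>t\<in>tests M r. \<mu> i t * (of_bool (lab j = i) * ?\<tau> t (u j)))
          = (\<Sum>i<k. if i = lab j then \<Sum>t\<in>tests M r. \<mu> i t * ?\<tau> t (u j) else 0)"
        by (intro sum.cong) auto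
      also have "\<dots> = (\<Sum>t\<in>tests M r. \<mu> (lab j) t * ?\<tau> t (u j))"
        using lab j by (simp add: sum.delta)
      \<comment> \<open>The given label of a sample point is one of the competitors in the
        minimum.\<close>
      also have "min_test g M k r \<rho> \<mu> (u j) \<le> \<dots>"
        unfolding min_test_def using lab j by (intro Min_le) auto
      finally show "min_test g M k r \<rho> \<mu> (u j)
          \<le> (\<Sum>i<k. \<Sum>t\<in>tests M r. \<mu> i t * (of_bool (lab j = i) * ?\<tau> t (u j)))" .
    qed
    also have "\<dots> = (\<Sum>i<k. \<Sum>t\<in>tests M r. \<mu> i t * z i t)"
      unfolding z_def by (simp only: avg_sum avg_cmult)
    finally show "avg {..<n} (\<lambda>v. MIN i\<in>{..<k}. \<Sum>t\<in>tests M r. \<mu> i t * ?\<tau> t v)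
        \<le> (\<Sum>i<k. \<Sum>t\<in>tests M r. \<mu> i t * z i t) + \<omega>"
      using mp[OF spec[OF lln[unfolded tests_close_def], of \<mu>]] \<mu> unfolding min_test_def by fastforce
  qed (use pos in \<open>simp_all add: lessThan_empty_iff\<close>)
  then obtain \<pi> where \<pi>: "\<forall>v\<in>{..<n}. \<pi> v < k"
    "(\<Sum>i<k. \<Sum>t\<in>tests M r. (avg {..<n} (\<lambda>v. of_bool (\<pi> v = i) * ?\<tau> t v) - z i t)\<^sup>2)
      \<le> real ((2 * r) ^ M) / n + \<omega>"
    unfolding card_tests card_lessThan by (elim exE conjE)
  define pt :: "nat \<times> nat \<Rightarrow> nat"
    where "pt = (\<lambda>(a, i). if a = 0 then i else if a = 1 then u i else \<rho> i)"
  define lb :: "nat \<times> nat \<Rightarrow> nat" where "lb = (\<lambda>(a, i). if a = 0 then \<pi> i else lab i)"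
  define V where "V = Pair (0::nat) ` {..<n}"
  define S where "S = Pair (1::nat) ` {..<s}"
  define R where "R = Pair (2::nat) ` {..<r}"
  define G where "G x y = g (pt x) (pt y)" for x y
  have inj: "inj_on (Pair a) X" for a :: nat and X :: "nat set" by (simp add: inj_on_def)
  have gap_eq: "gap V S lb i (profile_test G M (restrict (\<lambda>q. (2, y q)) {..<M}) \<sigma>)
      = avg {..<n} (\<lambda>v. of_bool (\<pi> v = i) * ?\<tau> (y, \<sigma>) v) - z i (y, \<sigma>)" for i y \<sigma>
    unfolding gap_def V_def S_def avg_reindex[OF inj] z_def test_val_def profile_test_def
    by (simp add: lb_def G_def pt_def)
  have \<theta>a: "avg (PiE {..<M} (\<lambda>_. R)) (\<lambda>X. (gap V S lb i (profile_test G M X \<sigma>))\<^sup>2) \<le> 2 ^ M / real n + \<omega> / real r ^ M"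
    if i: "i < k" and \<sigma>: "\<sigma> \<in> PiE {..<M} (\<lambda>_. UNIV)" for i \<sigma>
  proof -
    let ?f = "\<lambda>i t. (avg {..<n} (\<lambda>v. of_bool (\<pi> v = i) * ?\<tau> t v) - z i t)\<^sup>2"
    have "(\<Sum>y\<in>PiE {..<M} (\<lambda>_. {..<r}). ?f i (y, \<sigma>)) = sum (?f i) ((\<lambda>y. (y, \<sigma>)) ` PiE {..<M} (\<lambda>_. {..<r}))"
      by (subst sum.reindex) (simp_all add: inj_on_def)
    also have "\<dots> \<le> sum (?f i) (tests M r)"
    proof (rule sum_mono2[OF finite_tests])
      show "(\<lambda>y. (y, \<sigma>)) ` PiE {..<M} (\<lambda>_. {..<r}) \<subseteq> tests M r"
        using \<sigma> by (intro image_subsetI) (simp add: tests_def)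
    qed simp
    also have "\<dots> \<le> (\<Sum>i<k. sum (?f i) (tests M r))"
      using i by (intro member_le_sum[of i "{..<k}" "\<lambda>i. sum (?f i) (tests M r)"]) (simp_all add: sum_nonneg)
    also note \<pi>(2)
    finally have le: "(\<Sum>y\<in>PiE {..<M} (\<lambda>_. {..<r}). ?f i (y, \<sigma>)) \<le> real ((2 * r) ^ M) / n + \<omega>" .
    have "avg (PiE {..<M} (\<lambda>_. R)) (\<lambda>X. (gap V S lb i (profile_test G M X \<sigma>))\<^sup>2)
        = avg (PiE {..<M} (\<lambda>_. {..<r})) (\<lambda>y. ?f i (y, \<sigma>))"
      unfolding R_def avg_PiE_reindex[OF inj] gap_eq ..
    also have "\<dots> = (\<Sum>y\<in>PiE {..<M} (\<lambda>_. {..<r}). ?f i (y, \<sigma>)) / real r ^ M"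
      by (simp add: avg_def card_PiE)
    \<comment> \<open>The mean over tuples divides the total by \<open>r ^ M\<close>, so an error
      \<open>\<omega>\<close> proportional to the number of tests is affordable.\<close>
    also have "\<dots> \<le> (real ((2 * r) ^ M) / n + \<omega>) / real r ^ M"
      using le by (intro divide_right_mono) auto
    also have "\<dots> = 2 ^ M / real n + \<omega> / real r ^ M"
      using pos by (simp add: power_mult_distrib add_divide_distrib)
    finally show ?thesis .
  qed
  have cd: "codeg G (Pair a ` {..<m}) b v w = sample_codeg g m (\<lambda>i. pt (a, i)) b (pt v) (pt w)" for a m b v w
    unfolding codeg_def sample_codeg_def avg_reindex[OF inj] G_def ..
  have pts: "(\<lambda>i. pt (0, i)) = id" "(\<lambda>i. pt (1, i)) = u" "(\<lambda>i. pt (2, i)) = \<rho>"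
    by (auto simp: pt_def)
  have pts': "pt (0, i) = i" "pt (Suc 0, i) = u i" for i by (auto simp: pt_def)
  have \<theta>b: "avg B (\<lambda>v. avg C (\<lambda>w. \<bar>codeg G Q b v w - codeg G R b v w\<bar>)) \<le> \<theta>"
    if QBC: "Q \<in> {V, S}" "B \<in> {V, S}" "C \<in> {V, S}" for Q B C b
  proof -
    have Q: "\<exists>Q'\<in>{(n, id), (s, u)}. \<forall>v w. codeg G Q b v w = sample_codeg g (fst Q') (snd Q') b (pt v) (pt w)"
    proof (cases "Q = V")
      case True
      have "codeg G Q b v w = sample_codeg g n id b (pt v) (pt w)" for v w
        unfolding True V_def cd pts ..
      then show ?thesis by (intro bexI[of _ "(n, id)"]) simp_all
    next
      case False
      then have "Q = S" using QBC(1) by blast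
      then have "codeg G Q b v w = sample_codeg g s u b (pt v) (pt w)" for v w
        by (simp only: S_def cd pts)
      then show ?thesis by (intro bexI[of _ "(s, u)"]) simp_all
    qed
    have av: "\<exists>B'\<in>{(n, id), (s, u)}. \<forall>f. avg B (\<lambda>v. f (pt v)) = avg {..<fst B'} (\<lambda>v. f (snd B' v))"
      if "B \<in> {V, S}" for B
    proof (cases "B = V")
      case True
      then have "avg B (\<lambda>v. f (pt v)) = avg {..<n} f" for f
        by (simp only: V_def avg_reindex[OF inj] pts')
      then show ?thesis by (intro bexI[of _ "(n, id)"]) simp_all
    next
      case False
      then have "B = S" using that by blast
      then have "avg B (\<lambda>v. f (pt v)) = avg {..<s} (\<lambda>j. f (u j))" for f
        by (simp only: S_def avg_reindex[OF inj] pts' One_nat_def)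
      then show ?thesis by (intro bexI[of _ "(s, u)"]) simp_all
    qed
    obtain Q' where Q': "Q' \<in> {(n, id), (s, u)}"
      "\<And>v w. codeg G Q b v w = sample_codeg g (fst Q') (snd Q') b (pt v) (pt w)" using Q by blast
    obtain B' where B': "B' \<in> {(n, id), (s, u)}" "\<And>f. avg B (\<lambda>v. f (pt v)) = avg {..<fst B'} (\<lambda>v. f (snd B' v))"
      using av[OF QBC(2)] by blast
    obtain C' where C': "C' \<in> {(n, id), (s, u)}" "\<And>f. avg C (\<lambda>v. f (pt v)) = avg {..<fst C'} (\<lambda>v. f (snd C' v))"
      using av[OF QBC(3)] by blast
    have R: "codeg G R b v w = sample_codeg g r \<rho> b (pt v) (pt w)" for v w
      unfolding R_def cd pts ..
    define h where "h x y = \<bar>sample_codeg g (fst Q') (snd Q') b x y - sample_codeg g r \<rho> b x y\<bar>" for x y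
    have "avg B (\<lambda>v. avg C (\<lambda>w. \<bar>codeg G Q b v w - codeg G R b v w\<bar>)) = avg B (\<lambda>v. avg C (\<lambda>w. h (pt v) (pt w)))"
      by (simp add: Q'(2) R h_def)
    also have "\<dots> = avg {..<fst B'} (\<lambda>v. avg {..<fst C'} (\<lambda>w. h (snd B' v) (snd C' w)))"
      unfolding C'(2) by (rule B'(2))
    also have "\<dots> = codeg_error g Q' (r, \<rho>) B' C' b" by (simp add: codeg_error_def h_def)
    also have "\<dots> \<le> \<theta>" using codeg Q'(1) B'(1) C'(1) unfolding codeg_close_def by blast
    finally show ?thesis .
  qed
  have "\<bar>hom M (\<lambda>_. {..<n}) (\<lambda>p q a b. c p q (g a b) (\<pi> a) (\<pi> b))
     - hom M (\<lambda>_. {..<s}) (\<lambda>p q i j. c p q (g (u i) (u j)) (lab i) (lab j))\<bar>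
    \<le> real M * (real k * 2 ^ M * sqrt (2 ^ M / real n + \<omega> / real r ^ M + 4 * real M * \<theta>))"
    if c: "\<forall>p q b i j. 0 \<le> c p q b i j \<and> c p q b i j \<le> (1::real)" for c
  proof -
    have "\<bar>hom M (\<lambda>_. V) (\<lambda>p q x y. c p q (G x y) (lb x) (lb y))
       - hom M (\<lambda>_. S) (\<lambda>p q x y. c p q (G x y) (lb x) (lb y))\<bar>
      \<le> real M * (real k * 2 ^ M * sqrt (2 ^ M / real n + \<omega> / real r ^ M + 4 * real M * \<theta>))"
    proof (rule hom_transfer[where g = G and lab = lb and c = c and k = k and R = R, OF _ _ _ _ _ _ _ _ _ \<theta>a \<theta>b])
      show "lb z < k" if z: "z \<in> V \<union> S" for z
      proof -
        consider v where "z = (0, v)" "v < n" | j where "z = (1, j)" "j < s"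
          using z by (auto simp: V_def S_def)
        then show ?thesis by cases (use \<pi>(1) lab in \<open>simp_all add: lb_def\<close>)
      qed
      show "finite V" "finite S" "finite R" "V \<noteq> {}" "S \<noteq> {}"
        unfolding V_def S_def R_def using pos by (simp_all add: lessThan_empty_iff)
      show "G x y = G y x" for x y unfolding G_def by (rule g)
      show "0 \<le> c p q b i j" "c p q b i j \<le> 1" for p q b i j using c by simp_all
    qed
    then show ?thesis
      unfolding V_def S_def hom_reindex[OF inj] by (simp add: G_def lb_def pts')
  qed
  then show ?thesis using \<pi>(1) by (intro exI[of _ \<pi>] conjI allI impI) simp_all
qed

section \<open>Lifting a modification of the sample\<close>

lemma avg_not_inj_le:
  fixes n m M :: nat
  assumes n: "0 < n" and m: "m \<le> M"
  shows "avg (PiE {..<M} (\<lambda>_. {..<n})) (\<lambda>y. of_bool (\<not> inj_on y {..<m})) \<le> M\<^sup>2 / n"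
proof -
  let ?P = "PiE {..<M} (\<lambda>_. {..<n})"
  have P: "finite ?P" "?P \<noteq> {}" using n by (auto simp: PiE_eq_empty_iff intro!: finite_PiE)
  have one: "avg ?P (\<lambda>y. of_bool (y (fst e) = y (snd e))) \<le> 1 / n" if e_in: "e \<in> pairs m" for e
  proof -
    obtain p q where e: "e = (p, q)" "p < q" "q < m" using e_in by (cases e) (auto simp: pairs_def)
    have "avg ?P (\<lambda>y. of_bool (y p = y q)) = avg ?P (\<lambda>y. avg {..<n} (\<lambda>x. of_bool (x = y q)))"
      by (subst avg_PiE_resample_same[where p = p]) (use e m n in auto)
    also have "\<dots> \<le> 1 / n"
      by (rule avg_le[OF P]) (auto simp: avg_def of_bool_def sum.delta intro!: divide_right_mono)
    finally show ?thesis by (simp add: e)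
  qed
  have "avg ?P (\<lambda>y. of_bool (\<not> inj_on y {..<m})) \<le> avg ?P (\<lambda>y. \<Sum>e\<in>pairs m. of_bool (y (fst e) = y (snd e)))"
  proof (intro avg_mono)
    fix y :: "nat \<Rightarrow> nat"
    show "of_bool (\<not> inj_on y {..<m}) \<le> (\<Sum>e\<in>pairs m. of_bool (y (fst e) = y (snd e)) :: real)"
    proof (rule of_bool_le_sum)
      assume "\<not> inj_on y {..<m}"
      then obtain p q where pq: "p < m" "q < m" "p \<noteq> q" "y p = y q" by (auto simp: inj_on_def)
      then show "\<exists>e\<in>pairs m. y (fst e) = y (snd e)"
        by (intro bexI[of _ "(min p q, max p q)"]) (auto simp: pairs_def min_def max_def)
    qed simp
  qed
  also have "\<dots> = (\<Sum>e\<in>pairs m. avg ?P (\<lambda>y. of_bool (y (fst e) = y (snd e))))" by (simp only: avg_sum)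
  also have "\<dots> \<le> (\<Sum>e\<in>pairs m. 1 / n)" by (intro sum_mono one)
  also have "\<dots> = card (pairs m) / n" by simp
  also have "\<dots> \<le> M\<^sup>2 / n"
    using card_pairs_le[of m] m
    by (intro divide_right_mono) (auto simp flip: of_nat_power intro: order_trans power_mono)
  finally show ?thesis .
qed

text \<open>Presents an average over pairs as a density of the same kind as copy counts, so that one
  transfer result covers the edit distance too.\<close>

lemma hom_single_pair:
  assumes M: "2 \<le> M" and A: "finite A" "A \<noteq> {}"
  shows "hom M (\<lambda>_. A) (\<lambda>p q x y. if p = 0 \<and> q = 1 then f x y else 1) = avg A (\<lambda>x. avg A (f x))"
proof -
  have e: "(0, 1) \<in> pairs M" using M by (simp add: pairs_def)
  have "(\<Prod>e\<in>pairs M. if fst e = 0 \<and> snd e = 1 then f (y (fst e)) (y (snd e)) else 1) = f (y 0) (y 1)" for y :: "nat \<Rightarrow> 'a"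
  proof -
    have "(\<Prod>e\<in>pairs M - {(0, 1)}. if fst e = 0 \<and> snd e = 1 then f (y (fst e)) (y (snd e)) else 1) = 1"
      by (rule prod.neutral) (auto simp: prod_eq_iff)
    then show ?thesis by (subst prod.remove[OF finite_pairs e]) simp
  qed
  then have "hom M (\<lambda>_. A) (\<lambda>p q x y. if p = 0 \<and> q = 1 then f x y else 1)
      = avg (PiE {..<M} (\<lambda>_. A)) (\<lambda>y. f (y 0) (y 1))"
    unfolding hom_def by simp
  also have "\<dots> = avg A (\<lambda>x. avg A (f x))" using M A by (intro avg_PiE_two) auto
  finally show ?thesis .
qed

definition edit :: "nat \<Rightarrow> (nat \<Rightarrow> nat \<Rightarrow> bool) \<Rightarrow> (nat \<Rightarrow> nat \<Rightarrow> bool) \<Rightarrow> real" where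
  "edit n g h = avg {..<n} (\<lambda>a. avg {..<n} (\<lambda>b. of_bool (g a b \<noteq> h a b)))"

definition copy_density :: "nat \<Rightarrow> nat \<Rightarrow> nat \<times> (nat \<Rightarrow> nat \<Rightarrow> bool) \<Rightarrow> (nat \<Rightarrow> nat \<Rightarrow> bool) \<Rightarrow> real" where
  "copy_density n M mJ h = avg (PiE {..<M} (\<lambda>_. {..<n})) (\<lambda>x. of_bool (inj_on x {..<fst mJ} \<and>
     (\<forall>e\<in>pairs (fst mJ). snd mJ (fst e) (snd e) = h (x (fst e)) (x (snd e)))))"

lemma prod_of_bool: "finite I \<Longrightarrow> (\<Prod>i\<in>I. of_bool (P i)) = (of_bool (\<forall>i\<in>I. P i) :: real)"
  by (induction I rule: finite_induct) auto

lemma rounding_graph: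
  fixes n M :: nat and L :: real and g :: "nat \<Rightarrow> nat \<Rightarrow> bool"
  assumes n: "0 < n" and JJ: "finite JJ" "\<And>mJ. mJ \<in> JJ \<Longrightarrow> fst mJ \<le> M"
    and W: "\<forall>e. 0 \<le> W e \<and> W e \<le> 1" and L: "0 < L" and irr: "\<And>a. \<not> g a a"
  defines "err \<equiv> 2 * L * card JJ * M\<^sup>2 / n"
  shows "\<exists>h. (\<forall>a. \<not> h a a) \<and> (\<forall>a b. h a b = h b a) \<and>
    edit n g h \<le> edit_fun n g W + err \<and>
    (\<forall>mJ\<in>JJ. copy_density n M mJ h \<le> copies n M mJ W + sqrt ((1 + err) / L))"
proof -
  obtain w where w: "\<And>a b. a < b \<Longrightarrow> b < n \<Longrightarrow> w (a, b) = 0 \<or> w (a, b) = 1" "\<forall>e. 0 \<le> w e \<and> w e \<le> 1"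
    "edit_fun n g w \<le> edit_fun n g W + err"
    "\<And>mJ. mJ \<in> JJ \<Longrightarrow> L * (copies n M mJ w - copies n M mJ W)\<^sup>2 \<le> 1 + err"
    using rounding[OF n JJ W less_imp_le[OF L], of g] unfolding err_def by blast
  define h where "h a b \<longleftrightarrow> a \<noteq> b \<and> w (ordered a b) = 1" for a b
  have w_h: "w (ordered a b) = of_bool (h a b)" if "a < n" "b < n" "a \<noteq> b" for a b
    using that w(1)[of "min a b" "max a b"] by (auto simp: h_def ordered_def min_def max_def)
  \<comment> \<open>Only an inequality: the diagonal weights are not rounded, while neither
    \<open>g\<close> nor \<open>h\<close> has loops.\<close>
  have "edit n g h \<le> edit_fun n g w"
    unfolding edit_def edit_fun_def
  proof (intro avg_mono)
    fix a b assume "a \<in> {..<n}" "b \<in> {..<n}"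
    then show "of_bool (g a b \<noteq> h a b) \<le> (if g a b then 1 - w (ordered a b) else w (ordered a b))"
      using w_h[of a b] irr[of a] spec[OF w(2), of "ordered a b"] by (cases "a = b") (auto simp: h_def)
  qed
  moreover have "copy_density n M mJ h = copies n M mJ w" if mJ: "mJ \<in> JJ" for mJ
    unfolding copy_density_def copies_def
  proof (rule avg_cong[OF refl])
    fix x assume x: "x \<in> PiE {..<M} (\<lambda>_. {..<n})"
    let ?m = "fst mJ"
    have "(\<Prod>e\<in>pairs ?m. if snd mJ (fst e) (snd e) then w (ordered (x (fst e)) (x (snd e)))
        else 1 - w (ordered (x (fst e)) (x (snd e))))
      = (\<Prod>e\<in>pairs ?m. of_bool (snd mJ (fst e) (snd e) = h (x (fst e)) (x (snd e))))"
      if inj: "inj_on x {..<?m}"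
    proof (rule prod.cong[OF refl])
      fix e assume e: "e \<in> pairs ?m"
      then have "x (fst e) < n" "x (snd e) < n" "x (fst e) \<noteq> x (snd e)"
        using x JJ(2)[OF mJ] inj_onD[OF inj, of "fst e" "snd e"] by (auto simp: pairs_def PiE_iff)
      then show "(if snd mJ (fst e) (snd e) then w (ordered (x (fst e)) (x (snd e)))
        else 1 - w (ordered (x (fst e)) (x (snd e)))) = of_bool (snd mJ (fst e) (snd e) = h (x (fst e)) (x (snd e)))"
        by (simp add: w_h)
    qed
    then show "of_bool (inj_on x {..<?m} \<and> (\<forall>e\<in>pairs ?m. snd mJ (fst e) (snd e) = h (x (fst e)) (x (snd e))))
        = copy_fun ?m (snd mJ) x w"
      by (cases "inj_on x {..<?m}") (simp_all add: copy_fun_def prod_of_bool)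
  qed
  moreover have "copies n M mJ w \<le> copies n M mJ W + sqrt ((1 + err) / L)" if "mJ \<in> JJ" for mJ
  proof -
    have "(copies n M mJ w - copies n M mJ W)\<^sup>2 \<le> (1 + err) / L"
      using w(4)[OF that] L by (simp add: field_simps)
    then have "copies n M mJ w - copies n M mJ W \<le> sqrt ((1 + err) / L)"
      by (rule real_le_rsqrt)
    then show ?thesis by simp
  qed
  moreover have "h a b = h b a" "\<not> h a a" for a b by (auto simp: h_def ordered_def min.commute max.commute)
  ultimately show ?thesis using w(3) by (intro exI[of _ h] conjI allI ballI) auto
qed

text \<open>The four errors in the density are due to repeated sample points, to regularising
  \<open>h\<close>, to the transfer from sample to graph, and to rounding. The edit distance pays
  for the last two only, because cell averages preserve it.\<close>

lemma sample_lift: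
  fixes g h :: "nat \<Rightarrow> nat \<Rightarrow> bool" and L \<gamma> \<theta> \<omega> :: real and T M n s r :: nat
  assumes pos: "0 < n" "0 < s" "0 < r" "2 \<le> M" "0 < L" "0 < \<gamma>" "1 < real T * \<gamma>\<^sup>2"
    and g: "\<And>x y. g x y = g y x" "\<And>x. \<not> g x x"
    and h: "\<And>x y. h x y = h y x"
    and codeg: "codeg_close g n s u r \<rho> \<theta>"
    and lln: "tests_close g n s u M (4 ^ T) r \<rho> \<omega>"
    and JJ: "finite JJ" "\<And>mJ. mJ \<in> JJ \<Longrightarrow> fst mJ \<le> M"
    and free: "\<And>mJ. mJ \<in> JJ \<Longrightarrow> copy_density s M mJ h = 0"
  defines "err \<equiv> 2 * L * card JJ * M\<^sup>2 / n"
    and "\<zeta> \<equiv> real M * (real (4 ^ T) * 2 ^ M * sqrt (2 ^ M / real n + \<omega> / real r ^ M + 4 * real M * \<theta>))"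
  shows "\<exists>h'. (\<forall>a. \<not> h' a a) \<and> (\<forall>a b. h' a b = h' b a) \<and>
    edit n g h' \<le> edit s (\<lambda>i j. g (u i) (u j)) h + \<zeta> + err \<and>
    (\<forall>mJ\<in>JJ. copy_density n M mJ h' \<le> M\<^sup>2 / s + M\<^sup>2 * \<gamma> + \<zeta> + sqrt ((1 + err) / L))"
proof -
  let ?S = "{..<s}" and ?V = "{..<n}"
  have S: "finite ?S" "?S \<noteq> {}" and V: "finite ?V" "?V \<noteq> {}" using pos by auto
  define gs where "gs i j = g (u i) (u j)" for i j
  define hf :: "nat \<times> nat \<Rightarrow> real" where "hf e = of_bool (h (fst e) (snd e))" for e
  obtain lab where lab: "\<forall>x. lab x < 4 ^ T"
    and reg: "\<forall>X Y. X \<subseteq> ?S \<longrightarrow> Y \<subseteq> ?S \<longrightarrow>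
      \<bar>\<Sum>e\<in>X \<times> Y. hf e - cell_avg (?S \<times> ?S) (cell_of gs lab) hf (cell_of gs lab e)\<bar> \<le> \<gamma> * (card ?S)\<^sup>2"
    using weak_regularity[of ?S hf \<gamma> T gs] pos by (auto simp: hf_def)
  define c0 where "c0 b i j = cell_avg (?S \<times> ?S) (cell_of gs lab) hf (b, i, j)" for b i j
  have c01: "0 \<le> c0 b i j" "c0 b i j \<le> 1" for b i j
    unfolding c0_def cell_avg_def hf_def by (auto intro!: avg_nonneg avg_le_one)
  \<comment> \<open>Symmetry makes \<open>c0\<close> a weight on unordered pairs.\<close>
  have c0_sym: "c0 b i j = c0 b j i" for b i j
  proof -
    let ?F = "\<lambda>i j. {e \<in> ?S \<times> ?S. cell_of gs lab e = (b, i, j)}"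
    have "?F j i = prod.swap ` ?F i j"
      by (auto simp: cell_of_def gs_def g(1) image_iff intro!: exI)
    then have "avg (?F j i) hf = avg (?F i j) (\<lambda>e. hf (prod.swap e))"
      by (simp add: avg_reindex[of prod.swap] inj_on_def)
    also have "(\<lambda>e. hf (prod.swap e)) = hf" by (auto simp: hf_def fun_eq_iff h)
    finally show ?thesis by (simp add: c0_def cell_avg_def)
  qed
  define hc where "hc i j = c0 (gs i j) (lab i) (lab j)" for i j
  have hc: "cell_avg (?S \<times> ?S) (cell_of gs lab) hf (cell_of gs lab (i, j)) = hc i j" for i j
    by (simp add: hc_def c0_def cell_of_def)
  obtain \<pi> where \<pi>: "\<And>c. (\<forall>p q b i j. 0 \<le> c p q b i j \<and> c p q b i j \<le> (1::real)) \<Longrightarrow>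
    \<bar>hom M (\<lambda>_. ?V) (\<lambda>p q a b. c p q (g a b) (\<pi> a) (\<pi> b))
     - hom M (\<lambda>_. ?S) (\<lambda>p q i j. c p q (g (u i) (u j)) (lab i) (lab j))\<bar> \<le> \<zeta>"
    using sample_transfer[where k = "4 ^ T" and lab = lab, OF _ _ _ _ g(1) _ codeg lln] pos lab
    unfolding \<zeta>_def by auto
  \<comment> \<open>The regularised \<open>h\<close>, carried to all vertices: it needs only
    adjacency in \<open>g\<close> and two labels.\<close>
  define W where "W e = c0 (g (fst e) (snd e)) (\<pi> (fst e)) (\<pi> (snd e))" for e
  have W01: "\<forall>e. 0 \<le> W e \<and> W e \<le> 1" using c01 by (simp add: W_def)
  have W_ord: "W (ordered a b) = c0 (g a b) (\<pi> a) (\<pi> b)" for a b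
    by (auto simp: W_def ordered_def min_def max_def g(1)[of b a] c0_sym[of _ "\<pi> b"])
  have edit_W: "edit_fun n g W \<le> edit s gs h + \<zeta>"
  proof -
    define c where "c p q b i j = (if p = 0 \<and> q = 1 then (if b then 1 - c0 b i j else c0 b i j) else 1)"
      for p q :: nat and b i j
    have "\<forall>p q b i j. 0 \<le> c p q b i j \<and> c p q b i j \<le> 1" using c01 by (simp add: c_def)
    from \<pi>[OF this] have "hom M (\<lambda>_. ?V) (\<lambda>p q a b. c p q (g a b) (\<pi> a) (\<pi> b))
        \<le> hom M (\<lambda>_. ?S) (\<lambda>p q i j. c p q (gs i j) (lab i) (lab j)) + \<zeta>"
      by (simp add: gs_def)
    also have "hom M (\<lambda>_. ?V) (\<lambda>p q a b. c p q (g a b) (\<pi> a) (\<pi> b)) = edit_fun n g W"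
      unfolding c_def hom_single_pair[OF pos(4) V] edit_fun_def W_ord
      by (intro avg_cong refl)
    also have "hom M (\<lambda>_. ?S) (\<lambda>p q i j. c p q (gs i j) (lab i) (lab j))
        = avg ?S (\<lambda>i. avg ?S (\<lambda>j. if gs i j then 1 - hc i j else hc i j))"
      unfolding c_def hom_single_pair[OF pos(4) S] hc_def by (intro avg_cong refl)
    also have "\<dots> = edit s gs h"
    proof -
      \<comment> \<open>The cost \<open>if b then 1 - x else x\<close> is affine in \<open>x\<close>
        with slope \<open>\<phi>\<close>, and slope and constant term are functions of the cell; so
        cell averages have the same total cost as \<open>h\<close>.\<close>
      define \<phi> :: "bool \<times> nat \<times> nat \<Rightarrow> real" where "\<phi> z = (if fst z then - 1 else 1)" for z
      have "(\<Sum>e\<in>?S \<times> ?S. hc (fst e) (snd e) * \<phi> (cell_of gs lab e)) = (\<Sum>e\<in>?S \<times> ?S. hf e * \<phi> (cell_of gs lab e))"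
        using sum_cell_avg[of "?S \<times> ?S" "cell_of gs lab" hf \<phi>] by (simp add: hc[symmetric])
      then have "(\<Sum>i\<in>?S. \<Sum>j\<in>?S. hc i j * \<phi> (gs i j, lab i, lab j)) = (\<Sum>i\<in>?S. \<Sum>j\<in>?S. hf (i, j) * \<phi> (gs i j, lab i, lab j))"
        by (simp add: sum.cartesian_product case_prod_beta cell_of_def)
      moreover have "(if gs i j then 1 - x else x) = of_bool (gs i j) + x * \<phi> (gs i j, lab i, lab j)" for i j and x :: real
        by (simp add: \<phi>_def)
      moreover have "of_bool (gs i j \<noteq> h i j) = of_bool (gs i j) + hf (i, j) * \<phi> (gs i j, lab i, lab j)" for i j
        by (simp add: \<phi>_def hf_def)
      ultimately show ?thesis
        unfolding edit_def avg_def by (simp add: sum.distrib add_divide_distrib sum_divide_distrib[symmetric])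
    qed
    finally show ?thesis .
  qed
  have cut: "\<bar>avg ?S (\<lambda>x. avg ?S (\<lambda>y. (hf (x, y) - hc x y) * f x * f' y))\<bar> \<le> \<gamma>"
    if f: "\<And>x. 0 \<le> f x \<and> f x \<le> (1::real)" and f': "\<And>x. 0 \<le> f' x \<and> f' x \<le> (1::real)" for f f'
  proof -
    have reg': "\<bar>\<Sum>x\<in>X. \<Sum>y\<in>Y. hf (x, y) - hc x y\<bar> \<le> \<gamma> * s\<^sup>2" if "X \<subseteq> ?S" "Y \<subseteq> ?S" for X Y
      using reg that by (auto simp: sum.cartesian_product hc[symmetric] case_prod_beta)
    have "(\<Sum>x\<in>?S. \<Sum>y\<in>?S. (hf (x, y) - hc x y) * f x * f' y) \<le> \<gamma> * s\<^sup>2"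
      by (rule bilinear_le_cut) (use f f' reg' in \<open>auto simp: abs_le_iff\<close>)
    moreover have "(\<Sum>x\<in>?S. \<Sum>y\<in>?S. - (hf (x, y) - hc x y) * f x * f' y) \<le> \<gamma> * s\<^sup>2"
    proof (rule bilinear_le_cut)
      show "(\<Sum>x\<in>X. \<Sum>y\<in>Y. - (hf (x, y) - hc x y)) \<le> \<gamma> * s\<^sup>2" if "X \<subseteq> ?S" "Y \<subseteq> ?S" for X Y
        unfolding sum_negf using reg'[OF that] by (simp add: abs_le_iff)
    qed (use f f' in auto)
    ultimately have "\<bar>\<Sum>x\<in>?S. \<Sum>y\<in>?S. (hf (x, y) - hc x y) * f x * f' y\<bar> \<le> \<gamma> * s\<^sup>2"
      by (simp only: abs_le_iff sum_negf mult_minus_left)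
    then have "\<bar>\<Sum>x\<in>?S. \<Sum>y\<in>?S. (hf (x, y) - hc x y) * f x * f' y\<bar> / s\<^sup>2 \<le> \<gamma>"
      using pos by (simp add: field_simps)
    then show ?thesis
      by (simp add: avg_def sum_divide_distrib[symmetric] power2_eq_square abs_divide)
  qed
  have copies_W: "copies n M mJ W \<le> M\<^sup>2 / s + M\<^sup>2 * \<gamma> + \<zeta>" if mJ: "mJ \<in> JJ" for mJ
  proof -
    obtain m J where mJ_eq: "mJ = (m, J)" by fastforce
    have m: "m \<le> M" using JJ(2)[OF mJ] mJ_eq by simp
    \<comment> \<open>The factor \<open>1\<close> for pairs reaching beyond the \<open>m\<close>
      vertices of the pattern pads it to \<open>M\<close> positions.\<close>
    define sel where "sel p q x = (if q < m then (if J p q then x else 1 - x) else 1)" for p q and x :: real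
    have sel01: "0 \<le> x \<Longrightarrow> x \<le> 1 \<Longrightarrow> 0 \<le> sel p q x \<and> sel p q x \<le> 1" for p q x
      by (simp add: sel_def)
    have restr: "(\<Prod>e\<in>pairs M. sel (fst e) (snd e) (f e)) = (\<Prod>e\<in>pairs m. if J (fst e) (snd e) then f e else 1 - f e)" for f
    proof -
      have "(\<Prod>e\<in>pairs M. sel (fst e) (snd e) (f e)) = (\<Prod>e\<in>pairs m. sel (fst e) (snd e) (f e))"
        using m by (intro prod.mono_neutral_right finite_pairs) (auto simp: pairs_def sel_def)
      also have "\<dots> = (\<Prod>e\<in>pairs m. if J (fst e) (snd e) then f e else 1 - f e)"
        by (rule prod.cong) (auto simp: pairs_def sel_def)
      finally show ?thesis .
    qed
    define c where "c p q b i j = sel p q (c0 b i j)" for p q b i j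
    have "copies n M mJ W \<le> hom M (\<lambda>_. ?V) (\<lambda>p q a b. c p q (g a b) (\<pi> a) (\<pi> b))"
      unfolding copies_def hom_def mJ_eq fst_conv snd_conv
    proof (intro avg_mono)
      fix x
      have "(\<Prod>e\<in>pairs m. if J (fst e) (snd e) then W (ordered (x (fst e)) (x (snd e))) else 1 - W (ordered (x (fst e)) (x (snd e))))
        = (\<Prod>e\<in>pairs M. c (fst e) (snd e) (g (x (fst e)) (x (snd e))) (\<pi> (x (fst e))) (\<pi> (x (snd e))))"
        unfolding c_def restr[of "\<lambda>e. c0 (g (x (fst e)) (x (snd e))) (\<pi> (x (fst e))) (\<pi> (x (snd e)))"] W_ord ..
      moreover have "0 \<le> (\<Prod>e\<in>pairs M. c (fst e) (snd e) (g (x (fst e)) (x (snd e))) (\<pi> (x (fst e))) (\<pi> (x (snd e))))"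
        by (intro prod_nonneg) (simp add: c_def sel01 c01)
      ultimately show "copy_fun m J x W \<le> (\<Prod>e\<in>pairs M. c (fst e) (snd e) (g (x (fst e)) (x (snd e))) (\<pi> (x (fst e))) (\<pi> (x (snd e))))"
        unfolding copy_fun_def by simp
    qed
    also have "\<dots> \<le> hom M (\<lambda>_. ?S) (\<lambda>p q i j. c p q (gs i j) (lab i) (lab j)) + \<zeta>"
    proof -
      have "\<forall>p q b i j. 0 \<le> c p q b i j \<and> c p q b i j \<le> 1" by (simp add: c_def sel01 c01)
      from \<pi>[OF this] show ?thesis by (simp add: gs_def)
    qed
    also have "hom M (\<lambda>_. ?S) (\<lambda>p q i j. c p q (gs i j) (lab i) (lab j)) = hom M (\<lambda>_. ?S) (\<lambda>p q i j. sel p q (hc i j))"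
      by (simp add: c_def hc_def)
    also have "\<dots> \<le> hom M (\<lambda>_. ?S) (\<lambda>p q i j. sel p q (hf (i, j))) + M\<^sup>2 * \<gamma>"
    proof -
      have "\<bar>hom M (\<lambda>_. ?S) (\<lambda>p q i j. sel p q (hf (i, j))) - hom M (\<lambda>_. ?S) (\<lambda>p q i j. sel p q (hc i j))\<bar> \<le> (real M)\<^sup>2 * \<gamma>"
      proof (rule counting_lemma[OF S])
        fix p q :: nat and f f' :: "nat \<Rightarrow> real"
        assume f: "\<And>x. 0 \<le> f x \<and> f x \<le> 1" "\<And>x. 0 \<le> f' x \<and> f' x \<le> 1"
        have "avg ?S (\<lambda>x. avg ?S (\<lambda>y. (sel p q (hf (x, y)) - sel p q (hc x y)) * f x * f' y))
            = (if q < m then (if J p q then 1 else - 1) else 0) * avg ?S (\<lambda>x. avg ?S (\<lambda>y. (hf (x, y) - hc x y) * f x * f' y))"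
          unfolding avg_cmult[symmetric] by (intro avg_cong refl) (simp add: sel_def algebra_simps)
        then show "\<bar>avg ?S (\<lambda>x. avg ?S (\<lambda>y. (sel p q (hf (x, y)) - sel p q (hc x y)) * f x * f' y))\<bar> \<le> \<gamma>"
          using cut[OF f] pos by (simp add: abs_mult)
      qed (use pos c01 sel01 in \<open>simp_all add: hf_def hc_def\<close>)
      then show ?thesis by simp
    qed
    also have "hom M (\<lambda>_. ?S) (\<lambda>p q i j. sel p q (hf (i, j))) \<le> M\<^sup>2 / s"
    proof -
      \<comment> \<open>\<open>h\<close> contains no copy of the pattern, so only tuples with a
        repeated entry contribute.\<close>
      have "hom M (\<lambda>_. ?S) (\<lambda>p q i j. sel p q (hf (i, j)))
          \<le> avg (PiE {..<M} (\<lambda>_. ?S)) (\<lambda>y. of_bool (\<not> inj_on y {..<m}) + of_bool (inj_on y {..<m} \<and>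
             (\<forall>e\<in>pairs m. J (fst e) (snd e) = h (y (fst e)) (y (snd e)))))"
        unfolding hom_def
      proof (intro avg_mono)
        fix y
        have "(\<Prod>e\<in>pairs M. sel (fst e) (snd e) (hf (y (fst e), y (snd e))))
            = (\<Prod>e\<in>pairs m. of_bool (J (fst e) (snd e) = h (y (fst e)) (y (snd e))))"
          unfolding restr[of "\<lambda>e. hf (y (fst e), y (snd e))"] by (rule prod.cong) (auto simp: hf_def)
        then show "(\<Prod>e\<in>pairs M. sel (fst e) (snd e) (hf (y (fst e), y (snd e))))
          \<le> of_bool (\<not> inj_on y {..<m}) + of_bool (inj_on y {..<m} \<and>
             (\<forall>e\<in>pairs m. J (fst e) (snd e) = h (y (fst e)) (y (snd e))))"
          by (simp add: prod_of_bool)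
      qed
      also have "\<dots> = avg (PiE {..<M} (\<lambda>_. ?S)) (\<lambda>y. of_bool (\<not> inj_on y {..<m}))"
        unfolding avg_add using free[OF mJ] by (simp add: copy_density_def mJ_eq)
      also have "\<dots> \<le> M\<^sup>2 / s" by (rule avg_not_inj_le[OF pos(2) m])
      finally show ?thesis .
    qed
    finally show ?thesis by simp
  qed
  obtain h' where h': "\<forall>a. \<not> h' a a" "\<forall>a b. h' a b = h' b a" "edit n g h' \<le> edit_fun n g W + err"
    "\<forall>mJ\<in>JJ. copy_density n M mJ h' \<le> copies n M mJ W + sqrt ((1 + err) / L)"
    using rounding_graph[OF pos(1) JJ W01 pos(5), of g] g(2) unfolding err_def by blast
  have "edit n g h' \<le> edit s (\<lambda>i j. g (u i) (u j)) h + \<zeta> + err"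
    using h'(3) edit_W by (simp add: gs_def[abs_def])
  moreover have "\<forall>mJ\<in>JJ. copy_density n M mJ h' \<le> M\<^sup>2 / s + M\<^sup>2 * \<gamma> + \<zeta> + sqrt ((1 + err) / L)"
    using h'(4) copies_W by fastforce
  ultimately show ?thesis using h'(1,2) by blast
qed

section \<open>Random samples\<close>

abbreviation samples :: "nat \<Rightarrow> nat \<Rightarrow> (nat \<Rightarrow> nat) set" where
  "samples s n \<equiv> PiE {..<s} (\<lambda>_. {..<n})"

lemma samples_finite: "finite (samples s n)"
  by (auto intro!: finite_PiE)

lemma samples_nonempty: "0 < n \<Longrightarrow> samples s n \<noteq> {}"
  by (auto simp: PiE_eq_empty_iff)

text \<open>\<open>G u\<close> depends on the very sample that contains \<open>u l\<close>.
  Resampling coordinate \<open>l\<close> makes the point independent of \<open>u\<close>, at the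
  cost \<open>d\<close> of altering one coordinate in the parameter of \<open>G\<close>.\<close>

lemma avg_sample_point:
  fixes G :: "(nat \<Rightarrow> nat) \<Rightarrow> nat \<Rightarrow> real"
  assumes n: "0 < n" and s: "0 < s"
    and stab: "\<And>u l a x. u \<in> samples s n \<Longrightarrow> l < s \<Longrightarrow> a < n \<Longrightarrow> x < n \<Longrightarrow> G (u(l := a)) x \<le> G u x + d"
  shows "avg (samples s n) (\<lambda>u. avg {..<s} (\<lambda>l. G u (u l))) \<le> avg (samples s n) (\<lambda>u. avg {..<n} (G u)) + d"
proof -
  let ?U = "samples s n"
  have one: "avg ?U (\<lambda>u. G u (u l)) \<le> avg ?U (\<lambda>u. avg {..<n} (G u)) + d" if "l < s" for l
  proof -
    have "avg ?U (\<lambda>u. G u (u l)) = avg ?U (\<lambda>u. avg {..<n} (\<lambda>a. G (u(l := a)) a))"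
      by (subst avg_PiE_resample_same[where p = l]) (use that n in auto)
    also have "\<dots> \<le> avg ?U (\<lambda>u. avg {..<n} (\<lambda>a. G u a + d))"
      using that by (intro avg_mono stab) auto
    also have "\<dots> = avg ?U (\<lambda>u. avg {..<n} (G u)) + d"
      using n by (simp add: avg_add avg_const lessThan_empty_iff samples_finite samples_nonempty)
    finally show ?thesis .
  qed
  have "avg ?U (\<lambda>u. avg {..<s} (\<lambda>l. G u (u l))) = avg {..<s} (\<lambda>l. avg ?U (\<lambda>u. G u (u l)))"
    by (rule avg_swap)
  also have "\<dots> \<le> avg ?U (\<lambda>u. avg {..<n} (G u)) + d"
  proof (rule avg_le)
    show "{..<s} \<noteq> {}" using s by (simp add: lessThan_empty_iff)
  qed (use one in simp_all)
  finally show ?thesis .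
qed

lemma inverse_le_inverse_sqrt:
  fixes s :: nat
  assumes "0 < s"
  shows "1 / real s \<le> 1 / sqrt s"
proof -
  have "real s \<le> (real s)\<^sup>2" using assms by (intro self_le_power) auto
  then have "sqrt s \<le> s" by (intro real_le_lsqrt) auto
  then show ?thesis using assms by (intro divide_left_mono) auto
qed

text \<open>Each of the two points is either a free vertex or a sample point. A sample point is
  traded for a free one at the cost \<open>d\<close>, twice in the last case.\<close>

lemma avg_sample_pair:
  fixes F :: "(nat \<Rightarrow> nat) \<Rightarrow> nat \<Rightarrow> nat \<Rightarrow> real"
  assumes n: "0 < n" and s: "0 < s" and d: "0 \<le> d"
    and F: "\<And>u v w. 0 \<le> F u v w" "\<And>u v w. F u v w \<le> 1"
    and stab: "\<And>u l a v w. u \<in> samples s n \<Longrightarrow> l < s \<Longrightarrow> a < n \<Longrightarrow> F (u(l := a)) v w \<le> F u v w + d"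
  defines "m \<equiv> avg (samples s n) (\<lambda>u. avg {..<n} (\<lambda>v. avg {..<n} (F u v))) + 2 * d + 1 / s"
  shows "avg (samples s n) (\<lambda>u. avg {..<n} (\<lambda>v. avg {..<n} (F u v))) \<le> m"
    and "avg (samples s n) (\<lambda>u. avg {..<n} (\<lambda>v. avg {..<s} (\<lambda>l. F u v (u l)))) \<le> m"
    and "avg (samples s n) (\<lambda>u. avg {..<s} (\<lambda>j. avg {..<n} (\<lambda>w. F u (u j) w))) \<le> m"
    and "avg (samples s n) (\<lambda>u. avg {..<s} (\<lambda>j. avg {..<s} (\<lambda>l. F u (u j) (u l)))) \<le> m"
proof -
  let ?U = "samples s n"
  let ?m = "avg ?U (\<lambda>u. avg {..<n} (\<lambda>v. avg {..<n} (F u v)))"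
  have s': "0 \<le> 1 / real s" by simp
  show "?m \<le> m" using d s' unfolding m_def by linarith
  have stab': "avg {..<n} (f (u(l := a))) \<le> avg {..<n} (f u) + d"
    if "\<And>x. f (u(l := a)) x \<le> f u x + d" for f u l a
  proof -
    have "avg {..<n} (f (u(l := a))) \<le> avg {..<n} (\<lambda>x. f u x + d)" by (intro avg_mono that)
    then show ?thesis using n by (simp add: avg_add avg_const lessThan_empty_iff)
  qed
  have VS: "avg ?U (\<lambda>u. avg {..<n} (\<lambda>v. avg {..<s} (\<lambda>l. F u v (u l)))) \<le> ?m + d"
  proof -
    have "avg ?U (\<lambda>u. avg {..<s} (\<lambda>l. avg {..<n} (\<lambda>v. F u v (u l))))
        \<le> avg ?U (\<lambda>u. avg {..<n} (\<lambda>w. avg {..<n} (\<lambda>v. F u v w))) + d"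
      by (rule avg_sample_point[OF n s, where G = "\<lambda>u w. avg {..<n} (\<lambda>v. F u v w)"])
        (rule stab', rule stab)
    then show ?thesis unfolding avg_swap[of "{..<s}" "{..<n}"] avg_swap[of "{..<n}" "{..<n}" "\<lambda>w v. F _ v w"] .
  qed
  show "avg ?U (\<lambda>u. avg {..<n} (\<lambda>v. avg {..<s} (\<lambda>l. F u v (u l)))) \<le> m"
    using VS d s' unfolding m_def by linarith
  have "avg ?U (\<lambda>u. avg {..<s} (\<lambda>j. avg {..<n} (\<lambda>w. F u (u j) w))) \<le> ?m + d"
    by (rule avg_sample_point[OF n s, where G = "\<lambda>u v. avg {..<n} (F u v)"])
      (rule stab', rule stab)
  then show "avg ?U (\<lambda>u. avg {..<s} (\<lambda>j. avg {..<n} (\<lambda>w. F u (u j) w))) \<le> m"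
    using d s' unfolding m_def by linarith
  have "avg ?U (\<lambda>u. avg {..<s} (\<lambda>j. avg {..<s} (\<lambda>l. F u (u j) (u l))))
      \<le> avg ?U (\<lambda>u. avg {..<n} (\<lambda>v. avg {..<s} (\<lambda>l. F u v (u l)))) + (d + 1 / s)"
  proof (rule avg_sample_point[OF n s, where G = "\<lambda>u v. avg {..<s} (\<lambda>l. F u v (u l))"])
    fix u l a x assume u: "u \<in> ?U" and l: "l < s" and a: "a < n"
    \<comment> \<open>Besides the parameter of \<open>F\<close>, the inner average changes at the
      single index \<open>l\<close>; this is the extra \<open>1 / s\<close>.\<close>
    have "avg {..<s} (\<lambda>j. F (u(l := a)) x ((u(l := a)) j))
        \<le> avg {..<s} (\<lambda>j. F u x (u j) + d + of_bool (j = l))"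
    proof (intro avg_mono)
      fix j
      show "F (u(l := a)) x ((u(l := a)) j) \<le> F u x (u j) + d + of_bool (j = l)"
        using F(2)[of "u(l := a)" x a] F(1)[of u x "u j"] d stab[OF u l a, of x "u j"] by auto
    qed
    also have "\<dots> = avg {..<s} (\<lambda>j. F u x (u j)) + (d + 1 / s)"
    proof -
      have "avg {..<s} (\<lambda>j. of_bool (j = l)) = 1 / s"
        using l by (simp add: avg_def of_bool_def sum.delta)
      then show ?thesis using s by (simp add: avg_add avg_const lessThan_empty_iff)
    qed
    finally show "avg {..<s} (\<lambda>j. F (u(l := a)) x ((u(l := a)) j)) \<le> avg {..<s} (\<lambda>j. F u x (u j)) + (d + 1 / s)" .
  qed
  then show "avg ?U (\<lambda>u. avg {..<s} (\<lambda>j. avg {..<s} (\<lambda>l. F u (u j) (u l)))) \<le> m"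
    using VS unfolding m_def by linarith
qed

text \<open>For nonnegative \<open>F\<close> it dominates all four combinations of point sets, so
  one application of Markov's inequality treats them together.\<close>

definition pair_sum :: "nat \<Rightarrow> nat \<Rightarrow> ((nat \<Rightarrow> nat) \<Rightarrow> nat \<Rightarrow> nat \<Rightarrow> real) \<Rightarrow> (nat \<Rightarrow> nat) \<Rightarrow> real" where
  "pair_sum s n F u =
    avg {..<n} (\<lambda>v. avg {..<n} (F u v)) + avg {..<n} (\<lambda>v. avg {..<s} (\<lambda>l. F u v (u l)))
    + avg {..<s} (\<lambda>j. avg {..<n} (F u (u j))) + avg {..<s} (\<lambda>j. avg {..<s} (\<lambda>l. F u (u j) (u l)))"

lemma avg_pair_sum_le:
  fixes F :: "(nat \<Rightarrow> nat) \<Rightarrow> nat \<Rightarrow> nat \<Rightarrow> real"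
  assumes n: "0 < n" and s: "0 < s" and d: "0 \<le> d"
    and F: "\<And>u v w. 0 \<le> F u v w" "\<And>u v w. F u v w \<le> 1"
    and stab: "\<And>u l a v w. u \<in> samples s n \<Longrightarrow> l < s \<Longrightarrow> a < n \<Longrightarrow> F (u(l := a)) v w \<le> F u v w + d"
    and m: "avg (samples s n) (\<lambda>u. avg {..<n} (\<lambda>v. avg {..<n} (F u v))) \<le> m"
  shows "avg (samples s n) (pair_sum s n F) \<le> 4 * (m + 2 * d + 1 / s)"
proof -
  let ?U = "samples s n"
  let ?m = "avg ?U (\<lambda>u. avg {..<n} (\<lambda>v. avg {..<n} (F u v))) + 2 * d + 1 / s"
  have "avg ?U (\<lambda>u. avg {..<n} (\<lambda>v. avg {..<s} (\<lambda>l. F u v (u l)))) \<le> ?m"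
    by (rule avg_sample_pair(2)[where F = F]) (fact n s d F stab)+
  moreover have "avg ?U (\<lambda>u. avg {..<s} (\<lambda>j. avg {..<n} (F u (u j)))) \<le> ?m"
    by (rule avg_sample_pair(3)[where F = F]) (fact n s d F stab)+
  moreover have "avg ?U (\<lambda>u. avg {..<s} (\<lambda>j. avg {..<s} (\<lambda>l. F u (u j) (u l)))) \<le> ?m"
    by (rule avg_sample_pair(4)[where F = F]) (fact n s d F stab)+
  moreover have "avg ?U (\<lambda>u. avg {..<n} (\<lambda>v. avg {..<n} (F u v))) \<le> ?m"
    by (rule avg_sample_pair(1)[where F = F]) (fact n s d F stab)+
  moreover have "avg ?U (pair_sum s n F) = avg ?U (\<lambda>u. avg {..<n} (\<lambda>v. avg {..<n} (F u v)))
      + avg ?U (\<lambda>u. avg {..<n} (\<lambda>v. avg {..<s} (\<lambda>l. F u v (u l))))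
      + avg ?U (\<lambda>u. avg {..<s} (\<lambda>j. avg {..<n} (F u (u j))))
      + avg ?U (\<lambda>u. avg {..<s} (\<lambda>j. avg {..<s} (\<lambda>l. F u (u j) (u l))))"
    unfolding pair_sum_def[abs_def] avg_add by (rule refl)
  ultimately show ?thesis using m by (simp add: algebra_simps)
qed

section \<open>Codegrees on a random sample\<close>

lemma sample_codeg_id: "sample_codeg g n id b v w = avg {..<n} (\<lambda>x. of_bool (g v x = b) * of_bool (g w x = b))"
  by (simp add: sample_codeg_def)

lemma sample_codeg_01: "0 \<le> sample_codeg g s u b v w" "sample_codeg g s u b v w \<le> 1"
  unfolding sample_codeg_def by (auto intro!: avg_nonneg avg_le_one)

lemma sample_codeg_mean:
  assumes "0 < n" "0 < s"
  shows "avg (samples s n) (\<lambda>u. \<bar>sample_codeg g s u b v w - sample_codeg g n id b v w\<bar>) \<le> 1 / sqrt s"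
  unfolding sample_codeg_id unfolding sample_codeg_def
  by (rule avg_iid_abs[where f = "\<lambda>x. of_bool (g v x = b) * of_bool (g w x = b)"]) (use assms in auto)

lemma avg_fun_upd_le:
  fixes s :: nat
  assumes s: "0 < s" and l: "l < s" and f: "\<And>x. 0 \<le> f x \<and> f x \<le> (1::real)"
  shows "\<bar>avg {..<s} (\<lambda>j. f ((u(l := a)) j)) - avg {..<s} (\<lambda>j. f (u j))\<bar> \<le> 1 / s"
proof -
  have "\<bar>avg {..<s} (\<lambda>j. f ((u(l := a)) j) - f (u j))\<bar> \<le> avg {..<s} (\<lambda>j. of_bool (j = l))"
    by (rule order_trans[OF avg_abs avg_mono]) (use f[of a] f[of "u l"] in \<open>auto simp: abs_le_iff\<close>)
  also have "\<dots> = 1 / s" using l by (simp add: avg_def of_bool_def sum.delta)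
  finally show ?thesis by (simp add: avg_diff)
qed

text \<open>First moment method, with the errors for both values of \<open>b\<close> added up. The
  resulting \<open>\<rho>\<close> depends on the graph alone, so it can be fixed before the random
  sample is drawn.\<close>

lemma exists_codeg_sample:
  assumes n: "0 < n" and r: "0 < r"
  shows "\<exists>\<rho>\<in>samples r n. \<forall>b. avg {..<n} (\<lambda>v. avg {..<n} (\<lambda>w.
    \<bar>sample_codeg g n id b v w - sample_codeg g r \<rho> b v w\<bar>)) \<le> 2 / sqrt r"
proof -
  define X where "X \<rho> b = avg {..<n} (\<lambda>v. avg {..<n} (\<lambda>w. \<bar>sample_codeg g r \<rho> b v w - sample_codeg g n id b v w\<bar>))" for \<rho> b
  have X0: "0 \<le> X \<rho> b" for \<rho> b unfolding X_def by (intro avg_nonneg) auto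
  have "avg (samples r n) (\<lambda>\<rho>. X \<rho> b) \<le> 1 / sqrt r" for b
  proof -
    have "avg (samples r n) (\<lambda>\<rho>. X \<rho> b) = avg {..<n} (\<lambda>v. avg {..<n} (\<lambda>w.
        avg (samples r n) (\<lambda>\<rho>. \<bar>sample_codeg g r \<rho> b v w - sample_codeg g n id b v w\<bar>)))"
      unfolding X_def by (rule avg_swap3)
    also have "\<dots> \<le> 1 / sqrt r"
      by (rule avg_avg_le[OF n]) (rule sample_codeg_mean[OF n r])
    finally show ?thesis .
  qed
  from this[of True] this[of False] have E: "avg (samples r n) (\<lambda>\<rho>. X \<rho> True + X \<rho> False) \<le> 2 / sqrt r"
    by (simp add: avg_add)
  obtain \<rho> where \<rho>: "\<rho> \<in> samples r n" "X \<rho> True + X \<rho> False \<le> avg (samples r n) (\<lambda>\<rho>. X \<rho> True + X \<rho> False)"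
    using avg_exists_le[OF samples_finite samples_nonempty[OF n], of r "\<lambda>\<rho>. X \<rho> True + X \<rho> False"] by blast
  have "X \<rho> b \<le> 2 / sqrt r" for b
    using \<rho>(2) E X0[of \<rho> True] X0[of \<rho> False] by (cases b) auto
  then show ?thesis using \<rho>(1) unfolding X_def by (intro bexI[of _ \<rho>] allI) (simp_all add: abs_minus_commute)
qed

lemma codeg_error_prob:
  fixes g :: "nat \<Rightarrow> nat \<Rightarrow> bool"
  assumes n: "0 < n" and s: "0 < s" and \<theta>: "0 < \<theta>"
    and \<rho>: "\<And>b. avg {..<n} (\<lambda>v. avg {..<n} (\<lambda>w. \<bar>sample_codeg g n id b v w - sample_codeg g r \<rho> b v w\<bar>)) \<le> 2 / sqrt r"
  shows "avg (samples s n) (\<lambda>u. of_bool (\<not> codeg_close g n s u r \<rho> \<theta>)) \<le> (16 / sqrt r + 40 / sqrt s) / \<theta>"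
proof -
  let ?U = "samples s n"
  \<comment> \<open>The reference sample against all vertices; \<open>be\<close> compares the random
    sample with all vertices, and the triangle inequality joins the two.\<close>
  define al where "al b v w = \<bar>sample_codeg g n id b v w - sample_codeg g r \<rho> b v w\<bar>" for b v w
  define be where "be b u v w = \<bar>sample_codeg g s u b v w - sample_codeg g n id b v w\<bar>" for b u v w
  define Y where "Y = pair_sum s n"
  define X where "X b u = Y (\<lambda>_. al b) u + Y (be b) u" for b u
  have ub: "0 \<le> al b v w" "al b v w \<le> 1" "0 \<le> be b u v w" "be b u v w \<le> 1" for b u v w
    unfolding al_def be_def
    using sample_codeg_01[of g n id b v w] sample_codeg_01[of g r \<rho> b v w] sample_codeg_01[of g s u b v w]
    by (auto simp: abs_le_iff)
  have s1: "1 / real s \<le> 1 / sqrt s"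
    using s by (rule inverse_le_inverse_sqrt)
  have Yal: "avg ?U (Y (\<lambda>_. al b)) \<le> 4 * (2 / sqrt r + 1 / sqrt s)" for b
  proof -
    have P: "finite ?U" "?U \<noteq> {}" using n by (simp_all add: samples_finite samples_nonempty)
    have "avg ?U (\<lambda>u. avg {..<n} (\<lambda>v. avg {..<n} (al b v))) \<le> 2 / sqrt r"
      using \<rho>[of b] P by (simp add: avg_const al_def[abs_def])
    then have "avg ?U (Y (\<lambda>_. al b)) \<le> 4 * (2 / sqrt r + 2 * 0 + 1 / s)"
      unfolding Y_def by (intro avg_pair_sum_le n s) (use ub in auto)
    also have "\<dots> \<le> 4 * (2 / sqrt r + 1 / sqrt s)" using s1 by simp
    finally show ?thesis .
  qed
  have Ybe: "avg ?U (Y (be b)) \<le> 16 / sqrt s" for b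
  proof -
    have m: "avg ?U (\<lambda>u. avg {..<n} (\<lambda>v. avg {..<n} (be b u v))) \<le> 1 / sqrt s"
    proof -
      have "avg ?U (\<lambda>u. avg {..<n} (\<lambda>v. avg {..<n} (be b u v)))
          = avg {..<n} (\<lambda>v. avg {..<n} (\<lambda>w. avg ?U (\<lambda>u. be b u v w)))"
        by (rule avg_swap3)
      also have "\<dots> \<le> 1 / sqrt s"
        unfolding be_def by (rule avg_avg_le[OF n]) (rule sample_codeg_mean[OF n s])
      finally show ?thesis .
    qed
    have "be b (u(l := a)) v w \<le> be b u v w + 1 / s" if "l < s" for u l a v w
    proof -
      have "\<bar>sample_codeg g s (u(l := a)) b v w - sample_codeg g s u b v w\<bar> \<le> 1 / s"
        unfolding sample_codeg_def
        by (rule avg_fun_upd_le[OF s that, of "\<lambda>x. of_bool (g v x = b) * of_bool (g w x = b)"]) auto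
      then show ?thesis unfolding be_def by linarith
    qed
    then have "avg ?U (Y (be b)) \<le> 4 * (1 / sqrt s + 2 * (1 / s) + 1 / s)"
      unfolding Y_def by (intro avg_pair_sum_le n s m ub) simp_all
    also have "\<dots> \<le> 4 * (1 / sqrt s + 2 * (1 / sqrt s) + 1 / sqrt s)"
      using s1 by (intro mult_left_mono add_mono) auto
    finally show ?thesis by simp
  qed
  have Y0: "0 \<le> Y F u" if "\<And>v w. 0 \<le> F u v w" for F u
    unfolding Y_def pair_sum_def using that by (intro add_nonneg_nonneg avg_nonneg)
  have X0: "0 \<le> X b u" for b u unfolding X_def using Y0 ub by (simp add: add_nonneg_nonneg)
  have err_le: "codeg_error g Q (r, \<rho>) B C b \<le> X b u"
    if Q: "Q \<in> {(n, id), (s, u)}" and B: "B \<in> {(n, id), (s, u)}" and C: "C \<in> {(n, id), (s, u)}" for Q B C b u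
  proof -
    have BC: "avg {..<fst B} (\<lambda>v. avg {..<fst C} (\<lambda>w. F u (snd B v) (snd C w))) \<le> Y F u"
      if F: "\<And>v w. 0 \<le> F u v w" for F
    proof -
      have "0 \<le> avg {..<n} (\<lambda>v. avg {..<n} (\<lambda>w. F u v w))" "0 \<le> avg {..<n} (\<lambda>v. avg {..<s} (\<lambda>l. F u v (u l)))"
        "0 \<le> avg {..<s} (\<lambda>j. avg {..<n} (\<lambda>w. F u (u j) w))" "0 \<le> avg {..<s} (\<lambda>j. avg {..<s} (\<lambda>l. F u (u j) (u l)))"
        using F by (intro avg_nonneg; simp)+
      then show ?thesis using B C unfolding Y_def pair_sum_def by auto
    qed
    have "codeg_error g Q (r, \<rho>) B C b \<le> avg {..<fst B} (\<lambda>v. avg {..<fst C} (\<lambda>w.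
        al b (snd B v) (snd C w) + be b u (snd B v) (snd C w)))"
      unfolding codeg_error_def al_def be_def using Q by (intro avg_mono) auto
    also have "\<dots> \<le> X b u"
      unfolding avg_add X_def using BC[of "\<lambda>_. al b"] BC[of "be b"] ub by (intro add_mono) auto
    finally show ?thesis .
  qed
  have "avg ?U (\<lambda>u. of_bool (\<not> codeg_close g n s u r \<rho> \<theta>)) \<le> avg ?U (\<lambda>u. of_bool (\<theta> \<le> X True u + X False u))"
  proof (intro avg_mono of_bool_mono)
    fix u assume "\<not> codeg_close g n s u r \<rho> \<theta>"
    then obtain Q B C b where "Q \<in> {(n, id), (s, u)}" "B \<in> {(n, id), (s, u)}" "C \<in> {(n, id), (s, u)}"
      "\<theta> < codeg_error g Q (r, \<rho>) B C b"
      unfolding codeg_close_def not_le[symmetric] by blast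
    then show "\<theta> \<le> X True u + X False u"
      using err_le[of Q u B C b] X0[of True u] X0[of False u] by (cases b) auto
  qed
  also have "\<dots> \<le> avg ?U (\<lambda>u. X True u + X False u) / \<theta>"
    using X0 \<theta> by (intro avg_markov) (auto intro: add_nonneg_nonneg)
  \<comment> \<open>Summed over both values of \<open>b\<close>: \<open>2 * 8\<close> over
    \<open>sqrt r\<close> and \<open>2 * (4 + 16)\<close> over \<open>sqrt s\<close>.\<close>
  also have "\<dots> \<le> (16 / sqrt r + 40 / sqrt s) / \<theta>"
    using Yal[of True] Yal[of False] Ybe[of True] Ybe[of False] \<theta>
    by (intro divide_right_mono) (auto simp: X_def avg_add)
  finally show ?thesis .
qed

text \<open>Row averages over the sample are first replaced by row means \<open>f\<close>, at points
  of the same sample, which calls for \<open>avg_sample_point\<close>; then the sample mean of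
  \<open>f\<close> is replaced by its mean over all vertices.\<close>

lemma edit_sample_mean:
  assumes n: "0 < n" and s: "0 < s"
  shows "avg (samples s n) (\<lambda>u. \<bar>edit s (\<lambda>i j. g (u i) (u j)) (\<lambda>i j. h (u i) (u j)) - edit n g h\<bar>) \<le> 3 / sqrt s"
proof -
  let ?U = "samples s n"
  define Y :: "nat \<Rightarrow> nat \<Rightarrow> real" where "Y v w = of_bool (g v w \<noteq> h v w)" for v w
  define f where "f v = avg {..<n} (Y v)" for v
  have Y01: "0 \<le> Y v w \<and> Y v w \<le> 1" for v w by (simp add: Y_def)
  have f01: "0 \<le> f v" "f v \<le> 1" for v
    unfolding f_def using Y01 by (auto intro!: avg_nonneg avg_le_one)
  define G where "G u v = \<bar>avg {..<s} (\<lambda>l. Y v (u l)) - f v\<bar>" for u v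
  have s1: "1 / real s \<le> 1 / sqrt s"
    using s by (rule inverse_le_inverse_sqrt)
  have G1: "avg ?U (\<lambda>u. avg {..<s} (\<lambda>j. G u (u j))) \<le> 1 / sqrt s + 1 / s"
  proof -
    have "avg ?U (\<lambda>u. avg {..<s} (\<lambda>j. G u (u j))) \<le> avg ?U (\<lambda>u. avg {..<n} (G u)) + 1 / s"
    proof (rule avg_sample_point[OF n s])
      fix u l a x assume "l < s"
      from avg_fun_upd_le[OF s this, of "Y x" u a] Y01
      show "G (u(l := a)) x \<le> G u x + 1 / s" unfolding G_def by fastforce
    qed
    also have "avg ?U (\<lambda>u. avg {..<n} (G u)) = avg {..<n} (\<lambda>v. avg ?U (\<lambda>u. G u v))" by (rule avg_swap)
    also have "\<dots> \<le> 1 / sqrt s"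
    proof (rule avg_le)
      fix v
      show "avg ?U (\<lambda>u. G u v) \<le> 1 / sqrt s"
        unfolding G_def f_def by (rule avg_iid_abs) (use n s Y01 in auto)
    qed (use n in auto)
    finally show ?thesis by simp
  qed
  have f1: "avg ?U (\<lambda>u. \<bar>avg {..<s} (\<lambda>j. f (u j)) - avg {..<n} f\<bar>) \<le> 1 / sqrt s"
    by (rule avg_iid_abs) (use n s f01 in auto)
  have "avg ?U (\<lambda>u. \<bar>edit s (\<lambda>i j. g (u i) (u j)) (\<lambda>i j. h (u i) (u j)) - edit n g h\<bar>)
      \<le> avg ?U (\<lambda>u. avg {..<s} (\<lambda>j. G u (u j)) + \<bar>avg {..<s} (\<lambda>j. f (u j)) - avg {..<n} f\<bar>)"
  proof (intro avg_mono)
    fix u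
    have "edit s (\<lambda>i j. g (u i) (u j)) (\<lambda>i j. h (u i) (u j)) - avg {..<s} (\<lambda>j. f (u j))
        = avg {..<s} (\<lambda>j. avg {..<s} (\<lambda>l. Y (u j) (u l)) - f (u j))"
      by (simp add: edit_def Y_def avg_diff)
    then have "\<bar>edit s (\<lambda>i j. g (u i) (u j)) (\<lambda>i j. h (u i) (u j)) - avg {..<s} (\<lambda>j. f (u j))\<bar> \<le> avg {..<s} (\<lambda>j. G u (u j))"
      unfolding G_def using avg_abs by metis
    moreover have "edit n g h = avg {..<n} f" by (simp add: edit_def f_def[abs_def] Y_def[abs_def])
    ultimately show "\<bar>edit s (\<lambda>i j. g (u i) (u j)) (\<lambda>i j. h (u i) (u j)) - edit n g h\<bar>
        \<le> avg {..<s} (\<lambda>j. G u (u j)) + \<bar>avg {..<s} (\<lambda>j. f (u j)) - avg {..<n} f\<bar>"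
      by linarith
  qed
  then show ?thesis using G1 f1 s1 unfolding avg_add by simp
qed

section \<open>A uniform law of large numbers for cheapest labels\<close>

lemma min_test_abs_le:
  assumes "0 < k" "\<And>i t. \<bar>\<mu> i t\<bar> \<le> 1"
  shows "\<bar>min_test g M k r \<rho> \<mu> v\<bar> \<le> card (tests M r)"
proof -
  have "min_test g M k r \<rho> \<mu> v \<in> (\<lambda>i. \<Sum>t\<in>tests M r. \<mu> i t * test_val g M \<rho> t v) ` {..<k}"
    unfolding min_test_def using assms(1) by (intro Min_in) auto
  then obtain i where i: "min_test g M k r \<rho> \<mu> v = (\<Sum>t\<in>tests M r. \<mu> i t * test_val g M \<rho> t v)" by auto
  have "\<bar>\<Sum>t\<in>tests M r. \<mu> i t * test_val g M \<rho> t v\<bar> \<le> (\<Sum>t\<in>tests M r. 1)"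
    using assms(2) test_val_01 by (intro order_trans[OF sum_abs] sum_mono) (simp add: abs_mult mult_le_one)
  then show ?thesis using i by simp
qed

lemma min_test_lipschitz:
  fixes d :: real
  assumes k: "0 < k" and d: "\<And>i t. i < k \<Longrightarrow> t \<in> tests M r \<Longrightarrow> \<mu> i t \<le> \<nu> i t + d" and d0: "0 \<le> d"
  shows "min_test g M k r \<rho> \<mu> v \<le> min_test g M k r \<rho> \<nu> v + card (tests M r) * d"
proof -
  have "min_test g M k r \<rho> \<nu> v \<in> (\<lambda>i. \<Sum>t\<in>tests M r. \<nu> i t * test_val g M \<rho> t v) ` {..<k}"
    unfolding min_test_def using k by (intro Min_in) auto
  then obtain i where i: "i < k" "min_test g M k r \<rho> \<nu> v = (\<Sum>t\<in>tests M r. \<nu> i t * test_val g M \<rho> t v)" by auto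
  have "min_test g M k r \<rho> \<mu> v \<le> (\<Sum>t\<in>tests M r. \<mu> i t * test_val g M \<rho> t v)"
    unfolding min_test_def using i by (intro Min_le) auto
  also have "\<dots> \<le> (\<Sum>t\<in>tests M r. \<nu> i t * test_val g M \<rho> t v + d)"
  proof (intro sum_mono)
    fix t assume "t \<in> tests M r"
    then have "\<mu> i t * test_val g M \<rho> t v \<le> (\<nu> i t + d) * test_val g M \<rho> t v"
      using d[OF i(1)] test_val_01 by (intro mult_right_mono) auto
    also have "\<dots> \<le> \<nu> i t * test_val g M \<rho> t v + d"
      using mult_left_le[OF test_val_01(2) d0] by (simp add: distrib_right)
    finally show "\<mu> i t * test_val g M \<rho> t v \<le> \<nu> i t * test_val g M \<rho> t v + d" .
  qed
  finally show ?thesis using i(2) by (simp add: sum.distrib)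
qed

text \<open>A union bound over a grid of step \<open>1 / D\<close> in the cube of all
  \<open>\<mu>\<close>. Half of the error \<open>4 * N / D\<close> is the deviation at the grid
  point, the other half comes from replacing \<open>\<mu>\<close> by it on both sides.\<close>

lemma min_test_lln:
  fixes g :: "nat \<Rightarrow> nat \<Rightarrow> bool" and M :: nat
  assumes n: "0 < n" and s: "0 < s" and k: "0 < k" and r: "0 < r" and D: "0 < D"
  defines "N \<equiv> card (tests M r)"
  shows "avg (samples s n) (\<lambda>u. of_bool (\<not> tests_close g n s u M k r \<rho> (4 * real N / real D)))
    \<le> real ((2 * D + 1) ^ (k * N)) * exp (- (real s / (4 * (real D)\<^sup>2)))"
proof -
  let ?U = "samples s n"
  have N: "0 < N" unfolding N_def card_tests using r by simp
  define grid :: "real set" where "grid = (\<lambda>i. real_of_int i / D) ` {- int D..int D}"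
  define net where "net = PiE ({..<k} \<times> tests M r) (\<lambda>_. grid)"
  have grid: "finite grid" "card grid \<le> 2 * D + 1"
  proof -
    show "finite grid" by (simp add: grid_def)
    have "card grid \<le> card {- int D..int D}" unfolding grid_def by (rule card_image_le) simp
    then show "card grid \<le> 2 * D + 1" by simp
  qed
  have net: "finite net" "card net \<le> (2 * D + 1) ^ (k * N)"
  proof -
    show "finite net" unfolding net_def using grid by (intro finite_PiE) auto
    have "card net = card grid ^ (k * N)"
      by (simp add: net_def card_PiE card_cartesian_product N_def)
    then show "card net \<le> (2 * D + 1) ^ (k * N)" using grid(2) by (simp add: power_mono)
  qed
  \<comment> \<open>Division by \<open>N\<close> normalises to \<open>[-1, 1]\<close>. Clamping
    bounds all entries, those outside the index range included, and changes no grid value.\<close>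
  define fn where "fn \<nu> v = min_test g M k r \<rho> (\<lambda>i t. max (- 1) (min 1 (\<nu> (i, t)))) v / N" for \<nu> v
  have fn1: "\<bar>fn \<nu> v\<bar> \<le> 1" for \<nu> v
    using min_test_abs_le[OF k, of "\<lambda>i t. max (- 1) (min 1 (\<nu> (i, t)))" g M r \<rho> v] N
    by (simp add: fn_def abs_divide N_def abs_le_iff)
  define bad where "bad \<nu> u \<longleftrightarrow> 2 / real D \<le> avg {..<n} (fn \<nu>) - avg {..<s} (\<lambda>j. fn \<nu> (u j))" for \<nu> u
  have pbad: "avg ?U (\<lambda>u. of_bool (bad \<nu> u)) \<le> exp (- (real s / (4 * (real D)\<^sup>2)))" for \<nu>
  proof -
    have "avg ?U (\<lambda>u. of_bool (bad \<nu> u)) \<le> exp (- (real s * (2 / real D)\<^sup>2 / 16))"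
      unfolding bad_def
      by (rule avg_iid_tail[where f = "fn \<nu>" and t = "2 / real D"])
        (use n s D fn1 in \<open>auto simp: lessThan_empty_iff field_simps\<close>)
    then show ?thesis by (simp add: power_divide)
  qed
  have "avg ?U (\<lambda>u. of_bool (\<not> tests_close g n s u M k r \<rho> (4 * real N / real D)))
    \<le> avg ?U (\<lambda>u. \<Sum>\<nu>\<in>net. of_bool (bad \<nu> u))"
  proof (intro avg_mono)
    fix u
    have "avg {..<n} (min_test g M k r \<rho> \<mu>) \<le> avg {..<s} (\<lambda>j. min_test g M k r \<rho> \<mu> (u j)) + 4 * real N / real D"
      if nb: "\<And>\<nu>. \<nu> \<in> net \<Longrightarrow> \<not> bad \<nu> u" and \<mu>: "\<And>i t. \<bar>\<mu> i t\<bar> \<le> 1" for \<mu>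
    proof -
      define \<nu> where "\<nu> = restrict (\<lambda>(i, t). real_of_int \<lfloor>\<mu> i t * D\<rfloor> / D) ({..<k} \<times> tests M r)"
      have fl: "- int D \<le> \<lfloor>\<mu> i t * D\<rfloor>" "\<lfloor>\<mu> i t * D\<rfloor> \<le> int D" for i t
      proof -
        have "- real D \<le> \<mu> i t * D" "\<mu> i t * D \<le> D"
          using \<mu>[of i t] mult_right_mono[of "- 1" "\<mu> i t" "real D"] mult_right_mono[of "\<mu> i t" 1 "real D"]
          by (auto simp: abs_le_iff)
        then show "- int D \<le> \<lfloor>\<mu> i t * D\<rfloor>" "\<lfloor>\<mu> i t * D\<rfloor> \<le> int D"
          by (simp_all add: le_floor_iff) (metis floor_mono floor_of_nat)
      qed
      have "\<nu> \<in> net" unfolding net_def \<nu>_def grid_def using fl by (auto simp: image_iff)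
      then have nbad: "avg {..<n} (fn \<nu>) - avg {..<s} (\<lambda>j. fn \<nu> (u j)) < 2 / D" using nb by (simp add: bad_def not_le)
      define \<nu>' where "\<nu>' i t = max (- 1) (min 1 (\<nu> (i, t)))" for i t
      have close: "\<nu>' i t \<le> \<mu> i t + 1 / D" "\<mu> i t \<le> \<nu>' i t + 1 / D" if "i < k" "t \<in> tests M r" for i t
      proof -
        have v: "\<nu> (i, t) = real_of_int \<lfloor>\<mu> i t * D\<rfloor> / D" using that by (simp add: \<nu>_def)
        have "real_of_int \<lfloor>\<mu> i t * D\<rfloor> \<le> \<mu> i t * D" "\<mu> i t * D \<le> real_of_int \<lfloor>\<mu> i t * D\<rfloor> + 1" by linarith+
        then have "\<nu> (i, t) \<le> \<mu> i t" "\<mu> i t \<le> \<nu> (i, t) + 1 / D" using D by (simp_all add: v field_simps)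
        moreover have "- 1 \<le> \<nu> (i, t)" "\<nu> (i, t) \<le> 1"
        proof -
          have "- real D \<le> real_of_int \<lfloor>\<mu> i t * D\<rfloor>" "real_of_int \<lfloor>\<mu> i t * D\<rfloor> \<le> real D"
            using fl[of i t] by linarith+
          then show "- 1 \<le> \<nu> (i, t)" "\<nu> (i, t) \<le> 1" using D by (simp_all add: v field_simps)
        qed
        moreover have "0 \<le> 1 / real D" by simp
        ultimately show "\<nu>' i t \<le> \<mu> i t + 1 / D" "\<mu> i t \<le> \<nu>' i t + 1 / D" by (auto simp: \<nu>'_def)
      qed
      have NfN: "N * fn \<nu> v = min_test g M k r \<rho> \<nu>' v" for v
        using N by (simp add: fn_def \<nu>'_def[abs_def])
      have c1: "min_test g M k r \<rho> \<mu> v \<le> N * fn \<nu> v + N * (1 / D)" for v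
        unfolding NfN unfolding N_def by (rule min_test_lipschitz[OF k]) (use close(2) in auto)
      have c2: "N * fn \<nu> v \<le> min_test g M k r \<rho> \<mu> v + N * (1 / D)" for v
        unfolding NfN unfolding N_def by (rule min_test_lipschitz[OF k]) (use close(1) in auto)
      have "avg {..<n} (min_test g M k r \<rho> \<mu>) \<le> avg {..<n} (\<lambda>v. N * fn \<nu> v + N * (1 / D))"
        by (intro avg_mono c1)
      also have "\<dots> = N * avg {..<n} (fn \<nu>) + N * (1 / D)"
        using n unfolding avg_add avg_cmult by (subst avg_const) auto
      also have "\<dots> \<le> N * (avg {..<s} (\<lambda>j. fn \<nu> (u j)) + 2 / D) + N * (1 / D)"
        using nbad by (intro add_mono mult_left_mono) auto
      also have "\<dots> = avg {..<s} (\<lambda>j. N * fn \<nu> (u j)) + 3 * (N / D)"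
        unfolding avg_cmult by (simp add: distrib_left)
      also have "avg {..<s} (\<lambda>j. N * fn \<nu> (u j)) \<le> avg {..<s} (\<lambda>j. min_test g M k r \<rho> \<mu> (u j) + N * (1 / D))"
        by (intro avg_mono c2)
      also have "\<dots> = avg {..<s} (\<lambda>j. min_test g M k r \<rho> \<mu> (u j)) + N / D"
        using s unfolding avg_add by (subst avg_const) auto
      finally show ?thesis by simp
    qed
    then show "of_bool (\<not> tests_close g n s u M k r \<rho> (4 * real N / real D)) \<le> (\<Sum>\<nu>\<in>net. of_bool (bad \<nu> u) :: real)"
      unfolding tests_close_def by (intro of_bool_le_sum net(1)) blast
  qed
  also have "\<dots> = (\<Sum>\<nu>\<in>net. avg ?U (\<lambda>u. of_bool (bad \<nu> u)))" by (simp only: avg_sum)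
  also have "\<dots> \<le> (\<Sum>\<nu>\<in>net. exp (- (real s / (4 * (real D)\<^sup>2))))" by (intro sum_mono pbad)
  also have "\<dots> = real (card net) * exp (- (real s / (4 * (real D)\<^sup>2)))" by simp
  also have "\<dots> \<le> real ((2 * D + 1) ^ (k * N)) * exp (- (real s / (4 * (real D)\<^sup>2)))"
    using net(2) by (intro mult_right_mono) (simp_all only: of_nat_le_iff exp_ge_zero)
  finally show ?thesis .
qed

section \<open>Choice of the parameters\<close>

lemma pow_shift:
  fixes D :: nat
  assumes "2 \<le> D"
  shows "2 ^ j * D ^ a \<le> D ^ (j + a)"
  unfolding power_add using assms by (intro mult_right_mono power_mono) auto

lemma le_two_power: "(D :: nat) \<le> 2 ^ D"
  by (rule less_imp_le) (rule less_exp)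

lemma two_pow_ratio:
  assumes "c * 2 ^ a \<le> (2 :: real) ^ b"
  shows "c / 2 ^ b \<le> 1 / 2 ^ a"
  using assms by (simp add: field_simps)

text \<open>In \<open>sample_size\<close> and \<open>lift_probability\<close>, \<open>D\<close> stands for \<open>M/\<delta>\<close> rounded up, and the successive parameters are
  powers of two whose exponents are powers of \<open>D\<close> that leave ample room.\<close>

definition sample_size :: "nat \<Rightarrow> nat" where
  "sample_size D = 2 ^ (2 * D ^ 20)"

text \<open>\<open>h\<close> is quantified inside the event: a good sample lifts every modification,
  so \<open>h\<close> may be chosen after the sample.\<close>

definition lifts :: "nat \<Rightarrow> (nat \<Rightarrow> nat \<Rightarrow> bool) \<Rightarrow> nat \<Rightarrow> nat \<Rightarrow> (nat \<times> (nat \<Rightarrow> nat \<Rightarrow> bool)) set \<Rightarrow> nat \<Rightarrow> (nat \<Rightarrow> nat) \<Rightarrow> bool" where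
  "lifts n g D M JJ s u \<longleftrightarrow> (\<forall>h. (\<forall>x y. h x y = h y x) \<longrightarrow> (\<forall>mJ\<in>JJ. copy_density s M mJ h = 0) \<longrightarrow>
     (\<exists>h'. (\<forall>a. \<not> h' a a) \<and> (\<forall>a b. h' a b = h' b a) \<and>
       edit n g h' \<le> edit s (\<lambda>i j. g (u i) (u j)) h + 1 / (4 * (real D)\<^sup>2) \<and>
       (\<forall>mJ\<in>JJ. copy_density n M mJ h' < 2 / real D)))"

lemma lift_probability:
  fixes g :: "nat \<Rightarrow> nat \<Rightarrow> bool"
  assumes M: "2 \<le> M" "M \<le> D" and n: "2 ^ (D ^ 24) \<le> n"
    and g: "\<And>x y. g x y = g y x" "\<And>x. \<not> g x x"
    and JJ: "finite JJ" "\<And>mJ. mJ \<in> JJ \<Longrightarrow> fst mJ \<le> M" "card JJ \<le> 2 ^ (2 * D\<^sup>2)"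
  defines "s \<equiv> sample_size D"
  shows "avg (samples s n) (\<lambda>u. of_bool (\<not> lifts n g D M JJ s u)) \<le> 1 / 20"
proof -
  have D: "2 \<le> D" using M by linarith
  \<comment> \<open>The comparisons of exponents absorb numerical factors \<open>2 ^ j\<close> into
    \<open>j\<close> spare powers of \<open>D\<close>.\<close>
  note P = pow_shift[OF D]
  have D1: "1 \<le> D ^ a" for a using D by (simp add: one_le_power)
  have D_le: "real D \<le> 2 ^ D" using le_two_power[of D] by (metis of_nat_le_iff of_nat_numeral of_nat_power)
  have M_le: "real M \<le> 2 ^ D" using D_le M by linarith
  \<comment> \<open>\<open>T\<close> exceeds \<open>1 / \<gamma>\<^sup>2 = 16 * D ^ 6\<close>;
    \<open>\<gamma>\<close> and \<open>L\<close> make \<open>M\<^sup>2 * \<gamma>\<close> and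
    \<open>sqrt (2 / L)\<close> at most \<open>1 / (4 * D)\<close>; \<open>\<theta>\<close> and
    \<open>1 / G\<close> are small against the inverse square of \<open>M * k * 2 ^ M\<close>; and
    \<open>r\<close> makes the codegree error of the reference sample small against
    \<open>\<theta>\<close>.\<close>
  define T where "T = D ^ 11"
  define r where "r = (2::nat) ^ (2 * D ^ 16)"
  define G where "G = (2::nat) ^ (D ^ 15)"
  define \<theta> where "\<theta> = 1 / (2::real) ^ (D ^ 15)"
  define \<gamma> where "\<gamma> = 1 / (4 * (real D) ^ 3)"
  define L where "L = 32 * (real D)\<^sup>2"
  define N where "N = card (tests M r)"
  define k where "k = (4::nat) ^ T"
  have n0: "0 < n" using n by (meson less_le_trans zero_less_numeral zero_less_power)
  have s0: "0 < s" and r0: "0 < r" and G0: "0 < G" and k0: "0 < k"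
    by (simp_all add: s_def sample_size_def r_def G_def k_def)
  have sq: "sqrt r = 2 ^ (D ^ 16)" "sqrt s = 2 ^ (D ^ 20)"
    by (simp_all add: r_def s_def sample_size_def real_sqrt_power[symmetric] power_mult real_sqrt_unique mult.commute)
      (simp_all add: power_mult[symmetric] mult.commute[of _ 2] power_even_eq real_sqrt_power)
  obtain \<rho> where \<rho>: "\<rho> \<in> samples r n" "\<And>b. avg {..<n} (\<lambda>v. avg {..<n} (\<lambda>w.
    \<bar>sample_codeg g n id b v w - sample_codeg g r \<rho> b v w\<bar>)) \<le> 2 / sqrt r"
    using exists_codeg_sample[OF n0 r0, of g] by blast
  define codeg_ok where "codeg_ok u = codeg_close g n s u r \<rho> \<theta>" for u
  define lln_ok where "lln_ok u = tests_close g n s u M k r \<rho> (4 * real N / real G)" for u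
  define \<zeta> where "\<zeta> = real M * (real (4 ^ T) * 2 ^ M *
      sqrt (2 ^ M / real n + (4 * real N / real G) / real r ^ M + 4 * real M * \<theta>))"
  define err where "err = 2 * L * card JJ * M\<^sup>2 / n"
  have nr: "2 ^ (D ^ 24) \<le> real n" using n by (metis of_nat_le_iff of_nat_numeral of_nat_power)
  have p1: "avg (samples s n) (\<lambda>u. of_bool (\<not> codeg_ok u)) \<le> 1 / 40"
  proof -
    have "avg (samples s n) (\<lambda>u. of_bool (\<not> codeg_ok u)) \<le> (16 / sqrt r + 40 / sqrt s) / \<theta>"
      unfolding codeg_ok_def by (rule codeg_error_prob[OF n0 s0 _ \<rho>(2)]) (simp add: \<theta>_def)
    also have "\<dots> \<le> (1 / 2 ^ (D ^ 15 + 7) + 1 / 2 ^ (D ^ 15 + 7)) / \<theta>"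
    proof (intro divide_right_mono add_mono)
      have "4 + (D ^ 15 + 7) \<le> D ^ 16" using P[of 1 15] P[of 4 11] D1[of 11] by simp
      then have "(2::real) ^ (4 + (D ^ 15 + 7)) \<le> 2 ^ (D ^ 16)" by (intro power_increasing) auto
      then have "16 * (2::real) ^ (D ^ 15 + 7) \<le> 2 ^ (D ^ 16)" by (simp add: power_add)
      then show "16 / sqrt r \<le> 1 / 2 ^ (D ^ 15 + 7)" unfolding sq by (rule two_pow_ratio)
      have "6 + (D ^ 15 + 7) \<le> D ^ 20" using P[of 5 15] P[of 4 11] D1[of 11] by simp
      then have "(2::real) ^ (6 + (D ^ 15 + 7)) \<le> 2 ^ (D ^ 20)" by (intro power_increasing) auto
      then have "64 * (2::real) ^ (D ^ 15 + 7) \<le> 2 ^ (D ^ 20)" by (simp add: power_add)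
      moreover have "0 \<le> (2::real) ^ (D ^ 15 + 7)" by simp
      ultimately have "40 * (2::real) ^ (D ^ 15 + 7) \<le> 2 ^ (D ^ 20)" by linarith
      then show "40 / sqrt s \<le> 1 / 2 ^ (D ^ 15 + 7)" unfolding sq by (rule two_pow_ratio)
    qed (simp add: \<theta>_def)
    also have "\<dots> \<le> 1 / 40" by (simp add: \<theta>_def power_add)
    finally show ?thesis .
  qed
  have N_eq: "N = (2 * r) ^ M" by (simp add: N_def card_tests)
  have p2: "avg (samples s n) (\<lambda>u. of_bool (\<not> lln_ok u)) \<le> 1 / 40"
  proof -
    \<comment> \<open>Exponent for \<open>k * N * (D ^ 15 + 2)\<close>: the first term is for
      \<open>k\<close>, the next two for \<open>N\<close>, the rest for the logarithm of the grid
      size in one coordinate.\<close>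
    let ?A = "2 * D ^ 11 + 2 * D ^ 17 + D + D ^ 15 + 2"
    have "avg (samples s n) (\<lambda>u. of_bool (\<not> lln_ok u)) \<le> real ((2 * G + 1) ^ (k * N)) * exp (- (real s / (4 * (real G)\<^sup>2)))"
      unfolding lln_ok_def N_def by (rule min_test_lln[OF n0 s0 k0 r0 G0])
    also have "real ((2 * G + 1) ^ (k * N)) \<le> exp (real (k * N * (D ^ 15 + 2)))"
    proof -
      have "real (2 * G + 1) \<le> 2 ^ (D ^ 15 + 2)"
      proof -
        have "2 * G + 1 \<le> 4 * G" using G0 by simp
        then have "2 * G + 1 \<le> 2 ^ (D ^ 15 + 2)" by (simp add: G_def power_add)
        then show ?thesis by (metis of_nat_le_iff of_nat_numeral of_nat_power)
      qed
      also have "\<dots> \<le> exp 1 ^ (D ^ 15 + 2)"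
        using exp_ge_add_one_self[of 1] by (intro power_mono) auto
      finally have "real (2 * G + 1) ^ (k * N) \<le> (exp 1 ^ (D ^ 15 + 2)) ^ (k * N)" by (intro power_mono) auto
      also have "\<dots> = exp (real (k * N * (D ^ 15 + 2)))"
        by (simp only: power_mult[symmetric] exp_of_nat_mult[symmetric]) (simp add: algebra_simps)
      finally show ?thesis by simp
    qed
    also have "exp (real (k * N * (D ^ 15 + 2))) * exp (- (real s / (4 * (real G)\<^sup>2)))
        = exp (real (k * N * (D ^ 15 + 2)) - real s / (4 * (real G)\<^sup>2))"
      by (simp add: exp_add[symmetric])
    also have "\<dots> \<le> exp (- 5)"
    proof -
      have "k * N * (D ^ 15 + 2) \<le> 2 ^ ?A"
      proof -
        have "N \<le> (2 * r) ^ D" unfolding N_eq using M r0 by (intro power_increasing) auto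
        also have "2 * r = 2 ^ (2 * D ^ 16 + 1)" by (simp add: r_def)
        also have "(2 ^ (2 * D ^ 16 + 1)) ^ D = (2 :: nat) ^ ((2 * D ^ 16 + 1) * D)" by (simp only: power_mult)
        also have "(2 * D ^ 16 + 1) * D = 2 * D ^ 17 + D"
          using power_add[of D 16 1] by (simp add: distrib_right)
        finally have "N \<le> 2 ^ (2 * D ^ 17 + D)" .
        moreover have "k = 2 ^ (2 * D ^ 11)" by (simp add: k_def T_def power_mult)
        ultimately have "k * N * (D ^ 15 + 2) \<le> 2 ^ (2 * D ^ 11) * 2 ^ (2 * D ^ 17 + D) * 2 ^ (D ^ 15 + 2)"
          using le_two_power[of "D ^ 15 + 2"] by (intro mult_mono) auto
        also have "\<dots> = 2 ^ ?A" by (simp only: power_add[symmetric] add.assoc)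
        finally show ?thesis .
      qed
      then have "real (k * N * (D ^ 15 + 2)) \<le> 2 ^ ?A" by (metis of_nat_le_iff of_nat_numeral of_nat_power)
      moreover have "2 ^ (?A + 3) \<le> real s / (4 * (real G)\<^sup>2)"
      proof -
        have "?A + 3 + (2 * D ^ 15 + 2) \<le> 2 * D ^ 20"
          using P[of 3 17] P[of 6 11] P[of 2 15] P[of 16 1] P[of 17 0] by simp
        then have "(2::real) ^ (?A + 3 + (2 * D ^ 15 + 2)) \<le> 2 ^ (2 * D ^ 20)" by (intro power_increasing) auto
        then have "(2::real) ^ (?A + 3) * 2 ^ (2 * D ^ 15 + 2) \<le> 2 ^ (2 * D ^ 20)"
          by (simp only: power_add[of _ "?A + 3"])
        moreover have "4 * (2 ^ (D ^ 15))\<^sup>2 = (2::real) ^ (2 * D ^ 15 + 2)"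
          by (simp add: power_add power_mult[symmetric] mult.commute)
        ultimately have "(2::real) ^ (?A + 3) * (4 * (2 ^ (D ^ 15))\<^sup>2) \<le> 2 ^ (2 * D ^ 20)"
          by simp
        then show ?thesis by (simp add: s_def sample_size_def G_def field_simps)
      qed
      moreover have "(2::real) ^ m + 5 \<le> 2 ^ (m + 3)" for m
      proof -
        have "(1::real) \<le> 2 ^ m" by simp
        moreover have "(2::real) ^ (m + 3) = 8 * 2 ^ m" by (simp add: power_add)
        ultimately show ?thesis by linarith
      qed
      from this[of ?A] have "(2::real) ^ ?A + 5 \<le> 2 ^ (?A + 3)" .
      ultimately have "real (k * N * (D ^ 15 + 2)) + 5 \<le> real s / (4 * (real G)\<^sup>2)" by linarith
      then show ?thesis by simp
    qed
    also have "exp (- 5 :: real) \<le> 1 / 40"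
    proof -
      have "(1 + 1 + 1\<^sup>2 / 2) ^ 5 \<le> exp (1::real) ^ 5"
        using exp_lower_Taylor_quadratic[of "1::real"] by (intro power_mono) auto
      also have "exp (1::real) ^ 5 = exp 5" by (simp flip: exp_of_nat_mult)
      finally have "40 \<le> exp (5::real)" by (simp add: power_divide)
      then have "1 / exp 5 \<le> 1 / (40::real)" by (intro divide_left_mono) auto
      then show ?thesis by (simp add: exp_minus inverse_eq_divide)
    qed
    finally show ?thesis by simp
  qed
  \<comment> \<open>The bound is written as a square because \<open>\<zeta>\<close> contains the
    root of this sum.\<close>
  have X: "2 ^ M / real n + (4 * real N / real G) / real r ^ M + 4 * real M * \<theta> \<le> (1 / 2 ^ (D ^ 13))\<^sup>2"
  proof -
    have e: "2 * D ^ 13 + (D + 4) \<le> D ^ 15" using P[of 2 13] P[of 12 1] P[of 13 0] by simp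
    have M2: "(2::real) ^ M \<le> 2 ^ D" using M by (intro power_increasing) auto
    have key: "4 * 2 ^ D / (2::real) ^ (D ^ 15) \<le> 1 / 2 ^ (2 * D ^ 13 + 2)"
    proof (rule two_pow_ratio)
      have "(2::real) ^ (2 * D ^ 13 + (D + 4)) \<le> 2 ^ (D ^ 15)" using e by (intro power_increasing) auto
      then show "4 * 2 ^ D * (2::real) ^ (2 * D ^ 13 + 2) \<le> 2 ^ (D ^ 15)" by (simp add: power_add mult_ac)
    qed
    have "2 ^ M / real n \<le> 4 * 2 ^ D / 2 ^ (D ^ 15)"
    proof (rule frac_le)
      have "(2::real) ^ (D ^ 15) \<le> 2 ^ (D ^ 24)" using D by (intro power_increasing) auto
      then show "2 ^ (D ^ 15) \<le> real n" using nr by linarith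
      have "0 \<le> (2::real) ^ D" by simp
      then show "(2::real) ^ M \<le> 4 * 2 ^ D" using M2 by linarith
    qed auto
    moreover have "(4 * real N / real G) / real r ^ M = 4 * 2 ^ M / 2 ^ (D ^ 15)"
      using r0 by (simp add: N_eq G_def power_mult_distrib)
    then have "(4 * real N / real G) / real r ^ M \<le> 4 * 2 ^ D / 2 ^ (D ^ 15)"
      using M2 by (simp add: divide_right_mono)
    moreover have "4 * real M * \<theta> \<le> 4 * 2 ^ D / 2 ^ (D ^ 15)"
      using M_le by (simp add: \<theta>_def divide_right_mono)
    moreover have "(1 / (2::real) ^ (D ^ 13))\<^sup>2 = 4 * (1 / 2 ^ (2 * D ^ 13 + 2))"
      by (simp add: power_add power_mult[symmetric] power_divide mult.commute[of _ 2])
    moreover have "0 \<le> 1 / (2::real) ^ (2 * D ^ 13 + 2)" by simp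
    ultimately show ?thesis using key by linarith
  qed
  have D2: "8 * (real D)\<^sup>2 \<le> 2 ^ (3 + 2 * D)"
  proof -
    have "(real D)\<^sup>2 \<le> (2 ^ D)\<^sup>2" using D_le by (intro power_mono) auto
    moreover have "((2::real) ^ D)\<^sup>2 = 2 ^ (2 * D)" by (rule power_even_eq[symmetric])
    moreover have "(2::real) ^ (3 + 2 * D) = 8 * 2 ^ (2 * D)" by (simp only: power_add) simp
    ultimately show ?thesis by linarith
  qed
  have \<zeta>: "\<zeta> \<le> 1 / (8 * (real D)\<^sup>2)"
  proof -
    have "sqrt (2 ^ M / real n + (4 * real N / real G) / real r ^ M + 4 * real M * \<theta>) \<le> 1 / 2 ^ (D ^ 13)"
      using X by (intro real_le_lsqrt) auto
    then have "\<zeta> \<le> 2 ^ D * (2 ^ (2 * D ^ 11) * 2 ^ D * (1 / 2 ^ (D ^ 13)))"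
      unfolding \<zeta>_def using M_le M
      by (intro mult_mono) (auto simp: T_def power_mult \<theta>_def intro!: power_increasing)
    also have "\<dots> = 2 ^ (D + 2 * D ^ 11 + D) / 2 ^ (D ^ 13)"
      by (simp only: power_add mult_1_right times_divide_eq_right mult.assoc)
    also have "\<dots> \<le> 1 / 2 ^ (3 + 2 * D)"
    proof (rule two_pow_ratio)
      have "(D + 2 * D ^ 11 + D) + (3 + 2 * D) \<le> D ^ 13" using P[of 2 11] P[of 10 1] P[of 11 0] by simp
      then have "(2::real) ^ ((D + 2 * D ^ 11 + D) + (3 + 2 * D)) \<le> 2 ^ (D ^ 13)" by (intro power_increasing) auto
      then show "2 ^ (D + 2 * D ^ 11 + D) * (2::real) ^ (3 + 2 * D) \<le> 2 ^ (D ^ 13)" by (simp only: power_add)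
    qed
    also have "\<dots> \<le> 1 / (8 * (real D)\<^sup>2)" using D2 D by (intro divide_left_mono) auto
    finally show ?thesis .
  qed
  have err: "err \<le> 1 / (8 * (real D)\<^sup>2)"
  proof -
    have "err \<le> 2 * (32 * (real D)\<^sup>2) * 2 ^ (2 * D\<^sup>2) * (real D)\<^sup>2 / 2 ^ (D ^ 24)"
    proof -
      have "real (card JJ) \<le> 2 ^ (2 * D\<^sup>2)" using JJ(3) by (metis of_nat_le_iff of_nat_numeral of_nat_power)
      then show ?thesis
        unfolding err_def L_def using nr M n0 by (intro frac_le mult_mono) (auto intro!: power_mono)
    qed
    also have "\<dots> \<le> (2 ^ (3 + 2 * D) * 2 ^ (3 + 2 * D) * 2 ^ (2 * D\<^sup>2)) / 2 ^ (D ^ 24)"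
    proof (intro divide_right_mono)
      have "8 * (real D)\<^sup>2 * (8 * (real D)\<^sup>2) \<le> 2 ^ (3 + 2 * D) * 2 ^ (3 + 2 * D)"
        using D2 by (intro mult_mono) auto
      then have "(8 * (real D)\<^sup>2 * (8 * (real D)\<^sup>2)) * 2 ^ (2 * D\<^sup>2) \<le> (2 ^ (3 + 2 * D) * 2 ^ (3 + 2 * D)) * 2 ^ (2 * D\<^sup>2)"
        by (intro mult_right_mono) auto
      then show "2 * (32 * (real D)\<^sup>2) * 2 ^ (2 * D\<^sup>2) * (real D)\<^sup>2 \<le> 2 ^ (3 + 2 * D) * 2 ^ (3 + 2 * D) * 2 ^ (2 * D\<^sup>2)"
        by (simp add: mult_ac)
    qed simp
    also have "\<dots> \<le> 1 / 2 ^ (3 + 2 * D)"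
    proof (rule two_pow_ratio)
      have "(3 + 2 * D) + (3 + 2 * D) + 2 * D\<^sup>2 + (3 + 2 * D) \<le> D ^ 24"
        using P[of 22 2] P[of 23 1] P[of 24 0] D by (simp add: power2_eq_square)
      then have "(2::real) ^ ((3 + 2 * D) + (3 + 2 * D) + 2 * D\<^sup>2 + (3 + 2 * D)) \<le> 2 ^ (D ^ 24)"
        by (intro power_increasing) auto
      then show "2 ^ (3 + 2 * D) * 2 ^ (3 + 2 * D) * 2 ^ (2 * D\<^sup>2) * (2::real) ^ (3 + 2 * D) \<le> 2 ^ (D ^ 24)"
        by (simp only: power_add)
    qed
    also have "\<dots> \<le> 1 / (8 * (real D)\<^sup>2)" using D2 D by (intro divide_left_mono) auto
    finally show ?thesis .
  qed
  have small: "\<zeta> + err \<le> 1 / (4 * (real D)\<^sup>2)" using \<zeta> err by simp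
  \<comment> \<open>Four terms of at most \<open>1 / (4 * D)\<close> each, half of what is
    allowed.\<close>
  have density: "M\<^sup>2 / s + M\<^sup>2 * \<gamma> + \<zeta> + sqrt ((1 + err) / L) < 2 / real D"
  proof -
    have MD: "(real M)\<^sup>2 \<le> (real D)\<^sup>2" using M by (intro power_mono) auto
    have D3: "4 * (real D) ^ 3 \<le> real s"
    proof -
      have "4 * (real D) ^ 3 \<le> 4 * (2 ^ D) ^ 3" using D_le by (intro mult_left_mono power_mono) auto
      also have "((2::real) ^ D) ^ 3 = 2 ^ (3 * D)" by (metis power_mult mult.commute)
      also have "4 * (2::real) ^ (3 * D) = 2 ^ (2 + 3 * D)" by (simp add: power_add)
      also have "\<dots> \<le> 2 ^ (2 * D ^ 20)"
        using P[of 19 1] P[of 20 0] by (intro power_increasing) auto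
      finally show ?thesis by (simp add: s_def sample_size_def)
    qed
    have a: "(real M)\<^sup>2 / real s \<le> 1 / (4 * D)"
    proof -
      have "(real M)\<^sup>2 / real s \<le> (real D)\<^sup>2 / (4 * (real D) ^ 3)"
        using MD D3 D by (intro frac_le) auto
      also have "\<dots> = 1 / (4 * D)" using D by (simp add: field_simps power2_eq_square power3_eq_cube)
      finally show ?thesis .
    qed
    have b: "(real M)\<^sup>2 * \<gamma> \<le> 1 / (4 * D)"
    proof -
      have "(real M)\<^sup>2 * \<gamma> \<le> (real D)\<^sup>2 * \<gamma>" using MD by (intro mult_right_mono) (auto simp: \<gamma>_def)
      also have "\<dots> = 1 / (4 * D)" using D by (simp add: \<gamma>_def field_simps power2_eq_square power3_eq_cube)
      finally show ?thesis .
    qed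
    have c: "1 / (8 * (real D)\<^sup>2) \<le> 1 / (4 * D)"
      using D by (simp add: field_simps power2_eq_square)
    have d: "sqrt ((1 + err) / L) \<le> 1 / (4 * D)"
    proof (rule real_le_lsqrt)
      have "1 \<le> (real D)\<^sup>2" using D by (intro one_le_power) simp
      then have "1 \<le> 8 * (real D)\<^sup>2" by linarith
      then have "1 / (8 * (real D)\<^sup>2) \<le> 1" by (auto simp: divide_le_eq_1)
      then have "(1 + err) / L \<le> 2 / L" using err by (intro divide_right_mono) (auto simp: L_def)
      also have "\<dots> = (1 / (4 * D))\<^sup>2" by (simp add: L_def power_divide power_mult_distrib)
      finally show "(1 + err) / L \<le> (1 / (4 * D))\<^sup>2" .
    qed (use D in auto)
    have "M\<^sup>2 / s + M\<^sup>2 * \<gamma> + \<zeta> + sqrt ((1 + err) / L) \<le> 4 * (1 / (4 * D))"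
      using a b c d \<zeta> by simp
    also have "\<dots> < 2 / real D" using D by (simp add: field_simps)
    finally show ?thesis .
  qed
  have main: "lifts n g D M JJ s u" if ok: "codeg_ok u" "lln_ok u" for u
    unfolding lifts_def
  proof (intro allI impI)
    fix h :: "nat \<Rightarrow> nat \<Rightarrow> bool"
    assume h: "\<forall>x y. h x y = h y x" and free: "\<forall>mJ\<in>JJ. copy_density s M mJ h = 0"
    have "\<exists>h'. (\<forall>a. \<not> h' a a) \<and> (\<forall>a b. h' a b = h' b a) \<and>
      edit n g h' \<le> edit s (\<lambda>i j. g (u i) (u j)) h + \<zeta> + err \<and>
      (\<forall>mJ\<in>JJ. copy_density n M mJ h' \<le> M\<^sup>2 / s + M\<^sup>2 * \<gamma> + \<zeta> + sqrt ((1 + err) / L))"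
      unfolding \<zeta>_def err_def
    proof (rule sample_lift[OF n0 s0 r0 M(1), where u = u])
      show "0 < L" "0 < \<gamma>" using D by (simp_all add: L_def \<gamma>_def)
      show "1 < real T * \<gamma>\<^sup>2"
      proof -
        have "32 \<le> (real D) ^ 5" using power_mono[of 2 "real D" 5] D by simp
        then have "16 * (real D) ^ 6 < (real D) ^ 5 * (real D) ^ 6" using D by (intro mult_strict_right_mono) auto
        then have "16 * (real D) ^ 6 < (real D) ^ 11" by (simp flip: power_add)
        then show ?thesis using D
          by (simp add: T_def \<gamma>_def power_divide power_mult_distrib field_simps flip: power_mult)
      qed
      show "codeg_close g n s u r \<rho> \<theta>" "tests_close g n s u M (4 ^ T) r \<rho> (4 * real N / real G)"
        using ok by (simp_all add: codeg_ok_def lln_ok_def k_def)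
    qed (use g h free JJ in auto)
    then obtain h' where h': "\<forall>a. \<not> h' a a" "\<forall>a b. h' a b = h' b a"
      "edit n g h' \<le> edit s (\<lambda>i j. g (u i) (u j)) h + \<zeta> + err"
      "\<forall>mJ\<in>JJ. copy_density n M mJ h' \<le> M\<^sup>2 / s + M\<^sup>2 * \<gamma> + \<zeta> + sqrt ((1 + err) / L)" by blast
    then show "\<exists>h'. (\<forall>a. \<not> h' a a) \<and> (\<forall>a b. h' a b = h' b a) \<and>
       edit n g h' \<le> edit s (\<lambda>i j. g (u i) (u j)) h + 1 / (4 * (real D)\<^sup>2) \<and>
       (\<forall>mJ\<in>JJ. copy_density n M mJ h' < 2 / real D)"
      using small density by (intro exI[of _ h']) force
  qed
  have "avg (samples s n) (\<lambda>u. of_bool (\<not> lifts n g D M JJ s u))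
      \<le> avg (samples s n) (\<lambda>u. of_bool (\<not> codeg_ok u) + of_bool (\<not> lln_ok u))"
    using main by (intro avg_mono) auto
  also have "\<dots> \<le> 1 / 20" unfolding avg_add using p1 p2 by simp
  finally show ?thesis .
qed

section \<open>Graphs and adjacency relations\<close>

definition rel_graph :: "nat \<Rightarrow> (nat \<Rightarrow> nat \<Rightarrow> bool) \<Rightarrow> graph" where
  "rel_graph n h = \<lparr>verts = {..<n}, edges = {{i, j} |i j. i < n \<and> j < n \<and> i \<noteq> j \<and> h i j}\<rparr>"

definition sym_irrefl :: "(nat \<Rightarrow> nat \<Rightarrow> bool) \<Rightarrow> bool" where
  "sym_irrefl h \<longleftrightarrow> (\<forall>i j. h i j = h j i) \<and> (\<forall>i. \<not> h i i)"

lemma sym_irreflD: "sym_irrefl h \<Longrightarrow> h i j = h j i" "sym_irrefl h \<Longrightarrow> \<not> h i i"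
  by (auto simp: sym_irrefl_def)

lemma verts_rel_graph [simp]: "verts (rel_graph n h) = {..<n}"
  by (simp add: rel_graph_def)

lemma edge_rel_graph:
  assumes "\<And>i j. h i j = h j i"
  shows "{i, j} \<in> edges (rel_graph n h) \<longleftrightarrow> i < n \<and> j < n \<and> i \<noteq> j \<and> h i j"
  using assms by (auto simp: rel_graph_def doubleton_eq_iff)

lemma simple_rel_graph: "simple_graph (rel_graph n h)"
  by (auto simp: simple_graph_def rel_graph_def)

lemma sym_irrefl_edge_access: "simple_graph G \<Longrightarrow> sym_irrefl (edge_access x G)"
  by (auto simp: sym_irrefl_def edge_access_def insert_commute simple_graph_def)

lemma graph_iso_sym:
  assumes "graph_iso G H"
  shows "graph_iso H G"
proof -
  obtain f where f: "bij_betw f (verts G) (verts H)"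
    "\<And>u v. u \<in> verts G \<Longrightarrow> v \<in> verts G \<Longrightarrow> {u, v} \<in> edges G \<longleftrightarrow> {f u, f v} \<in> edges H"
    using assms by (auto simp: graph_iso_def)
  let ?f = "inv_into (verts G) f"
  have "bij_betw ?f (verts H) (verts G)" using f(1) by (rule bij_betw_inv_into)
  moreover have "{u, v} \<in> edges H \<longleftrightarrow> {?f u, ?f v} \<in> edges G" if "u \<in> verts H" "v \<in> verts H" for u v
    using f(2)[of "?f u" "?f v"] that f(1)
    by (simp add: bij_betw_inv_into_right bij_betw_apply[OF bij_betw_inv_into])
  ultimately show ?thesis unfolding graph_iso_def by blast
qed

lemma property_iso:
  assumes "graph_property P" "graph_iso G H" "simple_graph G" "simple_graph H"
  shows "G \<in> P \<longleftrightarrow> H \<in> P"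
  using assms graph_iso_sym[OF assms(2)] unfolding graph_property_def by blast

lemma iso_edge_access:
  assumes G: "simple_graph G" and x: "enumerates x G" and n: "n = card (verts G)"
    and h: "\<And>i j. i < n \<Longrightarrow> j < n \<Longrightarrow> h i j = edge_access x G i j" and hs: "\<And>i j. h i j = h j i"
  shows "graph_iso (rel_graph n h) G"
  unfolding graph_iso_def
proof (intro exI[of _ x] conjI ballI)
  show b: "bij_betw x (verts (rel_graph n h)) (verts G)" using x n by (simp add: enumerates_def)
  fix u v assume uv: "u \<in> verts (rel_graph n h)" "v \<in> verts (rel_graph n h)"
  have "{x u, x v} \<notin> edges G" if "u = v" using G that by (auto simp: simple_graph_def)
  then show "{u, v} \<in> edges (rel_graph n h) \<longleftrightarrow> {x u, x v} \<in> edges G"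
    using uv h[of u v] unfolding edge_rel_graph[of h, OF hs] by (auto simp: edge_access_def)
qed

text \<open>An injective pullback is isomorphic to an induced subgraph. This is how heredity enters:
  it keeps sampled subgraphs in \<open>P\<close> and excludes copies of graphs outside
  \<open>P\<close>.\<close>

lemma pullback_in_property:
  assumes P: "hereditary P" and h: "rel_graph s h \<in> P" "sym_irrefl h" and J: "sym_irrefl J"
    and y: "inj_on y {..<m}" "y ` {..<m} \<subseteq> {..<s}"
    and eq: "\<And>p q. p < q \<Longrightarrow> q < m \<Longrightarrow> J p q = h (y p) (y q)"
  shows "rel_graph m J \<in> P"
proof -
  let ?H = "induced_subgraph (rel_graph s h) (y ` {..<m})"
  have H: "?H \<in> P" using P h y by (simp add: hereditary_def)
  have gp: "graph_property P" using P by (simp add: hereditary_def)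
  have eq': "J p q = h (y p) (y q)" if "p < m" "q < m" for p q
    using eq[of p q] eq[of q p] that sym_irreflD[OF h(2)] sym_irreflD[OF J]
    by (cases p q rule: linorder_cases) auto
  have iso: "graph_iso (rel_graph m J) ?H"
    unfolding graph_iso_def
  proof (intro exI[of _ y] conjI ballI)
    show "bij_betw y (verts (rel_graph m J)) (verts ?H)"
      using y by (simp add: induced_subgraph_def bij_betw_def)
    fix u v assume "u \<in> verts (rel_graph m J)" "v \<in> verts (rel_graph m J)"
    then have uv: "u < m" "v < m" by auto
    have "{y u, y v} \<in> edges ?H \<longleftrightarrow> {y u, y v} \<in> edges (rel_graph s h)"
      using uv by (auto simp: induced_subgraph_def)
    then show "{u, v} \<in> edges (rel_graph m J) \<longleftrightarrow> {y u, y v} \<in> edges ?H"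
      using uv y eq'[of u v]
      by (auto simp: edge_rel_graph[OF sym_irreflD(1)[OF h(2)]] edge_rel_graph[OF sym_irreflD(1)[OF J]] inj_on_def)
  qed
  have "simple_graph ?H" using H gp unfolding graph_property_def by blast
  then show ?thesis using property_iso[OF gp iso simple_rel_graph] H by blast
qed

section \<open>Edit distance of graphs and of relations\<close>

definition diff_pairs :: "nat \<Rightarrow> (nat \<Rightarrow> nat \<Rightarrow> bool) \<Rightarrow> (nat \<Rightarrow> nat \<Rightarrow> bool) \<Rightarrow> (nat \<times> nat) set" where
  "diff_pairs n g h = {(a, b). a < b \<and> b < n \<and> g a b \<noteq> h a b}"

lemma finite_diff_pairs [simp]: "finite (diff_pairs n g h)"
  by (rule finite_subset[of _ "{..<n} \<times> {..<n}"]) (auto simp: diff_pairs_def)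

lemma edit_eq_diff_pairs:
  assumes g: "sym_irrefl g" and h: "sym_irrefl h"
  shows "edit n g h = 2 * card (diff_pairs n g h) / (real n)\<^sup>2"
proof -
  let ?D = "{(a, b). a < n \<and> b < n \<and> g a b \<noteq> h a b}"
  have fin: "finite ?D" by (rule finite_subset[of _ "{..<n} \<times> {..<n}"]) auto
  have un: "?D = diff_pairs n g h \<union> prod.swap ` diff_pairs n g h"
  proof (intro set_eqI iffI)
    fix e assume e: "e \<in> ?D"
    obtain a b where ab: "e = (a, b)" by fastforce
    have "a \<noteq> b" using e ab g h by (auto simp: sym_irrefl_def)
    then consider "a < b" | "b < a" by linarith
    then show "e \<in> diff_pairs n g h \<union> prod.swap ` diff_pairs n g h"
    proof cases
      case 2
      then have "(b, a) \<in> diff_pairs n g h" using e ab g h by (auto simp: diff_pairs_def sym_irrefl_def)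
      then show ?thesis using ab by (auto simp: image_iff intro!: bexI[of _ "(b, a)"])
    qed (use e ab in \<open>auto simp: diff_pairs_def\<close>)
  next
    fix e assume "e \<in> diff_pairs n g h \<union> prod.swap ` diff_pairs n g h"
    then show "e \<in> ?D" using g h by (auto simp: diff_pairs_def sym_irrefl_def)
  qed
  have "card ?D = card (diff_pairs n g h) + card (prod.swap ` diff_pairs n g h)"
    unfolding un by (rule card_Un_disjoint[OF finite_diff_pairs finite_imageI[OF finite_diff_pairs]]) (auto simp: diff_pairs_def)
  also have "card (prod.swap ` diff_pairs n g h) = card (diff_pairs n g h)"
    by (rule card_image) (auto simp: inj_on_def)
  finally have c: "card ?D = 2 * card (diff_pairs n g h)" by simp
  have "(\<Sum>a<n. \<Sum>b<n. of_bool (g a b \<noteq> h a b)) = (\<Sum>e\<in>{..<n} \<times> {..<n}. of_bool (e \<in> ?D) :: real)"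
    unfolding sum.cartesian_product by (intro sum.cong) auto
  also have "\<dots> = (\<Sum>e\<in>?D. 1)"
    by (rule sum.mono_neutral_cong_right) auto
  finally have "(\<Sum>a<n. \<Sum>b<n. of_bool (g a b \<noteq> h a b)) = real (card ?D)" by simp
  moreover have "edit n g h = (\<Sum>a<n. \<Sum>b<n. of_bool (g a b \<noteq> h a b)) / real n / real n"
    by (simp only: edit_def avg_def sum_divide_distrib[symmetric] card_lessThan)
  ultimately show ?thesis by (simp only: c) (simp add: power2_eq_square)
qed

lemma edit_triangle: "edit n a c \<le> edit n a b + edit n b c"
  unfolding edit_def avg_add[symmetric] by (intro avg_mono) auto

lemma edit_nonneg: "0 \<le> edit n g h"
  unfolding edit_def by (intro avg_nonneg) auto

lemma edit_cong:
  assumes "\<And>i j. i < n \<Longrightarrow> j < n \<Longrightarrow> g i j = g' i j" "\<And>i j. i < n \<Longrightarrow> j < n \<Longrightarrow> h i j = h' i j"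
  shows "edit n g h = edit n g' h'"
  unfolding edit_def using assms by (intro avg_cong) auto

lemma card_sym_diff_edges:
  assumes G: "simple_graph G" and H: "simple_graph H" and V: "verts H = verts G"
    and x: "enumerates x G" and n: "n = card (verts G)"
  shows "card (sym_diff (edges G) (edges H)) = card (diff_pairs n (edge_access x G) (edge_access x H))"
proof -
  let ?f = "\<lambda>(a, b). {x a, x b}"
  have b: "bij_betw x {..<n} (verts G)" using x n by (simp add: enumerates_def)
  have "bij_betw ?f (diff_pairs n (edge_access x G) (edge_access x H)) (sym_diff (edges G) (edges H))"
    unfolding bij_betw_def
  proof
    show "inj_on ?f (diff_pairs n (edge_access x G) (edge_access x H))"
    proof (rule inj_onI)
      fix d e assume d: "d \<in> diff_pairs n (edge_access x G) (edge_access x H)"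
        and e: "e \<in> diff_pairs n (edge_access x G) (edge_access x H)" and eq: "?f d = ?f e"
      have "x ` {fst d, snd d} = x ` {fst e, snd e}" using eq by (auto simp: case_prod_beta)
      then have "{fst d, snd d} = {fst e, snd e}"
        using d e by (subst (asm) inj_on_image_eq_iff[OF bij_betw_imp_inj_on[OF b]]) (auto simp: diff_pairs_def)
      then show "d = e" using d e by (auto simp: diff_pairs_def doubleton_eq_iff)
    qed
    show "?f ` diff_pairs n (edge_access x G) (edge_access x H) = sym_diff (edges G) (edges H)"
    proof (intro set_eqI iffI)
      fix e assume e: "e \<in> sym_diff (edges G) (edges H)"
      then have "e \<subseteq> verts G" "card e = 2" using G H V by (auto simp: simple_graph_def)
      then obtain v w where vw: "e = {v, w}" "v \<noteq> w" "v \<in> verts G" "w \<in> verts G" by (auto simp: card_2_iff)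
      obtain a c where ac: "a < n" "c < n" "v = x a" "w = x c"
        using vw bij_betw_imp_surj_on[OF b] by blast
      have "a \<noteq> c" using vw ac by auto
      then have "(min a c, max a c) \<in> diff_pairs n (edge_access x G) (edge_access x H)"
        using e ac vw by (auto simp: diff_pairs_def edge_access_def min_def max_def insert_commute)
      moreover have "?f (min a c, max a c) = e" using ac vw by (auto simp: min_def max_def)
      ultimately show "e \<in> ?f ` diff_pairs n (edge_access x G) (edge_access x H)" by (metis imageI)
    qed (auto simp: diff_pairs_def edge_access_def)
  qed
  then show ?thesis by (simp add: bij_betw_same_card)
qed

text \<open>The factor \<open>2\<close> appears because \<open>edit\<close> averages over ordered pairs.\<close>

definition far_rel :: "graph set \<Rightarrow> nat \<Rightarrow> real \<Rightarrow> (nat \<Rightarrow> nat \<Rightarrow> bool) \<Rightarrow> bool" where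
  "far_rel P n \<beta> g \<longleftrightarrow> (\<forall>h. sym_irrefl h \<and> rel_graph n h \<in> P \<longrightarrow> 2 * \<beta> \<le> edit n g h)"

text \<open>Transport along \<open>x\<close> in both directions; closure of \<open>P\<close> under
  isomorphism carries membership from a relation on indices to a graph on \<open>verts G\<close> and
  back.\<close>

lemma far_from_iff_far_rel:
  assumes P: "hereditary P" and G: "simple_graph G" and x: "enumerates x G" and n: "n = card (verts G)" "0 < n"
  shows "far_from P \<beta> G \<longleftrightarrow> far_rel P n \<beta> (edge_access x G)"
proof -
  have gp: "graph_property P" using P by (simp add: hereditary_def)
  have b: "bij_betw x {..<n} (verts G)" using x n by (simp add: enumerates_def)
  have *: "real (card (sym_diff (edges G) (edges H))) \<ge> \<beta> * real (card (verts G)) ^ 2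
      \<longleftrightarrow> 2 * \<beta> \<le> edit n (edge_access x G) (edge_access x H)"
    if H: "simple_graph H" "verts H = verts G" for H
  proof -
    have "2 * \<beta> \<le> 2 * C / N \<longleftrightarrow> \<beta> * N \<le> C" if "0 < N" for C N :: real
      using that by (simp add: field_simps)
    from this[of "(real n)\<^sup>2"] n(2) show ?thesis
      unfolding edit_eq_diff_pairs[OF sym_irrefl_edge_access[OF G] sym_irrefl_edge_access[OF H(1)], of n x x]
        card_sym_diff_edges[OF G H x n(1)] n(1)[symmetric] by simp
  qed
  show ?thesis
  proof
    assume far: "far_from P \<beta> G"
    show "far_rel P n \<beta> (edge_access x G)"
      unfolding far_rel_def
    proof (intro allI impI)
      fix h assume "sym_irrefl h \<and> rel_graph n h \<in> P"
      then have h: "sym_irrefl h" "rel_graph n h \<in> P" by auto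
      define H where "H = \<lparr>verts = verts G, edges = {{x i, x j} |i j. i < n \<and> j < n \<and> i \<noteq> j \<and> h i j}\<rparr>"
      have sH: "simple_graph H"
        using G bij_betw_apply[OF b] bij_betw_imp_inj_on[OF b]
        by (auto simp: H_def simple_graph_def card_insert_if inj_on_def)
      have acc: "h i j = edge_access x H i j" if ij: "i < n" "j < n" for i j
      proof
        assume "h i j"
        then show "edge_access x H i j" using ij sym_irreflD(2)[OF h(1), of i]
          by (auto simp: edge_access_def H_def)
      next
        assume "edge_access x H i j"
        then obtain i' j' where e: "{x i, x j} = {x i', x j'}" "i' < n" "j' < n" "h i' j'"
          by (auto simp: edge_access_def H_def)
        have "x ` {i, j} = x ` {i', j'}" using e by auto
        then have "{i, j} = {i', j'}"
          using ij e by (subst (asm) inj_on_image_eq_iff[OF bij_betw_imp_inj_on[OF b]]) auto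
        then show "h i j" using e sym_irreflD(1)[OF h(1)] by (auto simp: doubleton_eq_iff)
      qed
      have xH: "enumerates x H" "n = card (verts H)" using x n by (simp_all add: H_def enumerates_def)
      have "graph_iso (rel_graph n h) H"
        by (rule iso_edge_access[OF sH xH acc sym_irreflD(1)[OF h(1)]])
      then have "H \<in> P" using property_iso[OF gp _ simple_rel_graph sH] h by blast
      then have "2 * \<beta> \<le> edit n (edge_access x G) (edge_access x H)"
        using far *[OF sH] by (auto simp: far_from_def H_def)
      also have "\<dots> = edit n (edge_access x G) h" using acc by (intro edit_cong) auto
      finally show "2 * \<beta> \<le> edit n (edge_access x G) h" .
    qed
  next
    assume far: "far_rel P n \<beta> (edge_access x G)"
    show "far_from P \<beta> G"
      unfolding far_from_def
    proof (intro ballI impI)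
      fix H assume H: "H \<in> P" "verts H = verts G"
      have sH: "simple_graph H" using H gp by (auto simp: graph_property_def)
      have xH: "enumerates x H" "n = card (verts H)" using x n H by (simp_all add: enumerates_def)
      have "graph_iso (rel_graph n (edge_access x H)) H"
        by (rule iso_edge_access[OF sH xH refl]) (rule sym_irreflD(1)[OF sym_irrefl_edge_access[OF sH]])
      then have "rel_graph n (edge_access x H) \<in> P" using property_iso[OF gp _ simple_rel_graph sH] H by blast
      then have "2 * \<beta> \<le> edit n (edge_access x G) (edge_access x H)"
        using far sym_irrefl_edge_access[OF sH] by (auto simp: far_rel_def)
      then show "real (card (sym_diff (edges G) (edges H))) \<ge> \<beta> * real (card (verts G)) ^ 2"
        using *[OF sH H(2)] by blast
    qed
  qed
qed

text \<open>The required number of edits is \<open>0\<close>. The empty graph is thus far for every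
  \<open>\<beta>\<close> and never close, and the estimator answers \<open>Far\<close> when
  \<open>n = 0\<close>.\<close>

lemma far_from_empty: "card (verts G) = 0 \<Longrightarrow> far_from P \<beta> G"
  by (simp add: far_from_def)

section \<open>Nonadaptive decision trees\<close>

fun query_tree :: "(nat \<times> nat) list \<Rightarrow> (bool list \<Rightarrow> verdict) \<Rightarrow> decision_tree" where
  "query_tree [] f = Output (f [])"
| "query_tree (e # es) f = Query (fst e) (snd e)
     (query_tree es (\<lambda>a. f (True # a))) (query_tree es (\<lambda>a. f (False # a)))"

lemma run_query_tree: "run adj (query_tree es f) = f (map (\<lambda>e. adj (fst e) (snd e)) es)"
  by (induction es arbitrary: f) auto

lemma queries_query_tree: "queries adj (query_tree es f) = es"
  by (induction es arbitrary: f) auto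

text \<open>All pairs inside \<open>u\<close> are queried regardless of the answers, and
  \<open>dec\<close> is applied to the graph read off. Injectivity of \<open>u\<close> makes the
  queries legal.\<close>

lemma decision_tree_exists:
  assumes u: "inj_on u {..<s}" "u ` {..<s} \<subseteq> {..<n}"
  shows "\<exists>T. \<forall>adj. sym_irrefl adj \<longrightarrow>
    (\<forall>(i, j)\<in>set (queries adj T). i < n \<and> j < n \<and> i \<noteq> j) \<and> length (queries adj T) \<le> s\<^sup>2 \<and>
    run adj T = dec (\<lambda>i j. i < s \<and> j < s \<and> adj (u i) (u j))"
proof -
  have u_lt: "u i < n" if "i < s" for i using u(2) that by auto
  have u_eq: "u i = u j \<longleftrightarrow> i = j" if "i < s" "j < s" for i j
    using inj_on_eq_iff[OF u(1)] that by simp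
  define ps where "ps = concat (map (\<lambda>i. map (\<lambda>j. (u i, u j)) [0..<i]) [0..<s])"
  have set_ps: "set ps = {(u i, u j) |i j. j < i \<and> i < s}"
  proof -
    have "set ps = (\<Union>i\<in>{..<s}. (\<lambda>j. (u i, u j)) ` {..<i})"
      by (simp add: ps_def atLeast0LessThan)
    also have "\<dots> = {(u i, u j) |i j. j < i \<and> i < s}"
      by (intro set_eqI iffI; elim UN_E imageE CollectE exE conjE) blast+
    finally show ?thesis .
  qed
  have len: "length ps \<le> s\<^sup>2"
  proof -
    have "length ps = (\<Sum>i<s. i)"
      by (simp add: ps_def length_concat o_def sum_list_distinct_conv_sum_set atLeast0LessThan)
    also have "\<dots> \<le> (\<Sum>i<s. s)" by (intro sum_mono) auto
    finally show ?thesis by (simp add: power2_eq_square)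
  qed
  \<comment> \<open>Each unordered pair is asked once, larger index first, so its answer is looked
    up in both orders.\<close>
  define decode where "decode a i j \<longleftrightarrow> i < s \<and> j < s \<and>
    (((u i, u j), True) \<in> set (zip ps a) \<or> ((u j, u i), True) \<in> set (zip ps a))" for a i j
  define T where "T = query_tree ps (\<lambda>a. dec (decode a))"
  show ?thesis
  proof (intro exI[of _ T] allI impI conjI)
    fix adj assume adj: "sym_irrefl adj"
    have q: "queries adj T = ps" by (simp add: T_def queries_query_tree)
    show "\<forall>(i, j)\<in>set (queries adj T). i < n \<and> j < n \<and> i \<noteq> j"
      unfolding q set_ps using u_lt u_eq by force
    show "length (queries adj T) \<le> s\<^sup>2" using len q by simp
    have z: "(e, True) \<in> set (zip ps (map (\<lambda>e. adj (fst e) (snd e)) ps)) \<longleftrightarrow> e \<in> set ps \<and> adj (fst e) (snd e)" for e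
      by (auto simp: zip_map2 zip_same_conv_map)
    have "decode (map (\<lambda>e. adj (fst e) (snd e)) ps) = (\<lambda>i j. i < s \<and> j < s \<and> adj (u i) (u j))"
    proof (intro ext)
      fix i j
      show "decode (map (\<lambda>e. adj (fst e) (snd e)) ps) i j = (i < s \<and> j < s \<and> adj (u i) (u j))"
      proof (cases "i < s \<and> j < s")
        case True
        have mem: "(u i, u j) \<in> set ps \<longleftrightarrow> j < i" "(u j, u i) \<in> set ps \<longleftrightarrow> i < j"
          using True u_eq unfolding set_ps by force+
        have "adj (u j) (u i) = adj (u i) (u j)" "i = j \<Longrightarrow> \<not> adj (u i) (u j)"
          using sym_irreflD[OF adj] by auto
        then show ?thesis
          unfolding decode_def z mem fst_conv snd_conv using True by (cases i j rule: linorder_cases) auto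
      next
        case False
        then show ?thesis unfolding decode_def by blast
      qed
    qed
    then show "run adj T = dec (\<lambda>i j. i < s \<and> j < s \<and> adj (u i) (u j))"
      by (simp add: T_def run_query_tree)
  qed
qed

section \<open>Finite families of small patterns\<close>

lemma prob_pmf_of_set_avg:
  assumes "finite A" "A \<noteq> {}"
  shows "measure_pmf.prob (pmf_of_set A) S = avg A (\<lambda>a. of_bool (a \<in> S))"
  using assms by (simp add: measure_pmf_of_set avg_def Int_def)

text \<open>The symmetric closure of a set of pairs; coding relations by sets of increasing pairs
  makes the family of patterns finite.\<close>

definition pattern :: "nat \<times> (nat \<times> nat) set \<Rightarrow> nat \<times> (nat \<Rightarrow> nat \<Rightarrow> bool)" where
  "pattern mE = (fst mE, \<lambda>p q. (p, q) \<in> snd mE \<or> (q, p) \<in> snd mE)"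

definition patterns :: "nat \<Rightarrow> (nat \<times> (nat \<Rightarrow> nat \<Rightarrow> bool)) set" where
  "patterns M = pattern ` ({..M} \<times> Pow (pairs M))"

lemma finite_patterns: "finite (patterns M)"
  by (simp add: patterns_def)

lemma card_patterns: "card (patterns M) \<le> 2 ^ (M + M\<^sup>2)"
proof -
  have "card (patterns M) \<le> card ({..M} \<times> Pow (pairs M))"
    unfolding patterns_def by (rule card_image_le) simp
  also have "\<dots> = Suc M * 2 ^ card (pairs M)" by (simp add: card_cartesian_product card_Pow)
  also have "\<dots> \<le> 2 ^ M * 2 ^ (M\<^sup>2)"
    using card_pairs_le[of M] Suc_leI[OF less_exp[of M]] by (intro mult_mono power_increasing) auto
  finally show ?thesis by (simp add: power_add)
qed

lemma patternsD: "mJ \<in> patterns M \<Longrightarrow> fst mJ \<le> M" "mJ \<in> patterns M \<Longrightarrow> sym_irrefl (snd mJ)"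
  by (auto simp: patterns_def pattern_def sym_irrefl_def pairs_def)

definition bad_patterns :: "graph set \<Rightarrow> nat \<Rightarrow> (nat \<times> (nat \<Rightarrow> nat \<Rightarrow> bool)) set" where
  "bad_patterns P M = {mJ \<in> patterns M. rel_graph (fst mJ) (snd mJ) \<notin> P}"

lemma copy_density_zero:
  assumes P: "hereditary P" and h: "rel_graph s h \<in> P" "sym_irrefl h" and mJ: "mJ \<in> bad_patterns P M"
  shows "copy_density s M mJ h = 0"
proof -
  have "\<not> (inj_on y {..<fst mJ} \<and> (\<forall>e\<in>pairs (fst mJ). snd mJ (fst e) (snd e) = h (y (fst e)) (y (snd e))))"
    if y: "y \<in> PiE {..<M} (\<lambda>_. {..<s})" for y
  proof
    assume c: "inj_on y {..<fst mJ} \<and> (\<forall>e\<in>pairs (fst mJ). snd mJ (fst e) (snd e) = h (y (fst e)) (y (snd e)))"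
    have "rel_graph (fst mJ) (snd mJ) \<in> P"
    proof (rule pullback_in_property[OF P h])
      show "y ` {..<fst mJ} \<subseteq> {..<s}" using y mJ patternsD(1)[of mJ M] by (force simp: bad_patterns_def PiE_iff)
      show "snd mJ p q = h (y p) (y q)" if "p < q" "q < fst mJ" for p q
        using c that by (force simp: pairs_def)
    qed (use c mJ patternsD(2)[of mJ M] in \<open>auto simp: bad_patterns_def\<close>)
    then show False using mJ by (simp add: bad_patterns_def)
  qed
  then have "copy_density s M mJ h = avg (PiE {..<M} (\<lambda>_. {..<s})) (\<lambda>_. 0)"
    unfolding copy_density_def by (intro avg_cong refl) simp
  then show ?thesis by (simp add: avg_def)
qed

text \<open>Numbering the vertices of \<open>F\<close> turns maps on \<open>verts F\<close> into
  tuples of length \<open>m\<close>, which \<open>avg_PiE_extend\<close> pads to length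
  \<open>M\<close>.\<close>

lemma pattern_of_ind:
  assumes F: "simple_graph F" "card (verts F) \<le> M" and g: "sym_irrefl g" and n: "0 < n"
  shows "\<exists>mJ\<in>patterns M. graph_iso (rel_graph (fst mJ) (snd mJ)) F \<and> ind F (rel_graph n g) \<le> copy_density n M mJ g"
proof -
  define m where "m = card (verts F)"
  have fin: "finite (verts F)" using F by (simp add: simple_graph_def)
  obtain x where x: "bij_betw x {..<m} (verts F)"
    using ex_bij_betw_nat_finite[OF fin] by (auto simp: m_def atLeast0LessThan)
  define E where "E = {e \<in> pairs m. {x (fst e), x (snd e)} \<in> edges F}"
  define mJ where "mJ = pattern (m, E)"
  have m: "m \<le> M" using F by (simp add: m_def)
  have "pairs m \<subseteq> pairs M" using m by (auto simp: pairs_def)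
  then have pat: "mJ \<in> patterns M" using m by (auto simp: mJ_def patterns_def E_def)
  have enum: "enumerates x F" using x by (simp add: enumerates_def m_def)
  have fst: "fst mJ = m" by (simp add: mJ_def pattern_def)
  have J: "snd mJ i j = edge_access x F i j" if "i < m" "j < m" for i j
  proof -
    have "{x i, x j} \<notin> edges F" if "i = j" using F that by (auto simp: simple_graph_def)
    then show ?thesis
      using that by (cases i j rule: linorder_cases)
        (auto simp: mJ_def pattern_def E_def pairs_def edge_access_def insert_commute)
  qed
  have iso: "graph_iso (rel_graph (fst mJ) (snd mJ)) F"
    unfolding fst
  proof (rule iso_edge_access[OF F(1) enum m_def])
    show "snd mJ i j = snd mJ j i" for i j using patternsD(2)[OF pat] by (rule sym_irreflD)
  qed (rule J)
  define ok where "ok y \<longleftrightarrow> inj_on y {..<m} \<and> (\<forall>e\<in>pairs m. snd mJ (fst e) (snd e) = g (y (fst e)) (y (snd e)))" for y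
  have ok_restrict: "ok (restrict y {..<m}) = ok y" for y
  proof -
    have "inj_on (restrict y {..<m}) {..<m} = inj_on y {..<m}" by (rule inj_on_cong) simp
    then show ?thesis by (auto simp: ok_def pairs_def)
  qed
  have V: "finite {..<n}" "{..<n} \<noteq> {}" using n by auto
  let ?res = "\<lambda>\<phi>. restrict (\<lambda>i. \<phi> (x i)) {..<m}"
  have bij: "bij_betw ?res (PiE (verts F) (\<lambda>_. {..<n})) (PiE {..<m} (\<lambda>_. {..<n}))"
  proof (rule bij_betw_byWitness[where f' = "\<lambda>y. restrict (\<lambda>v. y (inv_into {..<m} x v)) (verts F)"])
    show "\<forall>\<phi>\<in>PiE (verts F) (\<lambda>_. {..<n}). restrict (\<lambda>v. ?res \<phi> (inv_into {..<m} x v)) (verts F) = \<phi>"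
    proof
      fix \<phi> assume \<phi>: "\<phi> \<in> PiE (verts F) (\<lambda>_. {..<n})"
      show "restrict (\<lambda>v. ?res \<phi> (inv_into {..<m} x v)) (verts F) = \<phi>"
        using \<phi> x bij_betw_inv_into_right[OF x] bij_betw_apply[OF bij_betw_inv_into[OF x]]
        by (auto simp: fun_eq_iff restrict_def PiE_iff extensional_def)
    qed
    show "\<forall>y\<in>PiE {..<m} (\<lambda>_. {..<n}). ?res (restrict (\<lambda>v. y (inv_into {..<m} x v)) (verts F)) = y"
    proof
      fix y assume y: "y \<in> PiE {..<m} (\<lambda>_. {..<n})"
      show "?res (restrict (\<lambda>v. y (inv_into {..<m} x v)) (verts F)) = y"
        using y bij_betw_inv_into_left[OF x] bij_betw_apply[OF x]
        by (auto simp: fun_eq_iff restrict_def PiE_iff extensional_def)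
    qed
    show "?res ` PiE (verts F) (\<lambda>_. {..<n}) \<subseteq> PiE {..<m} (\<lambda>_. {..<n})"
      using bij_betw_apply[OF x] by (intro image_subsetI) (simp add: restrict_PiE_iff PiE_iff)
    show "(\<lambda>y. restrict (\<lambda>v. y (inv_into {..<m} x v)) (verts F)) ` PiE {..<m} (\<lambda>_. {..<n}) \<subseteq> PiE (verts F) (\<lambda>_. {..<n})"
      using bij_betw_apply[OF bij_betw_inv_into[OF x]] by (intro image_subsetI) (simp add: restrict_PiE_iff PiE_iff)
  qed
  have "ind F (rel_graph n g) \<le> avg (PiE (verts F) (\<lambda>_. {..<n})) (\<lambda>\<phi>. of_bool (ok (?res \<phi>)))"
  proof -
    have "PiE (verts F) (\<lambda>_. {..<n}) \<noteq> {}" using V by (simp add: PiE_eq_empty_iff)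
    then have "ind F (rel_graph n g) = avg (PiE (verts F) (\<lambda>_. {..<n})) (\<lambda>\<phi>. of_bool (\<phi> \<in> {\<phi>. inj_on \<phi> (verts F) \<and>
       (\<forall>u\<in>verts F. \<forall>v\<in>verts F. {u, v} \<in> edges F \<longleftrightarrow> {\<phi> u, \<phi> v} \<in> edges (rel_graph n g))}))"
      unfolding ind_def verts_rel_graph
      by (intro prob_pmf_of_set_avg finite_PiE fin) auto
    also have "\<dots> \<le> avg (PiE (verts F) (\<lambda>_. {..<n})) (\<lambda>\<phi>. of_bool (ok (?res \<phi>)))"
    proof (intro avg_mono of_bool_mono)
      fix \<phi> assume \<phi>: "\<phi> \<in> PiE (verts F) (\<lambda>_. {..<n})"
        and "\<phi> \<in> {\<phi>. inj_on \<phi> (verts F) \<and>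
       (\<forall>u\<in>verts F. \<forall>v\<in>verts F. {u, v} \<in> edges F \<longleftrightarrow> {\<phi> u, \<phi> v} \<in> edges (rel_graph n g))}"
      then have c: "inj_on \<phi> (verts F)"
        "\<And>u v. u \<in> verts F \<Longrightarrow> v \<in> verts F \<Longrightarrow> {u, v} \<in> edges F \<longleftrightarrow> {\<phi> u, \<phi> v} \<in> edges (rel_graph n g)" by auto
      have "inj_on (\<lambda>i. \<phi> (x i)) {..<m}"
        using comp_inj_on[of x "{..<m}" \<phi>] c(1) x by (simp add: bij_betw_def o_def)
      moreover have "snd mJ p q = g (\<phi> (x p)) (\<phi> (x q))" if pq: "p < q" "q < m" for p q
      proof -
        have v: "x p \<in> verts F" "x q \<in> verts F" using pq bij_betw_apply[OF x] by auto
        have "x p \<noteq> x q" using pq inj_on_eq_iff[OF bij_betw_imp_inj_on[OF x], of p q] by simp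
        then have "\<phi> (x p) \<noteq> \<phi> (x q)" using inj_on_eq_iff[OF c(1)] v by simp
        then show ?thesis
          using J[of p q] pq c(2)[OF v] \<phi> v
          by (auto simp: edge_access_def edge_rel_graph[OF sym_irreflD(1)[OF g]])
      qed
      ultimately have "ok (\<lambda>i. \<phi> (x i))" by (auto simp: ok_def pairs_def)
      then show "ok (?res \<phi>)" unfolding ok_restrict .
    qed
    finally show ?thesis .
  qed
  also have "\<dots> = avg (PiE {..<m} (\<lambda>_. {..<n})) (\<lambda>y. of_bool (ok y))"
    by (rule avg_bij[OF bij, symmetric])
  also have "\<dots> = avg (PiE {..<M} (\<lambda>_. {..<n})) (\<lambda>y. of_bool (ok (restrict y {..<m})))"
    by (rule avg_PiE_extend[OF V m, symmetric])
  also have "\<dots> = copy_density n M mJ g"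
    unfolding ok_restrict unfolding copy_density_def fst ok_def ..
  finally show ?thesis using pat iso by blast
qed

section \<open>The removal hypothesis for a fixed number of vertices\<close>

definition removal :: "graph set \<Rightarrow> nat \<Rightarrow> nat \<Rightarrow> real \<Rightarrow> real \<Rightarrow> bool" where
  "removal P n M \<epsilon> \<delta> \<longleftrightarrow> (\<forall>g. sym_irrefl g \<and> far_rel P n (\<epsilon> / 2) g \<longrightarrow>
     (\<exists>mJ\<in>bad_patterns P M. \<delta> \<le> copy_density n M mJ g))"

lemma removal_of_ind:
  assumes P: "hereditary P" and n: "0 < n" "n\<^sub>0 \<le> n"
    and hyp: "\<forall>G. simple_graph G \<and> card (verts G) \<ge> n\<^sub>0 \<and> far_from P (\<epsilon> / 2) G \<longrightarrow>
      (\<exists>F. simple_graph F \<and> F \<notin> P \<and> card (verts F) \<le> M \<and> ind F G \<ge> \<delta>)"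
  shows "removal P n M \<epsilon> \<delta>"
  unfolding removal_def
proof (intro allI impI)
  fix g assume g: "sym_irrefl g \<and> far_rel P n (\<epsilon> / 2) g"
  let ?G = "rel_graph n g"
  have gp: "graph_property P" using P by (simp add: hereditary_def)
  have "far_rel P n (\<epsilon> / 2) (edge_access id ?G)"
  proof -
    have gs: "sym_irrefl g" using g by blast
    have "edge_access id ?G i j = g i j" if "i < n" "j < n" for i j
      using that sym_irreflD(2)[OF gs, of i]
      by (auto simp: edge_access_def edge_rel_graph[OF sym_irreflD(1)[OF gs]])
    then have "edit n (edge_access id ?G) h = edit n g h" for h
      by (intro edit_cong) auto
    then show ?thesis using g by (simp add: far_rel_def)
  qed
  then have "far_from P (\<epsilon> / 2) ?G"
    using far_from_iff_far_rel[OF P simple_rel_graph, of id n g n] n by (simp add: enumerates_def)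
  then obtain F where F: "simple_graph F" "F \<notin> P" "card (verts F) \<le> M" "\<delta> \<le> ind F ?G"
    using hyp n simple_rel_graph by fastforce
  obtain mJ where mJ: "mJ \<in> patterns M" "graph_iso (rel_graph (fst mJ) (snd mJ)) F" "ind F ?G \<le> copy_density n M mJ g"
    using pattern_of_ind[OF F(1,3) _ n(1), of g] g by blast
  have "rel_graph (fst mJ) (snd mJ) \<notin> P" using property_iso[OF gp mJ(2) simple_rel_graph F(1)] F(2) by blast
  then show "\<exists>mJ\<in>bad_patterns P M. \<delta> \<le> copy_density n M mJ g"
    using mJ F(4) by (intro bexI[of _ mJ]) (auto simp: bad_patterns_def)
qed

text \<open>A graph whose \<open>edit\<close> distance to its nearest member of \<open>P\<close> is
  barely \<open>\<epsilon>\<close> must have a bad pattern of density \<open>\<delta>\<close>, yet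
  each bad copy in it uses one of the few pairs where it differs from that member.\<close>

lemma epsilon_lower_bound:
  assumes P: "hereditary P" and n: "0 < n" and \<epsilon>: "0 < \<epsilon>"
    and rem: "removal P n M \<epsilon> \<delta>"
    and ex: "sym_irrefl h0" "rel_graph n h0 \<in> P"
    and far: "sym_irrefl g" "far_rel P n (\<epsilon> / 2) g"
  shows "\<delta> \<le> card (pairs M) * (\<epsilon> + 2 / (real n)\<^sup>2)"
proof -
  have n2: "0 < (real n)\<^sup>2" using n by simp
  obtain h where h: "sym_irrefl h" "rel_graph n h \<in> P"
    and least: "\<And>h'. sym_irrefl h' \<Longrightarrow> rel_graph n h' \<in> P \<Longrightarrow> card (diff_pairs n g h) \<le> card (diff_pairs n g h')"
    using ex_has_least_nat[of "\<lambda>h. sym_irrefl h \<and> rel_graph n h \<in> P" h0 "\<lambda>h. card (diff_pairs n g h)"] ex by blast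
  \<comment> \<open>The least number of pairs for which \<open>edit\<close> reaches
    \<open>\<epsilon>\<close>; rounding up is the source of \<open>2 / n\<^sup>2\<close>.\<close>
  define c where "c = nat \<lceil>\<epsilon> * (real n)\<^sup>2 / 2\<rceil>"
  have c: "\<epsilon> * (real n)\<^sup>2 / 2 \<le> c" "c \<le> \<epsilon> * (real n)\<^sup>2 / 2 + 1"
    using \<epsilon> by (simp_all add: c_def of_nat_ceiling)
  have "\<epsilon> \<le> edit n g h" using far h by (auto simp: far_rel_def)
  then have "\<epsilon> * (real n)\<^sup>2 / 2 \<le> card (diff_pairs n g h)"
    unfolding edit_eq_diff_pairs[OF far(1) h(1)] using n2 by (simp add: field_simps)
  then have "c \<le> card (diff_pairs n g h)" by (simp add: c_def nat_le_iff ceiling_le_iff)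
  then obtain D' where D': "D' \<subseteq> diff_pairs n g h" "card D' = c"
    using obtain_subset_with_card_n by blast
  \<comment> \<open>\<open>h\<close> with the pairs in \<open>D'\<close> switched to their state in
    \<open>g\<close>: a point on a shortest path from \<open>h\<close> to \<open>g\<close>.\<close>
  define g' where "g' a b \<longleftrightarrow> h a b \<noteq> (ordered a b \<in> D')" for a b
  have irr: "(a, a) \<notin> D'" for a using D' by (auto simp: diff_pairs_def)
  have g': "sym_irrefl g'"
    using h(1) irr by (auto simp: sym_irrefl_def g'_def ordered_def min.commute max.commute)
  have dgh: "diff_pairs n g' h = D'"
    using D'(1) by (auto simp: diff_pairs_def g'_def ordered_def)
  have "far_rel P n (\<epsilon> / 2) g'"
    unfolding far_rel_def
  proof (intro allI impI)
    fix h' assume h': "sym_irrefl h' \<and> rel_graph n h' \<in> P"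
    \<comment> \<open>A member of \<open>P\<close> with fewer than \<open>c\<close> differences from
      \<open>g'\<close> would be nearer to \<open>g\<close> than \<open>h\<close> is.\<close>
    have "diff_pairs n g h' \<subseteq> diff_pairs n g' h' \<union> (diff_pairs n g h - D')"
      using D'(1) by (auto simp: diff_pairs_def g'_def ordered_def)
    then have "card (diff_pairs n g h') \<le> card (diff_pairs n g' h' \<union> (diff_pairs n g h - D'))"
      by (intro card_mono) auto
    also have "\<dots> \<le> card (diff_pairs n g' h') + card (diff_pairs n g h - D')" by (rule card_Un_le)
    also have "card (diff_pairs n g h - D') = card (diff_pairs n g h) - c"
      using D' finite_subset[OF D'(1)] by (simp add: card_Diff_subset)
    finally have "c \<le> card (diff_pairs n g' h')"
      using least[of h'] h' \<open>c \<le> card (diff_pairs n g h)\<close> by linarith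
    then have "\<epsilon> * (real n)\<^sup>2 / 2 \<le> card (diff_pairs n g' h')" using c by linarith
    then show "2 * (\<epsilon> / 2) \<le> edit n g' h'"
      unfolding edit_eq_diff_pairs[OF g' conjunct1[OF h']] using n2 by (simp add: field_simps)
  qed
  then obtain mJ where mJ: "mJ \<in> bad_patterns P M" "\<delta> \<le> copy_density n M mJ g'"
    using rem g' unfolding removal_def by blast
  let ?P = "PiE {..<M} (\<lambda>_. {..<n})"
  have m: "fst mJ \<le> M" "sym_irrefl (snd mJ)" using mJ(1) patternsD[of mJ M] by (simp_all add: bad_patterns_def)
  have "copy_density n M mJ g' \<le> avg ?P (\<lambda>y. \<Sum>e\<in>pairs M. of_bool (g' (y (fst e)) (y (snd e)) \<noteq> h (y (fst e)) (y (snd e))))"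
    unfolding copy_density_def
  proof (intro avg_mono)
    fix y assume y: "y \<in> ?P"
    show "of_bool (inj_on y {..<fst mJ} \<and> (\<forall>e\<in>pairs (fst mJ). snd mJ (fst e) (snd e) = g' (y (fst e)) (y (snd e))))
      \<le> (\<Sum>e\<in>pairs M. of_bool (g' (y (fst e)) (y (snd e)) \<noteq> h (y (fst e)) (y (snd e))) :: real)"
    proof (rule of_bool_le_sum[OF finite_pairs], rule ccontr)
      assume cp: "inj_on y {..<fst mJ} \<and> (\<forall>e\<in>pairs (fst mJ). snd mJ (fst e) (snd e) = g' (y (fst e)) (y (snd e)))"
        and eq: "\<not> (\<exists>e\<in>pairs M. g' (y (fst e)) (y (snd e)) \<noteq> h (y (fst e)) (y (snd e)))"
      have "rel_graph (fst mJ) (snd mJ) \<in> P"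
      proof (rule pullback_in_property[OF P h(2,1) m(2)])
        show "inj_on y {..<fst mJ}" using cp by blast
        show "y ` {..<fst mJ} \<subseteq> {..<n}" using y m(1) by (force simp: PiE_iff)
        show "snd mJ p q = h (y p) (y q)" if "p < q" "q < fst mJ" for p q
        proof -
          have "(p, q) \<in> pairs (fst mJ)" "(p, q) \<in> pairs M" using that m(1) by (auto simp: pairs_def)
          then show ?thesis using cp eq by force
        qed
      qed
      then show False using mJ(1) by (simp add: bad_patterns_def)
    qed
  qed
  also have "\<dots> = (\<Sum>e\<in>pairs M. avg ?P (\<lambda>y. of_bool (g' (y (fst e)) (y (snd e)) \<noteq> h (y (fst e)) (y (snd e)))))"
    by (simp only: avg_sum)
  also have "\<dots> = (\<Sum>e\<in>pairs M. edit n g' h)"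
  proof (rule sum.cong[OF refl])
    fix e assume "e \<in> pairs M"
    then show "avg ?P (\<lambda>y. of_bool (g' (y (fst e)) (y (snd e)) \<noteq> h (y (fst e)) (y (snd e)))) = edit n g' h"
      unfolding edit_def
      by (intro avg_PiE_two[where f = "\<lambda>a b. of_bool (g' a b \<noteq> h a b)"])
        (use n in \<open>auto simp: pairs_def lessThan_empty_iff\<close>)
  qed
  also have "\<dots> = card (pairs M) * (2 * c / (real n)\<^sup>2)"
    unfolding edit_eq_diff_pairs[OF g' h(1)] dgh D'(2) by simp
  also have "\<dots> \<le> card (pairs M) * (\<epsilon> + 2 / (real n)\<^sup>2)"
    using c(2) n2 by (intro mult_left_mono) (auto simp: field_simps)
  finally show ?thesis using mJ(2) by linarith
qed

section \<open>The estimator\<close>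

text \<open>The demands on the estimator for fixed \<open>\<alpha>\<close> and \<open>n\<close>, in
  terms of relations on indices; the clauses about \<open>n = 0\<close> express that the empty graph
  is far.\<close>

definition good_alg :: "graph set \<Rightarrow> real \<Rightarrow> real \<Rightarrow> real \<Rightarrow> nat \<Rightarrow> decision_tree pmf \<Rightarrow> bool" where
  "good_alg P \<epsilon> c \<alpha> n A \<longleftrightarrow> (\<forall>adj. sym_irrefl adj \<longrightarrow>
     (\<forall>T\<in>set_pmf A. (\<forall>(i, j)\<in>set (queries adj T). i < n \<and> j < n \<and> i \<noteq> j) \<and> real (length (queries adj T)) \<le> c) \<and>
     (0 < n \<and> \<not> far_rel P n (\<alpha> - \<epsilon>) adj \<longrightarrow> 2 / 3 \<le> measure_pmf.prob A {T. run adj T = Close}) \<and>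
     (n = 0 \<or> far_rel P n \<alpha> adj \<longrightarrow> 2 / 3 \<le> measure_pmf.prob A {T. run adj T = Far}))"

lemma far_rel_antimono: "far_rel P n \<beta> g \<Longrightarrow> \<beta>' \<le> \<beta> \<Longrightarrow> far_rel P n \<beta>' g"
  unfolding far_rel_def by fastforce

lemma good_alg_far:
  assumes "0 \<le> c" "n = 0 \<or> (\<forall>adj. sym_irrefl adj \<longrightarrow> far_rel P n (\<alpha> - \<epsilon>) adj)"
  shows "\<exists>A. good_alg P \<epsilon> c \<alpha> n A"
  using assms by (intro exI[of _ "return_pmf (Output Far)"]) (auto simp: good_alg_def)

lemma good_alg_close:
  assumes "0 \<le> c" "0 < n" "\<forall>adj. sym_irrefl adj \<longrightarrow> \<not> far_rel P n \<alpha> adj"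
  shows "\<exists>A. good_alg P \<epsilon> c \<alpha> n A"
  using assms by (intro exI[of _ "return_pmf (Output Close)"]) (auto simp: good_alg_def)

text \<open>Reading the whole graph decides exactly whether it is \<open>\<alpha>\<close>-far, and a
  graph that is close at \<open>\<alpha> - \<epsilon>\<close> is not.\<close>

lemma good_alg_all:
  assumes c: "(real n)\<^sup>2 \<le> c" and n: "0 < n" and \<epsilon>: "0 < \<epsilon>"
  shows "\<exists>A. good_alg P \<epsilon> c \<alpha> n A"
proof -
  define dec where "dec g = (if far_rel P n \<alpha> g then Far else Close)" for g
  obtain T where T: "\<And>adj. sym_irrefl adj \<Longrightarrow>
    (\<forall>(i, j)\<in>set (queries adj T). i < n \<and> j < n \<and> i \<noteq> j) \<and> length (queries adj T) \<le> n\<^sup>2 \<and>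
    run adj T = dec (\<lambda>i j. i < n \<and> j < n \<and> adj (id i) (id j))"
    using decision_tree_exists[of id n n dec] by auto
  have dec: "dec (\<lambda>i j. i < n \<and> j < n \<and> adj (id i) (id j)) = dec adj" for adj
  proof -
    have "edit n (\<lambda>i j. i < n \<and> j < n \<and> adj (id i) (id j)) h = edit n adj h" for h
      by (rule edit_cong) auto
    then show ?thesis by (simp add: dec_def far_rel_def)
  qed
  have len: "real (length (queries adj T)) \<le> c" if "sym_irrefl adj" for adj
  proof -
    have "length (queries adj T) \<le> n\<^sup>2" using T[OF that] by blast
    then have "real (length (queries adj T)) \<le> real (n\<^sup>2)" by (rule of_nat_mono)
    also have "\<dots> \<le> c" using c by simp
    finally show ?thesis .
  qed
  have "good_alg P \<epsilon> c \<alpha> n (return_pmf T)"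
    unfolding good_alg_def
  proof (intro allI impI conjI)
    fix adj assume adj: "sym_irrefl adj"
    show "\<forall>T\<in>set_pmf (return_pmf T). (\<forall>(i, j)\<in>set (queries adj T). i < n \<and> j < n \<and> i \<noteq> j) \<and> real (length (queries adj T)) \<le> c"
      using T[OF adj] len[OF adj] by simp
    have run: "run adj T = dec adj" using T[OF adj] dec by simp
    show "2 / 3 \<le> measure_pmf.prob (return_pmf T) {T. run adj T = Close}" if "0 < n \<and> \<not> far_rel P n (\<alpha> - \<epsilon>) adj"
    proof -
      have "\<not> far_rel P n \<alpha> adj" using that far_rel_antimono[of P n \<alpha> adj "\<alpha> - \<epsilon>"] \<epsilon> by auto
      then have "run adj T = Close" by (simp add: run dec_def)
      then show ?thesis by simp
    qed
    show "2 / 3 \<le> measure_pmf.prob (return_pmf T) {T. run adj T = Far}" if "n = 0 \<or> far_rel P n \<alpha> adj"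
    proof -
      have "run adj T = Far" using that n by (simp add: run dec_def)
      then show ?thesis by simp
    qed
  qed
  then show ?thesis by blast
qed

text \<open>In terms of \<open>edit\<close>, which doubles distances, close means below
  \<open>2 * \<alpha> - 2 * \<epsilon>\<close> and far means at least \<open>2 * \<alpha>\<close>.
  This gap covers a sampling error \<open>\<eta>\<close>, a lifting error \<open>\<eta>\<close> and
  the distance \<open>\<epsilon>\<close> from the lifted graph to \<open>P\<close>, since
  \<open>2 * \<eta> \<le> \<epsilon>\<close>.\<close>

lemma good_alg_sample:
  assumes P: "hereditary P" and M: "2 \<le> M" "M \<le> D" and \<delta>: "2 / real D \<le> \<delta>"
    and n: "2 ^ (D ^ 24) \<le> n" and rem: "removal P n M \<epsilon> \<delta>"
    and \<epsilon>: "1 / (2 * (real D)\<^sup>2) \<le> \<epsilon>" and c: "(real (sample_size D))\<^sup>2 \<le> c"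
  shows "\<exists>A. good_alg P \<epsilon> c \<alpha> n A"
proof -
  define s where "s = sample_size D"
  define \<eta> where "\<eta> = 1 / (4 * (real D)\<^sup>2)"
  have D: "2 \<le> D" using M by linarith
  note Pw = pow_shift[OF D]
  have \<eta>: "0 < \<eta>" "2 * \<eta> \<le> \<epsilon>" using D \<epsilon> by (simp_all add: \<eta>_def)
  have s0: "0 < s" by (simp add: s_def sample_size_def)
  have n0: "0 < n" using n by (meson less_le_trans zero_less_numeral zero_less_power)
  define dec where "dec g = (if \<exists>h. sym_irrefl h \<and> rel_graph s h \<in> P \<and> edit s g h < 2 * \<alpha> - \<epsilon> - \<eta> then Close else Far)" for g
  define tree where "tree u = (SOME T. \<forall>adj. sym_irrefl adj \<longrightarrow>
    (\<forall>(i, j)\<in>set (queries adj T). i < n \<and> j < n \<and> i \<noteq> j) \<and> length (queries adj T) \<le> s\<^sup>2 \<and>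
    run adj T = dec (\<lambda>i j. i < s \<and> j < s \<and> adj (u i) (u j)))" for u
  have tree: "(\<forall>(i, j)\<in>set (queries adj (tree u)). i < n \<and> j < n \<and> i \<noteq> j) \<and> length (queries adj (tree u)) \<le> s\<^sup>2 \<and>
    run adj (tree u) = dec (\<lambda>i j. adj (u i) (u j))"
    if u: "u \<in> samples s n" "inj_on u {..<s}" and adj: "sym_irrefl adj" for u adj
  proof -
    have "u ` {..<s} \<subseteq> {..<n}" using u by auto
    from someI_ex[OF decision_tree_exists[OF u(2) this, of dec]] adj
    have "(\<forall>(i, j)\<in>set (queries adj (tree u)). i < n \<and> j < n \<and> i \<noteq> j) \<and> length (queries adj (tree u)) \<le> s\<^sup>2 \<and>
      run adj (tree u) = dec (\<lambda>i j. i < s \<and> j < s \<and> adj (u i) (u j))"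
      unfolding tree_def by blast
    moreover have "dec (\<lambda>i j. i < s \<and> j < s \<and> adj (u i) (u j)) = dec (\<lambda>i j. adj (u i) (u j))"
    proof -
      have "edit s (\<lambda>i j. i < s \<and> j < s \<and> adj (u i) (u j)) h = edit s (\<lambda>i j. adj (u i) (u j)) h" for h
        by (rule edit_cong) auto
      then show ?thesis by (simp add: dec_def)
    qed
    ultimately show ?thesis by simp
  qed
  \<comment> \<open>A repeated vertex would lead to an illegal query. Answering \<open>Far\<close>
    instead can be wrong only in the close case, where the collision probability is charged.\<close>
  define alg where "alg u = (if inj_on u {..<s} then tree u else Output Far)" for u
  define A where "A = map_pmf alg (pmf_of_set (samples s n))"
  have S: "finite (samples s n)" "samples s n \<noteq> {}" using n0 by (simp_all add: samples_finite samples_nonempty)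
  have prob_A: "measure_pmf.prob A {T. run adj T = v} = avg (samples s n) (\<lambda>u. of_bool (run adj (alg u) = v))" for adj v
    by (simp add: A_def prob_pmf_of_set_avg[OF S])
  have prob_ge: "2 / 3 \<le> measure_pmf.prob A {T. run adj T = v}"
    if b: "avg (samples s n) b \<le> 1 / 3" and imp: "\<And>u. u \<in> samples s n \<Longrightarrow> 0 \<le> b u"
      "\<And>u. u \<in> samples s n \<Longrightarrow> b u < 1 \<Longrightarrow> run adj (alg u) = v" for adj v b
  proof -
    have "avg (samples s n) (\<lambda>u. 1 - b u) \<le> avg (samples s n) (\<lambda>u. of_bool (run adj (alg u) = v))"
    proof (intro avg_mono)
      fix u assume u: "u \<in> samples s n"
      show "1 - b u \<le> of_bool (run adj (alg u) = v)"
        using imp[OF u] by (cases "b u < 1") auto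
    qed
    moreover have "avg (samples s n) (\<lambda>u. 1 - b u) = 1 - avg (samples s n) b"
      using avg_const[OF S, of 1] by (simp add: avg_diff)
    ultimately show ?thesis using b unfolding prob_A by linarith
  qed
  have JJ: "finite (bad_patterns P M)" "\<And>mJ. mJ \<in> bad_patterns P M \<Longrightarrow> fst mJ \<le> M"
    "card (bad_patterns P M) \<le> 2 ^ (2 * D\<^sup>2)"
  proof -
    show fin: "finite (bad_patterns P M)" by (simp add: bad_patterns_def finite_patterns)
    show "\<And>mJ. mJ \<in> bad_patterns P M \<Longrightarrow> fst mJ \<le> M" using patternsD(1) by (auto simp: bad_patterns_def)
    have "card (bad_patterns P M) \<le> card (patterns M)"
      by (intro card_mono finite_patterns) (auto simp: bad_patterns_def)
    also have "\<dots> \<le> 2 ^ (M + M\<^sup>2)" by (rule card_patterns)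
    also have "\<dots> \<le> 2 ^ (2 * D\<^sup>2)"
    proof (intro power_increasing)
      have "M\<^sup>2 \<le> D\<^sup>2" using M by (intro power_mono) auto
      moreover have "M \<le> D\<^sup>2" using M by (simp add: power2_eq_square) (meson le_square le_trans)
      ultimately show "M + M\<^sup>2 \<le> 2 * D\<^sup>2" by linarith
    qed simp
    finally show "card (bad_patterns P M) \<le> 2 ^ (2 * D\<^sup>2)" .
  qed
  have "good_alg P \<epsilon> c \<alpha> n A"
    unfolding good_alg_def
  proof (intro allI impI conjI)
    fix adj assume adj: "sym_irrefl adj"
    have "(\<forall>(i, j)\<in>set (queries adj (alg u)). i < n \<and> j < n \<and> i \<noteq> j) \<and> real (length (queries adj (alg u))) \<le> c"
      if u: "u \<in> samples s n" for u
    proof (cases "inj_on u {..<s}")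
      case True
      have "length (queries adj (tree u)) \<le> s\<^sup>2" using tree[OF u True adj] by blast
      then have "real (length (queries adj (tree u))) \<le> real (s\<^sup>2)" by (rule of_nat_mono)
      also have "\<dots> \<le> c" using c by (simp add: s_def)
      finally have "real (length (queries adj (tree u))) \<le> c" .
      moreover have "alg u = tree u" using True by (simp add: alg_def)
      ultimately show ?thesis using tree[OF u True adj] by simp
    next
      case False
      have "0 \<le> c" using c by (rule order_trans[rotated]) simp
      then show ?thesis using False by (simp add: alg_def)
    qed
    then show "\<forall>T\<in>set_pmf A. (\<forall>(i, j)\<in>set (queries adj T). i < n \<and> j < n \<and> i \<noteq> j) \<and> real (length (queries adj T)) \<le> c"
      using S by (simp add: A_def)
  next
    fix adj assume adj: "sym_irrefl adj" and close: "0 < n \<and> \<not> far_rel P n (\<alpha> - \<epsilon>) adj"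
    obtain h where h: "sym_irrefl h" "rel_graph n h \<in> P" "edit n adj h < 2 * (\<alpha> - \<epsilon>)"
      using close by (auto simp: far_rel_def not_le)
    have h3: "edit n adj h < 2 * \<alpha> - 2 * \<epsilon>" using h(3) by (simp add: algebra_simps)
    define Z where "Z u = \<bar>edit s (\<lambda>i j. adj (u i) (u j)) (\<lambda>i j. h (u i) (u j)) - edit n adj h\<bar>" for u
    show "2 / 3 \<le> measure_pmf.prob A {T. run adj T = Close}"
    proof (rule prob_ge[where b = "\<lambda>u. of_bool (\<eta> \<le> Z u) + of_bool (\<not> inj_on u {..<s})"])
      have "avg (samples s n) (\<lambda>u. of_bool (\<eta> \<le> Z u)) \<le> avg (samples s n) Z / \<eta>"
        using \<eta> by (intro avg_markov) (auto simp: Z_def)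
      also have "\<dots> \<le> (3 / sqrt s) / \<eta>"
        using edit_sample_mean[OF n0 s0, of adj h] \<eta> by (intro divide_right_mono) (auto simp: Z_def[abs_def])
      also have "\<dots> \<le> 1 / 6"
      proof -
        have "sqrt s = 2 ^ (D ^ 20)"
          by (simp add: s_def sample_size_def power_even_eq real_sqrt_unique)
        moreover have "72 * (real D)\<^sup>2 \<le> 2 ^ (D ^ 20)"
        proof -
          have "real D \<le> real (2 ^ D)" using le_two_power[of D] by (simp only: of_nat_le_iff)
          then have "(real D)\<^sup>2 \<le> (2 ^ D)\<^sup>2" by (intro power_mono) auto
          then have "72 * (real D)\<^sup>2 \<le> 128 * (2 ^ D)\<^sup>2" by (intro mult_mono) auto
          also have "128 * (2 ^ D)\<^sup>2 = (2::real) ^ 7 * 2 ^ (2 * D)" by (simp add: power_even_eq)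
          also have "\<dots> = 2 ^ (7 + 2 * D)" by (simp only: power_add)
          also have "\<dots> \<le> 2 ^ (D ^ 20)" using Pw[of 19 1] D by (intro power_increasing) auto
          finally show ?thesis .
        qed
        ultimately show ?thesis by (simp add: \<eta>_def field_simps)
      qed
      finally have p1: "avg (samples s n) (\<lambda>u. of_bool (\<eta> \<le> Z u)) \<le> 1 / 6" .
      have "avg (samples s n) (\<lambda>u. of_bool (\<not> inj_on u {..<s})) \<le> s\<^sup>2 / n"
        by (rule avg_not_inj_le[OF n0 order_refl])
      also have "\<dots> \<le> 1 / 2 ^ 3"
      proof -
        \<comment> \<open>\<open>s\<^sup>2\<close> is \<open>2 ^ (4 * D ^ 20)\<close>, so collisions
          are rare once \<open>n\<close> is at least \<open>2 ^ (D ^ 24)\<close>.\<close>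
        have "4 * D ^ 20 + 3 \<le> D ^ 24" using Pw[of 3 21] Pw[of 3 20] Pw[of 2 22] Pw[of 4 20] Pw[of 20 0] D by simp
        then have "(2::real) ^ (4 * D ^ 20 + 3) \<le> 2 ^ (D ^ 24)" by (intro power_increasing) auto
        also have "\<dots> \<le> real n" using n by (metis of_nat_le_iff of_nat_numeral of_nat_power)
        finally have "(real s)\<^sup>2 * 2 ^ 3 \<le> real n"
          by (simp add: s_def sample_size_def power_add power_mult[symmetric] mult_ac)
        then show ?thesis using n0 by (simp add: field_simps)
      qed
      finally have p2: "avg (samples s n) (\<lambda>u. of_bool (\<not> inj_on u {..<s})) \<le> 1 / 8" by simp
      show "avg (samples s n) (\<lambda>u. of_bool (\<eta> \<le> Z u) + of_bool (\<not> inj_on u {..<s})) \<le> 1 / 3"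
        unfolding avg_add using p1 p2 by linarith
      fix u assume u: "u \<in> samples s n"
        and "of_bool (\<eta> \<le> Z u) + of_bool (\<not> inj_on u {..<s}) < (1 :: real)"
      then have ok: "Z u < \<eta>" "inj_on u {..<s}" by (auto simp: of_bool_def split: if_splits)
      let ?h = "\<lambda>i j. h (u i) (u j)"
      have hs: "sym_irrefl ?h" using h(1) by (simp add: sym_irrefl_def)
      have "rel_graph s ?h \<in> P"
        by (rule pullback_in_property[OF P h(2,1) hs ok(2)]) (use u in auto)
      moreover have "edit s (\<lambda>i j. adj (u i) (u j)) ?h < 2 * \<alpha> - \<epsilon> - \<eta>"
        using ok(1) h3 \<eta>(2) unfolding Z_def by linarith
      ultimately have "dec (\<lambda>i j. adj (u i) (u j)) = Close" using hs by (auto simp: dec_def)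
      then show "run adj (alg u) = Close" using tree[OF u ok(2) adj] ok(2) by (simp add: alg_def)
    qed simp
  next
    fix adj assume adj: "sym_irrefl adj" and "n = 0 \<or> far_rel P n \<alpha> adj"
    then have far: "far_rel P n \<alpha> adj" using n0 by simp
    show "2 / 3 \<le> measure_pmf.prob A {T. run adj T = Far}"
    proof (rule prob_ge[where b = "\<lambda>u. of_bool (\<not> lifts n adj D M (bad_patterns P M) s u)"])
      have "avg (samples s n) (\<lambda>u. of_bool (\<not> lifts n adj D M (bad_patterns P M) s u)) \<le> 1 / 20"
        unfolding s_def by (rule lift_probability[OF M n sym_irreflD[OF adj] JJ])
      then show "avg (samples s n) (\<lambda>u. of_bool (\<not> lifts n adj D M (bad_patterns P M) s u)) \<le> 1 / 3" by simp
      fix u assume u: "u \<in> samples s n"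
        and "of_bool (\<not> lifts n adj D M (bad_patterns P M) s u) < (1 :: real)"
      then have ok: "lifts n adj D M (bad_patterns P M) s u" by (auto simp: of_bool_def split: if_splits)
      have "dec (\<lambda>i j. adj (u i) (u j)) = Far"
      proof (rule ccontr)
        assume "dec (\<lambda>i j. adj (u i) (u j)) \<noteq> Far"
        then obtain h where h: "sym_irrefl h" "rel_graph s h \<in> P"
          "edit s (\<lambda>i j. adj (u i) (u j)) h < 2 * \<alpha> - \<epsilon> - \<eta>"
          by (auto simp: dec_def split: if_splits)
        have sy: "\<forall>x y. h x y = h y x" using h(1) by (simp add: sym_irrefl_def)
        have ze: "\<forall>mJ\<in>bad_patterns P M. copy_density s M mJ h = 0"
          using copy_density_zero[OF P h(2,1)] by blast
        obtain h' where h': "\<forall>a. \<not> h' a a" "\<forall>a b. h' a b = h' b a"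
          "edit n adj h' \<le> edit s (\<lambda>i j. adj (u i) (u j)) h + 1 / (4 * (real D)\<^sup>2)"
          "\<forall>mJ\<in>bad_patterns P M. copy_density n M mJ h' < 2 / real D"
          using mp[OF mp[OF spec[OF ok[unfolded lifts_def], of h] sy] ze] by (elim exE conjE)
        have sh': "sym_irrefl h'" using h'(1,2) unfolding sym_irrefl_def by blast
        \<comment> \<open>The removal hypothesis is applied to the lifted graph, not to the
          input.\<close>
        have "\<not> far_rel P n (\<epsilon> / 2) h'"
        proof
          assume "far_rel P n (\<epsilon> / 2) h'"
          then obtain mJ where "mJ \<in> bad_patterns P M" "\<delta> \<le> copy_density n M mJ h'"
            using rem sh' unfolding removal_def by blast
          moreover from this(1) have "copy_density n M mJ h' < 2 / real D" using h'(4) by blast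
          ultimately show False using \<delta> by linarith
        qed
        then obtain H where H: "sym_irrefl H" "rel_graph n H \<in> P" "edit n h' H < \<epsilon>"
          by (auto simp: far_rel_def not_le)
        have "edit n adj H \<le> edit n adj h' + edit n h' H" by (rule edit_triangle)
        then have "edit n adj H < 2 * \<alpha>" using h'(3) h(3) H(3) unfolding \<eta>_def by linarith
        moreover have "2 * \<alpha> \<le> edit n adj H" using far H unfolding far_rel_def by blast
        ultimately show False by simp
      qed
      then show "run adj (alg u) = Far" using tree[OF u _ adj] by (simp add: alg_def)
    qed simp
  qed
  then show ?thesis by blast
qed

text \<open>For \<open>M = 1\<close> the set \<open>pairs M\<close> is empty and \<open>epsilon_lower_bound\<close> excludes far graphs, so nothing is
  queried once \<open>n \<ge> n\<^sub>0\<close>. This matters: the bound claimed for \<open>M = \<delta> = n\<^sub>0 = 1\<close> is two queries.\<close>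

lemma good_alg_exists:
  assumes P: "hereditary P" and \<epsilon>: "0 < \<epsilon>" and M: "1 \<le> M" and \<delta>: "0 < \<delta>"
    and D: "M \<le> D" "real M / \<delta> \<le> D" and c: "0 \<le> c"
    and rem: "\<And>n. 0 < n \<Longrightarrow> n\<^sub>0 \<le> n \<Longrightarrow> removal P n M \<epsilon> \<delta>"
    and c_small: "\<And>n. 0 < n \<Longrightarrow> n < n\<^sub>0 \<Longrightarrow> (real n)\<^sup>2 \<le> c"
    and c_large: "2 \<le> M \<Longrightarrow> (2 ^ (D ^ 24))\<^sup>2 \<le> c"
  shows "\<exists>A. good_alg P \<epsilon> c \<alpha> n A"
proof (cases "n = 0 \<or> (\<forall>adj. sym_irrefl adj \<longrightarrow> far_rel P n (\<alpha> - \<epsilon>) adj)")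
  case True
  then show ?thesis by (rule good_alg_far[OF c])
next
  case False
  \<comment> \<open>Not every graph on \<open>n\<close> vertices is far, so \<open>P\<close> has a
    member on \<open>n\<close> vertices, and \<open>\<epsilon> < \<alpha>\<close> because
    \<open>edit\<close> is nonnegative.\<close>
  then obtain adj h where h: "0 < n" "sym_irrefl h" "rel_graph n h \<in> P" "edit n adj h < 2 * (\<alpha> - \<epsilon>)"
    by (auto simp: far_rel_def not_le)
  then have n: "0 < n" and ex: "\<exists>h. sym_irrefl h \<and> rel_graph n h \<in> P" by auto
  have "0 < 2 * (\<alpha> - \<epsilon>)" by (rule le_less_trans[OF edit_nonneg h(4)])
  then have \<alpha>: "\<epsilon> < \<alpha>" by simp
  consider "(real n)\<^sup>2 \<le> c" | "n\<^sub>0 \<le> n" "\<not> (real n)\<^sup>2 \<le> c" using c_small n by (cases "n < n\<^sub>0") auto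
  then show ?thesis
  proof cases
    case 1
    then show ?thesis by (rule good_alg_all[OF _ n \<epsilon>])
  next
    case 2
    note rem = rem[OF n 2(1)]
    show ?thesis
    proof (cases "\<exists>g. sym_irrefl g \<and> far_rel P n (\<epsilon> / 2) g")
      case False
      \<comment> \<open>\<open>\<alpha>\<close> exceeds \<open>\<epsilon> / 2\<close>, so no graph
        is \<open>\<alpha>\<close>-far and the answer \<open>Close\<close> is always right.\<close>
      then have "\<not> far_rel P n \<alpha> adj" if "sym_irrefl adj" for adj
        using that far_rel_antimono[of P n \<alpha> adj "\<epsilon> / 2"] \<alpha> \<epsilon> by auto
      then show ?thesis using good_alg_close[OF c n] by blast
    next
      case True
      then have le: "\<delta> \<le> card (pairs M) * (\<epsilon> + 2 / (real n)\<^sup>2)"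
        using epsilon_lower_bound[OF P n \<epsilon> rem] ex by blast
      have M2: "2 \<le> M"
      proof (rule ccontr)
        assume "\<not> 2 \<le> M"
        then have "pairs M = {}" using M by (auto simp: pairs_def)
        then show False using le \<delta> by simp
      qed
      have D2: "2 \<le> D" using M2 D(1) by linarith
      have nD: "2 ^ (D ^ 24) \<le> n"
      proof (rule ccontr)
        assume "\<not> 2 ^ (D ^ 24) \<le> n"
        then have "real n \<le> 2 ^ (D ^ 24)" by (metis nat_le_linear of_nat_le_iff of_nat_numeral of_nat_power)
        then have "(real n)\<^sup>2 \<le> (2 ^ (D ^ 24))\<^sup>2" by (intro power_mono) auto
        then show False using c_large[OF M2] 2(2) by linarith
      qed
      have \<delta>D: "real M \<le> \<delta> * D" using D(2) \<delta> by (simp add: field_simps)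
      have "2 / real D \<le> \<delta>" using \<delta>D D2 M2 by (simp add: field_simps)
      moreover have "1 / (2 * (real D)\<^sup>2) \<le> \<epsilon>"
      proof -
        have "real M * 1 \<le> \<delta> * D" using \<delta>D by simp
        also have "\<dots> \<le> (real M)\<^sup>2 * (\<epsilon> + 2 / (real n)\<^sup>2) * D"
        proof (intro mult_right_mono)
          have "real (card (pairs M)) \<le> (real M)\<^sup>2" using card_pairs_le[of M] by (simp flip: of_nat_power)
          then have "card (pairs M) * (\<epsilon> + 2 / (real n)\<^sup>2) \<le> (real M)\<^sup>2 * (\<epsilon> + 2 / (real n)\<^sup>2)"
            using \<epsilon> by (intro mult_right_mono) auto
          then show "\<delta> \<le> (real M)\<^sup>2 * (\<epsilon> + 2 / (real n)\<^sup>2)" using le by linarith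
        qed simp
        finally have "real M * 1 \<le> real M * (real M * (\<epsilon> + 2 / (real n)\<^sup>2) * D)"
          by (simp add: power2_eq_square mult_ac)
        then have "1 \<le> real M * (\<epsilon> + 2 / (real n)\<^sup>2) * D"
          using M by (subst (asm) mult_le_cancel_left_pos) auto
        also have "\<dots> \<le> real D * (\<epsilon> + 2 / (real n)\<^sup>2) * D"
          using D(1) \<epsilon> by (intro mult_right_mono) auto
        finally have "1 / (real D)\<^sup>2 \<le> \<epsilon> + 2 / (real n)\<^sup>2"
          using D2 by (simp add: field_simps power2_eq_square)
        \<comment> \<open>The rounding term takes at most half of
          \<open>1 / D\<^sup>2\<close>.\<close>
        moreover have "2 / (real n)\<^sup>2 \<le> 1 / (2 * (real D)\<^sup>2)"
        proof -
          have "4 * D\<^sup>2 \<le> n"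
          proof -
            have "4 * D\<^sup>2 \<le> 4 * (2 ^ D)\<^sup>2" using le_two_power[of D] by (intro mult_left_mono power_mono) auto
            also have "\<dots> = 2 ^ (2 + 2 * D)" by (simp add: power_add power_even_eq)
            also have "\<dots> \<le> 2 ^ (D ^ 24)" using pow_shift[OF D2, of 23 1] D2 by (intro power_increasing) auto
            finally show ?thesis using nD by linarith
          qed
          then have "4 * (real D)\<^sup>2 \<le> real n" by (metis of_nat_le_iff of_nat_mult of_nat_numeral of_nat_power)
          also have "\<dots> \<le> (real n)\<^sup>2" using n by (intro self_le_power) auto
          finally show ?thesis using D2 n by (simp add: field_simps)
        qed
        ultimately have "1 / (real D)\<^sup>2 \<le> \<epsilon> + 1 / (2 * (real D)\<^sup>2)" by linarith
        moreover have "1 / (real D)\<^sup>2 = 2 * (1 / (2 * (real D)\<^sup>2))" by simp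
        ultimately show ?thesis by linarith
      qed
      moreover have "(real (sample_size D))\<^sup>2 \<le> c"
      proof -
        have "real (sample_size D) \<le> 2 ^ (D ^ 24)"
          using pow_shift[OF D2, of 4 20] by (simp add: sample_size_def)
        then have "(real (sample_size D))\<^sup>2 \<le> (2 ^ (D ^ 24))\<^sup>2" by (intro power_mono) auto
        then show ?thesis using c_large[OF M2] by linarith
      qed
      ultimately show ?thesis
        using good_alg_sample[OF P M2 D(1) _ nD rem] by blast
    qed
  qed
qed

text \<open>Origin of the exponent 50: \<open>D \<le> x + 1 \<le> x\<^sup>2\<close> gives
  \<open>D ^ 24 \<le> x ^ 48\<close>, and one more factor \<open>x\<^sup>2 \<ge> 4\<close> absorbs
  the coefficients.\<close>

lemma query_bound:
  fixes x :: real
  assumes D: "1 \<le> D" "D \<le> x + 1" and l: "0 \<le> l" "l \<le> x" and x: "2 \<le> x"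
  shows "2 * l + 2 * D ^ 24 \<le> x powr 50"
proof -
  have "2 * x \<le> x\<^sup>2" using x by (simp add: power2_eq_square)
  then have "D \<le> x\<^sup>2" "2 * l \<le> x\<^sup>2" using D l x by linarith+
  then have "D ^ 24 \<le> (x\<^sup>2) ^ 24" using D by (intro power_mono) auto
  also have "\<dots> = x ^ 48" by (simp flip: power_mult)
  finally have "2 * l + 2 * D ^ 24 \<le> x\<^sup>2 + 2 * x ^ 48" using \<open>2 * l \<le> x\<^sup>2\<close> by linarith
  also have "x\<^sup>2 \<le> x ^ 48" using x by (intro power_increasing) auto
  also have "x ^ 48 + 2 * x ^ 48 \<le> x\<^sup>2 * x ^ 48"
  proof -
    have "3 \<le> x\<^sup>2" using power_mono[OF x, of 2] by simp
    then have "3 * x ^ 48 \<le> x\<^sup>2 * x ^ 48" using x by (intro mult_right_mono) auto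
    then show ?thesis by simp
  qed
  also have "x\<^sup>2 * x ^ 48 = x ^ 50" by (simp flip: power_add)
  also have "\<dots> = x powr 50" using powr_realpow[of x 50] x by simp
  finally show ?thesis by simp
qed

lemma estimator_exists:
  fixes \<epsilon> \<delta> :: real and M n\<^sub>0 :: nat
  assumes P: "hereditary P" and \<epsilon>: "0 < \<epsilon>" and M: "1 \<le> M" and \<delta>: "0 < \<delta>" "\<delta> \<le> 1" and n0: "1 \<le> n\<^sub>0"
    and hyp: "\<forall>G. simple_graph G \<and> card (verts G) \<ge> n\<^sub>0 \<and> far_from P (\<epsilon> / 2) G \<longrightarrow>
      (\<exists>F. simple_graph F \<and> F \<notin> P \<and> card (verts F) \<le> M \<and> ind F G \<ge> \<delta>)"
  shows "\<exists>A. good_alg P \<epsilon> (2 powr ((real M / \<delta> + log 2 n\<^sub>0) powr 50)) \<alpha> n A"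
proof -
  define x where "x = real M / \<delta> + log 2 n\<^sub>0"
  define D where "D = nat \<lceil>real M / \<delta>\<rceil>"
  have M\<delta>: "real M \<le> real M / \<delta>" using \<delta> M by (simp add: field_simps)
  have l0: "0 \<le> log 2 n\<^sub>0" using n0 by simp
  have D: "real M / \<delta> \<le> D" "D \<le> real M / \<delta> + 1"
    using \<delta> M by (simp_all add: D_def of_nat_ceiling)
  have MD: "M \<le> D" using M\<delta> D(1) by linarith
  have x1: "real M / \<delta> \<le> x" "log 2 n\<^sub>0 \<le> x" "1 \<le> x" using M\<delta> l0 M \<delta> by (auto simp: x_def)
  have bound: "2 * log 2 n\<^sub>0 + 2 * real D ^ 24 \<le> x powr 50" if "2 \<le> x"
    using query_bound[of D x "log 2 n\<^sub>0"] that D MD M x1 l0 by simp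
  show ?thesis
  proof (rule good_alg_exists[OF P \<epsilon> M \<delta>(1) MD D(1)])
    show "removal P n M \<epsilon> \<delta>" if "0 < n" "n\<^sub>0 \<le> n" for n
      using removal_of_ind[OF P that hyp] .
    show "(real n)\<^sup>2 \<le> 2 powr ((real M / \<delta> + log 2 n\<^sub>0) powr 50)" if "0 < n" "n < n\<^sub>0" for n
    proof -
      \<comment> \<open>An \<open>n\<close> strictly between \<open>0\<close> and
        \<open>n\<^sub>0\<close> forces \<open>n\<^sub>0 \<ge> 2\<close>, so
        \<open>x \<ge> 2\<close> even for \<open>M = 1\<close>.\<close>
      have "1 \<le> log 2 n\<^sub>0" using that by (subst le_log_iff) auto
      then have "2 \<le> x" using M\<delta> M unfolding x_def by linarith
      then have "2 * log 2 n\<^sub>0 \<le> x powr 50" using bound by (smt (verit) zero_le_power of_nat_0_le_iff)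
      have "(real n)\<^sup>2 \<le> (real n\<^sub>0)\<^sup>2" using that by (intro power_mono) auto
      also have "\<dots> = 2 powr (2 * log 2 n\<^sub>0)"
      proof -
        have "2 powr (log 2 n\<^sub>0) = real n\<^sub>0" using n0 by simp
        then show ?thesis by (simp only: mult_2 powr_add power2_eq_square)
      qed
      also have "\<dots> \<le> 2 powr (x powr 50)" using \<open>2 * log 2 n\<^sub>0 \<le> x powr 50\<close> by (intro powr_mono) auto
      finally show ?thesis by (simp add: x_def)
    qed
    show "(2 ^ (D ^ 24))\<^sup>2 \<le> 2 powr ((real M / \<delta> + log 2 n\<^sub>0) powr 50)" if "2 \<le> M"
    proof -
      have "2 \<le> x" using that M\<delta> l0 unfolding x_def by linarith
      then have "2 * real D ^ 24 \<le> x powr 50" using bound l0 by linarith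
      have "(2 ^ (D ^ 24))\<^sup>2 = (2::real) ^ (2 * D ^ 24)" by (simp add: power_even_eq)
      also have "\<dots> = 2 powr (2 * real D ^ 24)" by (subst powr_realpow[symmetric]) auto
      also have "\<dots> \<le> 2 powr (x powr 50)" using \<open>2 * real D ^ 24 \<le> x powr 50\<close> by (intro powr_mono) auto
      finally show ?thesis by (simp add: x_def)
    qed
  qed simp
qed

theorem theorem1p4:
  "\<exists>c::real. c \<ge> 1 \<and>
    (\<forall>(P :: graph set) (\<epsilon> :: real) (M :: nat) (\<delta> :: real) (n\<^sub>0 :: nat).
       hereditary P \<and> 0 < \<epsilon> \<and> \<epsilon> < 1 \<and> M \<ge> 1 \<and> 0 < \<delta> \<and> \<delta> \<le> 1 \<and> n\<^sub>0 \<ge> 1 \<and>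
       (\<forall>G. simple_graph G \<and> card (verts G) \<ge> n\<^sub>0 \<and> far_from P (\<epsilon> / 2) G \<longrightarrow>
          (\<exists>F. simple_graph F \<and> F \<notin> P \<and> card (verts F) \<le> M \<and> ind F G \<ge> \<delta>)) \<longrightarrow>
       (\<exists>A. distance_estimator P \<epsilon> A \<and>
            query_complexity_at_most A (2 powr ((real M / \<delta> + log 2 (real n\<^sub>0)) powr c))))"
proof (intro exI[of _ 50] conjI allI impI)
  fix P :: "graph set" and \<epsilon> \<delta> :: real and M n\<^sub>0 :: nat
  assume asm: "hereditary P \<and> 0 < \<epsilon> \<and> \<epsilon> < 1 \<and> M \<ge> 1 \<and> 0 < \<delta> \<and> \<delta> \<le> 1 \<and> n\<^sub>0 \<ge> 1 \<and>
       (\<forall>G. simple_graph G \<and> card (verts G) \<ge> n\<^sub>0 \<and> far_from P (\<epsilon> / 2) G \<longrightarrow>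
          (\<exists>F. simple_graph F \<and> F \<notin> P \<and> card (verts F) \<le> M \<and> ind F G \<ge> \<delta>))"
  then have P: "hereditary P" by blast
  define c where "c = 2 powr ((real M / \<delta> + log 2 (real n\<^sub>0)) powr 50)"
  \<comment> \<open>The algorithm may depend on \<open>\<alpha>\<close> and \<open>n\<close>, so the
    case distinctions on them cost no queries.\<close>
  have "\<forall>\<alpha> n. \<exists>A. good_alg P \<epsilon> c \<alpha> n A"
    using asm estimator_exists[of P \<epsilon> M \<delta> n\<^sub>0] unfolding c_def by blast
  then obtain A where A: "\<And>\<alpha> n. good_alg P \<epsilon> c \<alpha> n (A \<alpha> n)" by metis
  have A': "(\<forall>T\<in>set_pmf (A \<alpha> n). (\<forall>(i, j)\<in>set (queries (edge_access x G) T). i < n \<and> j < n \<and> i \<noteq> j) \<and>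
       real (length (queries (edge_access x G) T)) \<le> c) \<and>
     (0 < n \<and> \<not> far_rel P n (\<alpha> - \<epsilon>) (edge_access x G) \<longrightarrow>
       2 / 3 \<le> measure_pmf.prob (A \<alpha> n) {T. run (edge_access x G) T = Close}) \<and>
     (n = 0 \<or> far_rel P n \<alpha> (edge_access x G) \<longrightarrow>
       2 / 3 \<le> measure_pmf.prob (A \<alpha> n) {T. run (edge_access x G) T = Far})"
    if "simple_graph G" for \<alpha> n x G
    by (rule mp[OF spec[OF A[unfolded good_alg_def]] sym_irrefl_edge_access[OF that]])
  have legal: "legal_queries A"
    unfolding legal_queries_def
  proof (intro allI impI ballI)
    fix \<alpha> G x T e
    assume "simple_graph G \<and> enumerates x G" "T \<in> set_pmf (A \<alpha> (card (verts G)))"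
      and e: "e \<in> set (queries (edge_access x G) T)"
    then have "\<forall>(i, j)\<in>set (queries (edge_access x G) T). i < card (verts G) \<and> j < card (verts G) \<and> i \<noteq> j"
      using A'[of G \<alpha> "card (verts G)" x] by blast
    then show "case e of (i, j) \<Rightarrow> i < card (verts G) \<and> j < card (verts G) \<and> i \<noteq> j" using e by blast
  qed
  have complexity: "query_complexity_at_most A c"
    unfolding query_complexity_at_most_def
  proof (intro allI impI ballI)
    fix \<alpha> G x T
    assume "simple_graph G \<and> enumerates x G" "T \<in> set_pmf (A \<alpha> (card (verts G)))"
    then show "real (length (queries (edge_access x G) T)) \<le> c"
      using A'[of G \<alpha> "card (verts G)" x] by blast
  qed
  have "distance_estimator P \<epsilon> A"
    unfolding distance_estimator_def
  proof (intro conjI legal allI impI)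
    fix \<alpha> G x assume G: "simple_graph G \<and> enumerates x G"
    let ?n = "card (verts G)"
    show "measure_pmf.prob (A \<alpha> ?n) {T. run (edge_access x G) T = Close} \<ge> 2/3" if "close_to P (\<alpha> - \<epsilon>) G"
    proof -
      \<comment> \<open>An empty graph is far for every parameter, so closeness forces a
        vertex.\<close>
      have "0 < ?n" using that far_from_empty[of G] by (cases "?n = 0") (auto simp: close_to_def)
      moreover have "\<not> far_rel P ?n (\<alpha> - \<epsilon>) (edge_access x G)"
        using that far_from_iff_far_rel[OF P _ _ refl \<open>0 < ?n\<close>] G by (auto simp: close_to_def)
      ultimately show ?thesis using A'[of G \<alpha> ?n x] G by blast
    qed
    show "measure_pmf.prob (A \<alpha> ?n) {T. run (edge_access x G) T = Far} \<ge> 2/3" if "far_from P \<alpha> G"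
    proof -
      have "?n = 0 \<or> far_rel P ?n \<alpha> (edge_access x G)"
        using that far_from_iff_far_rel[OF P _ _ refl] G by (cases "?n = 0") auto
      then show ?thesis using A'[of G \<alpha> ?n x] G by blast
    qed
  qed
  then show "\<exists>A. distance_estimator P \<epsilon> A \<and>
      query_complexity_at_most A (2 powr ((real M / \<delta> + log 2 (real n\<^sub>0)) powr 50))"
    using complexity unfolding c_def by blast
qed simp

end
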